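(* Let $(\boldsymbol r,\boldsymbol c)\in\boldsymbol{RC}$, with $\boldsymbol r$ and $\boldsymbol c$ of length $t$. Then $R^+_{\boldsymbol r}\otimes R^-_{\boldsymbol c}$ is a skew-Laurent extension of $B_{\boldsymbol r,\boldsymbol c}$ of the form $$R^+_{\boldsymbol r}\otimes R^-_{\boldsymbol c}=B_{\boldsymbol r,\boldsymbol c}\bigl[1\otimes Z_{1c_1}^{\pm1},\dots,1\otimes Z_{tc_t}^{\pm1};\,\tau_1,\dots,\tau_t\bigr]$$ for some $\tau_1,\dots,\tau_t\in\{1\}^{2n}\times H$.
   Context: Let $k$ be an arbitrary field, $n$ a positive integer, $q\in k^\times$ (no further hypothesis on $q$). All tensor products are over $k$, and $\langle\cdots\rangle$ denotes the two-sided ideal generated by the given elements. $A=\mathcal O_q(M_n(k))$ is the $k$-algebra with generators $X_{ij}$ ($1\le i,j\le n$) and relations $X_{ij}X_{lj}=qX_{lj}X_{ij}$ ($i<l$); $X_{ij}X_{im}=qX_{im}X_{ij}$ ($j<m$); $X_{ij}X_{lm}=X_{lm}X_{ij}$ ($i<l$, $j>m$); $X_{ij}X_{lm}-X_{lm}X_{ij}=(q-q^{-1})X_{im}X_{lj}$ ($i<l$, $j<m$). $\boldsymbol{RC}$ is the set of pairs $(\boldsymbol r,\boldsymbol c)$ of strictly increasing sequences $\boldsymbol r=(r_1,\dots,r_t)$, $\boldsymbol c=(c_1,\dots,c_t)$ in $\{1,\dots,n\}$ of the same length $t$ ($0\le t\le n$). Set $R^+_{\boldsymbol r,0}=A/\langle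 X_{ij}\mid j>t\text{ or }i<r_j\rangle$ and $R^-_{\boldsymbol c,0}=A/\langle X_{ij}\mid i>t\text{ or }j<c_i\rangle$, with $Y_{ij}$, $Z_{ij}$ the images of $X_{ij}$ in $R^+_{\boldsymbol r,0}$, $R^-_{\boldsymbol c,0}$ respectively. These are noetherian domains in which the $Y_{r_ss}$, respectively the $Z_{sc_s}$ ($s\le t$), are regular normal elements which commute with each other; set $R^+_{\boldsymbol r}=R^+_{\boldsymbol r,0}[Y_{r_11}^{-1},\dots,Y_{r_tt}^{-1}]$ and $R^-_{\boldsymbol c}=R^-_{\boldsymbol c,0}[Z_{1c_1}^{-1},\dots,Z_{tc_t}^{-1}]$. $B_{\boldsymbol r,\boldsymbol c}$ is the $k$-subalgebra of $R^+_{\boldsymbol r}\otimes R^-_{\boldsymbol c}$ generated by $\{Y_{il}\otimes Z_{lj}\mid l\le t,\ i\ge r_l,\ j\ge c_l\}\cup\{Y_{r_ll}^{-1}\otimes Z_{lc_l}^{-1}\mid l\le t\}$. The group $H=(k^\times)^n\times(k^\times)^n$ acts on $A$ by $(\alpha_1,\dots,\alpha_n,\beta_1,\dots,\beta_n).X_{ij}=\alpha_i\beta_jX_{ij}$, hence on $R^+_{\boldsymbol r}$ and $R^-_{\boldsymbol c}$; $H\times H$ acts on $R^+_{\boldsymbol r}\otimes R^-_{\boldsymbol c}$ factorwise and preserves $B_{\boldsymbol r,\boldsymbol c}$. The subgroup $\{1\}^{2n}\times H$ is the second factor of $H\times H$ (acting trivially on $R^+_{\boldsymbol r}$). A ring $T$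 is a skew-Laurent extension $S[x_1^{\pm1},\dots,x_t^{\pm1};\tau_1,\dots,\tau_t]$ of a subring $S$ if the $x_i$ are pairwise commuting units of $T$, the $\tau_i$ (restrict to) automorphisms of $S$ with $x_is=\tau_i(s)x_i$ for all $s\in S$, and the monomials $x_1^{m_1}\cdots x_t^{m_t}$ ($m_i\in\mathbb Z$) form a basis of $T$ as a left $S$-module. *)

theory Defs
  imports "HOL-Algebra.Algebra"
begin

section \<open>Associative algebras over a field\<close>

text \<open>The locale \<^locale>\<open>algebra\<close> of the library is restricted to commutative algebras.\<close>

locale assoc_algebra = module K A + A?: ring A for K (structure) and A (structure) +
  assumes smult_mult_left:
      "\<lbrakk>a \<in> carrier K; x \<in> carrier A; y \<in> carrier A\<rbrakk> \<Longrightarrow>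
        (a \<odot>\<^bsub>A\<^esub> x) \<otimes>\<^bsub>A\<^esub> y = a \<odot>\<^bsub>A\<^esub> (x \<otimes>\<^bsub>A\<^esub> y)"
    and smult_mult_right:
      "\<lbrakk>a \<in> carrier K; x \<in> carrier A; y \<in> carrier A\<rbrakk> \<Longrightarrow>
        x \<otimes>\<^bsub>A\<^esub> (a \<odot>\<^bsub>A\<^esub> y) = a \<odot>\<^bsub>A\<^esub> (x \<otimes>\<^bsub>A\<^esub> y)"

definition alg_hom ::
  "('k, 'm) ring_scheme \<Rightarrow> ('k, 'a, 'u) module_scheme \<Rightarrow> ('k, 'b, 'v) module_scheme \<Rightarrow> ('a \<Rightarrow> 'b) set"
  where "alg_hom K A B =
    {f \<in> ring_hom A B. \<forall>a\<in>carrier K. \<forall>x\<in>carrier A. f (a \<odot>\<^bsub>A\<^esub> x) = a \<odot>\<^bsub>B\<^esub> f x}"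

text \<open>Automorphisms are taken to be extensional, so that an automorphism is determined by its
  values on the carrier; this makes the definite descriptions below meaningful.\<close>

definition alg_auto :: "('k, 'm) ring_scheme \<Rightarrow> ('k, 'a, 'u) module_scheme \<Rightarrow> ('a \<Rightarrow> 'a) set"
  where "alg_auto K A =
    {f \<in> alg_hom K A A. bij_betw f (carrier A) (carrier A) \<and> f \<in> extensional (carrier A)}"

definition generated_subalgebra ::
  "('k, 'm) ring_scheme \<Rightarrow> ('k, 'a, 'u) module_scheme \<Rightarrow> 'a set \<Rightarrow> 'a set"
  where "generated_subalgebra K A G =
    \<Inter>{S. subring S A \<and> (\<forall>a\<in>carrier K. \<forall>x\<in>S. a \<odot>\<^bsub>A\<^esub> x \<in> S) \<and> G \<subseteq> S}"

text \<open>The library's \<^const>\<open>FactRing\<close>, with the induced scalar multiplication of cosets.\<close>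

definition quot_algebra :: "('k, 'a, 'u) module_scheme \<Rightarrow> 'a set \<Rightarrow> ('k, 'a set) module"
  where "quot_algebra A I =
    \<lparr>carrier = carrier (A Quot I), monoid.mult = monoid.mult (A Quot I), one = one (A Quot I),
     ring.zero = ring.zero (A Quot I), add = add (A Quot I),
     smult = (\<lambda>a C. \<Union>x\<in>C. I +>\<^bsub>A\<^esub> (a \<odot>\<^bsub>A\<^esub> x))\<rparr>"

text \<open>The algebra \<open>K[M]\<close> of a monoid \<open>M\<close>: finitely supported functions from \<open>M\<close> to \<open>K\<close>, with
  convolution as multiplication.\<close>

definition monoid_algebra ::
  "('k, 'm) ring_scheme \<Rightarrow> ('w, 'n) monoid_scheme \<Rightarrow> ('k, 'w \<Rightarrow> 'k) module"
  where "monoid_algebra K M =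
    \<lparr>carrier = {f. (\<forall>w\<in>carrier M. f w \<in> carrier K) \<and> (\<forall>w. w \<notin> carrier M \<longrightarrow> f w = \<zero>\<^bsub>K\<^esub>) \<and>
                   finite {w. f w \<noteq> \<zero>\<^bsub>K\<^esub>}},
     monoid.mult = (\<lambda>f g w. \<Oplus>\<^bsub>K\<^esub>p\<in>{(u, v). u \<in> carrier M \<and> v \<in> carrier M \<and>
                        f u \<noteq> \<zero>\<^bsub>K\<^esub> \<and> g v \<noteq> \<zero>\<^bsub>K\<^esub> \<and> u \<otimes>\<^bsub>M\<^esub> v = w}. f (fst p) \<otimes>\<^bsub>K\<^esub> g (snd p)),
     one = (\<lambda>w. if w = \<one>\<^bsub>M\<^esub> then \<one>\<^bsub>K\<^esub> else \<zero>\<^bsub>K\<^esub>),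
     ring.zero = (\<lambda>w. \<zero>\<^bsub>K\<^esub>),
     add = (\<lambda>f g w. f w \<oplus>\<^bsub>K\<^esub> g w),
     smult = (\<lambda>a f w. a \<otimes>\<^bsub>K\<^esub> f w)\<rparr>"

definition delta :: "('k, 'm) ring_scheme \<Rightarrow> 'w \<Rightarrow> 'w \<Rightarrow> 'k"
  where "delta K u = (\<lambda>w. if w = u then \<one>\<^bsub>K\<^esub> else \<zero>\<^bsub>K\<^esub>)"

definition free_monoid :: "'g set \<Rightarrow> 'g list monoid"
  where "free_monoid G = \<lparr>carrier = lists G, monoid.mult = (@), one = []\<rparr>"

definition free_algebra :: "('k, 'm) ring_scheme \<Rightarrow> 'g set \<Rightarrow> ('k, 'g list \<Rightarrow> 'k) module"
  where "free_algebra K G = monoid_algebra K (free_monoid G)"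


section \<open>Tensor products of algebras\<close>

text \<open>The free \<open>K\<close>-module on the set \<open>A \<times> B\<close>, with the product
  \<open>(a, b)(a', b') = (aa', bb')\<close> of its basis elements, is the monoid algebra of the product of
  the multiplicative monoids of \<open>A\<close> and \<open>B\<close>. As \<open>tensor_relations\<close> is stable, up to renaming,
  under multiplication by basis elements, the submodule it spans is an ideal, and \<open>A \<otimes> B\<close> is the
  quotient by it.\<close>

definition tensor_relations ::
  "('k, 'm) ring_scheme \<Rightarrow> ('k, 'a, 'u) module_scheme \<Rightarrow> ('k, 'b, 'v) module_scheme
    \<Rightarrow> ('a \<times> 'b \<Rightarrow> 'k) set"
  where "tensor_relations K A B =
    (let F = monoid_algebra K (A \<times>\<times> B) in
      {delta K (a \<oplus>\<^bsub>A\<^esub> a', b) \<ominus>\<^bsub>F\<^esub> (delta K (a, b) \<oplus>\<^bsub>F\<^esub> delta K (a', b)) | a a' b.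
         a \<in> carrier A \<and> a' \<in> carrier A \<and> b \<in> carrier B} \<union>
      {delta K (a, b \<oplus>\<^bsub>B\<^esub> b') \<ominus>\<^bsub>F\<^esub> (delta K (a, b) \<oplus>\<^bsub>F\<^esub> delta K (a, b')) | a b b'.
         a \<in> carrier A \<and> b \<in> carrier B \<and> b' \<in> carrier B} \<union>
      {delta K (s \<odot>\<^bsub>A\<^esub> a, b) \<ominus>\<^bsub>F\<^esub> (s \<odot>\<^bsub>F\<^esub> delta K (a, b)) | s a b.
         s \<in> carrier K \<and> a \<in> carrier A \<and> b \<in> carrier B} \<union>
      {delta K (a, s \<odot>\<^bsub>B\<^esub> b) \<ominus>\<^bsub>F\<^esub> (s \<odot>\<^bsub>F\<^esub> delta K (a, b)) | s a b.
         s \<in> carrier K \<and> a \<in> carrier A \<and> b \<in> carrier B})"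

definition tensor_ideal ::
  "('k, 'm) ring_scheme \<Rightarrow> ('k, 'a, 'u) module_scheme \<Rightarrow> ('k, 'b, 'v) module_scheme
    \<Rightarrow> ('a \<times> 'b \<Rightarrow> 'k) set"
  where "tensor_ideal K A B = Idl\<^bsub>monoid_algebra K (A \<times>\<times> B)\<^esub> (tensor_relations K A B)"

definition tensor_algebra ::
  "('k, 'm) ring_scheme \<Rightarrow> ('k, 'a, 'u) module_scheme \<Rightarrow> ('k, 'b, 'v) module_scheme
    \<Rightarrow> ('k, ('a \<times> 'b \<Rightarrow> 'k) set) module"
  where "tensor_algebra K A B =
    quot_algebra (monoid_algebra K (A \<times>\<times> B)) (tensor_ideal K A B)"

definition tensor ::
  "('k, 'm) ring_scheme \<Rightarrow> ('k, 'a, 'u) module_scheme \<Rightarrow> ('k, 'b, 'v) module_scheme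
    \<Rightarrow> 'a \<Rightarrow> 'b \<Rightarrow> ('a \<times> 'b \<Rightarrow> 'k) set"
  where "tensor K A B a b = tensor_ideal K A B +>\<^bsub>monoid_algebra K (A \<times>\<times> B)\<^esub> delta K (a, b)"

definition tensor_auto ::
  "('k, 'm) ring_scheme \<Rightarrow> ('k, 'a, 'u) module_scheme \<Rightarrow> ('k, 'b, 'v) module_scheme
    \<Rightarrow> ('a \<Rightarrow> 'a) \<Rightarrow> ('b \<Rightarrow> 'b) \<Rightarrow> ('a \<times> 'b \<Rightarrow> 'k) set \<Rightarrow> ('a \<times> 'b \<Rightarrow> 'k) set"
  where "tensor_auto K A B f g =
    (THE F. F \<in> alg_auto K (tensor_algebra K A B) \<and>
       (\<forall>a\<in>carrier A. \<forall>b\<in>carrier B. F (tensor K A B a b) = tensor K A B (f a) (g b)))"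


section \<open>Localization\<close>

definition generated_submonoid :: "('a, 'm) monoid_scheme \<Rightarrow> 'a set \<Rightarrow> 'a set"
  where "generated_submonoid M S = \<Inter>{H. submonoid H M \<and> S \<subseteq> H}"

text \<open>\<open>Q\<close>, with the canonical map \<open>\<phi>\<close>, is the algebra \<open>R[s\<^sup>-\<^sup>1 | s \<in> S]\<close> of (left) fractions of \<open>R\<close>
  with respect to the multiplicative set generated by \<open>S\<close>. It is unique up to unique isomorphism
  over \<open>R\<close> and exists, with \<open>\<phi>\<close> injective and all elements also right fractions, if the elements
  of \<open>S\<close> are regular and normal.\<close>

definition is_localization ::
  "('k, 'm) ring_scheme \<Rightarrow> ('k, 'a, 'u) module_scheme \<Rightarrow> 'a set \<Rightarrow> ('k, 'b, 'v) module_scheme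
    \<Rightarrow> ('a \<Rightarrow> 'b) \<Rightarrow> bool"
  where "is_localization K R S Q \<phi> \<longleftrightarrow>
    assoc_algebra K Q \<and> \<phi> \<in> alg_hom K R Q \<and>
    (\<forall>s\<in>generated_submonoid R S. \<phi> s \<in> Units Q) \<and>
    (\<forall>x\<in>carrier Q. \<exists>s\<in>generated_submonoid R S. \<exists>a\<in>carrier R. x = inv\<^bsub>Q\<^esub> (\<phi> s) \<otimes>\<^bsub>Q\<^esub> \<phi> a) \<and>
    (\<forall>a\<in>carrier R. \<phi> a = \<zero>\<^bsub>Q\<^esub> \<longleftrightarrow> (\<exists>s\<in>generated_submonoid R S. s \<otimes>\<^bsub>R\<^esub> a = \<zero>\<^bsub>R\<^esub>))"


section \<open>Skew-Laurent extensions\<close>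

definition left_basis :: "('a, 'm) ring_scheme \<Rightarrow> 'a set \<Rightarrow> 'i set \<Rightarrow> ('i \<Rightarrow> 'a) \<Rightarrow> bool"
  where "left_basis T S E v \<longleftrightarrow>
    v \<in> E \<rightarrow> carrier T \<and>
    (\<forall>y\<in>carrier T. \<exists>F a. finite F \<and> F \<subseteq> E \<and> a \<in> F \<rightarrow> S \<and> y = (\<Oplus>\<^bsub>T\<^esub>m\<in>F. a m \<otimes>\<^bsub>T\<^esub> v m)) \<and>
    (\<forall>F a. finite F \<and> F \<subseteq> E \<and> a \<in> F \<rightarrow> S \<and> (\<Oplus>\<^bsub>T\<^esub>m\<in>F. a m \<otimes>\<^bsub>T\<^esub> v m) = \<zero>\<^bsub>T\<^esub>
       \<longrightarrow> (\<forall>m\<in>F. a m = \<zero>\<^bsub>T\<^esub>))"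

definition laurent_monomial :: "('a, 'm) monoid_scheme \<Rightarrow> nat \<Rightarrow> (nat \<Rightarrow> 'a) \<Rightarrow> (nat \<Rightarrow> int) \<Rightarrow> 'a"
  where "laurent_monomial T t x m =
    foldr (\<lambda>i y. (x i [^]\<^bsub>T\<^esub> m i) \<otimes>\<^bsub>T\<^esub> y) [1..<Suc t] \<one>\<^bsub>T\<^esub>"

definition skew_laurent_extension ::
  "('a, 'm) ring_scheme \<Rightarrow> 'a set \<Rightarrow> nat \<Rightarrow> (nat \<Rightarrow> 'a) \<Rightarrow> (nat \<Rightarrow> 'a \<Rightarrow> 'a) \<Rightarrow> bool"
  where "skew_laurent_extension T S t x \<tau> \<longleftrightarrow>
    ring T \<and> subring S T \<and>
    (\<forall>i\<in>{1..t}. x i \<in> Units T) \<and>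
    (\<forall>i\<in>{1..t}. \<forall>j\<in>{1..t}. x i \<otimes>\<^bsub>T\<^esub> x j = x j \<otimes>\<^bsub>T\<^esub> x i) \<and>
    (\<forall>i\<in>{1..t}. \<tau> i \<in> ring_iso (T\<lparr>carrier := S\<rparr>) (T\<lparr>carrier := S\<rparr>)) \<and>
    (\<forall>i\<in>{1..t}. \<forall>s\<in>S. x i \<otimes>\<^bsub>T\<^esub> s = \<tau> i s \<otimes>\<^bsub>T\<^esub> x i) \<and>
    left_basis T S ({1..t} \<rightarrow>\<^sub>E (UNIV :: int set)) (laurent_monomial T t x)"


section \<open>Quantum matrices\<close>

type_synonym 'k qmat = "((nat \<times> nat) list \<Rightarrow> 'k) set"

definition qmat_relations :: "('k, 'm) ring_scheme \<Rightarrow> 'k \<Rightarrow> nat \<Rightarrow> ((nat \<times> nat) list \<Rightarrow> 'k) set"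
  where "qmat_relations K q n =
    (let F = free_algebra K ({1..n} \<times> {1..n}); x = (\<lambda>i j. delta K [(i, j)]) in
      {x i j \<otimes>\<^bsub>F\<^esub> x l j \<ominus>\<^bsub>F\<^esub> q \<odot>\<^bsub>F\<^esub> (x l j \<otimes>\<^bsub>F\<^esub> x i j) | i l j.
         i \<in> {1..n} \<and> l \<in> {1..n} \<and> j \<in> {1..n} \<and> i < l} \<union>
      {x i j \<otimes>\<^bsub>F\<^esub> x i m \<ominus>\<^bsub>F\<^esub> q \<odot>\<^bsub>F\<^esub> (x i m \<otimes>\<^bsub>F\<^esub> x i j) | i j m.
         i \<in> {1..n} \<and> j \<in> {1..n} \<and> m \<in> {1..n} \<and> j < m} \<union>
      {x i j \<otimes>\<^bsub>F\<^esub> x l m \<ominus>\<^bsub>F\<^esub> x l m \<otimes>\<^bsub>F\<^esub> x i j | i j l m.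
         i \<in> {1..n} \<and> j \<in> {1..n} \<and> l \<in> {1..n} \<and> m \<in> {1..n} \<and> i < l \<and> j > m} \<union>
      {(x i j \<otimes>\<^bsub>F\<^esub> x l m \<ominus>\<^bsub>F\<^esub> x l m \<otimes>\<^bsub>F\<^esub> x i j)
         \<ominus>\<^bsub>F\<^esub> (q \<ominus>\<^bsub>K\<^esub> inv\<^bsub>K\<^esub> q) \<odot>\<^bsub>F\<^esub> (x i m \<otimes>\<^bsub>F\<^esub> x l j) | i j l m.
         i \<in> {1..n} \<and> j \<in> {1..n} \<and> l \<in> {1..n} \<and> m \<in> {1..n} \<and> i < l \<and> j < m})"

definition qmat_ideal :: "('k, 'm) ring_scheme \<Rightarrow> 'k \<Rightarrow> nat \<Rightarrow> ((nat \<times> nat) list \<Rightarrow> 'k) set"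
  where "qmat_ideal K q n = Idl\<^bsub>free_algebra K ({1..n} \<times> {1..n})\<^esub> (qmat_relations K q n)"

definition qmat :: "('k, 'm) ring_scheme \<Rightarrow> 'k \<Rightarrow> nat \<Rightarrow> ('k, 'k qmat) module"
  where "qmat K q n = quot_algebra (free_algebra K ({1..n} \<times> {1..n})) (qmat_ideal K q n)"

definition qmat_X :: "('k, 'm) ring_scheme \<Rightarrow> 'k \<Rightarrow> nat \<Rightarrow> nat \<Rightarrow> nat \<Rightarrow> 'k qmat"
  where "qmat_X K q n i j =
    qmat_ideal K q n +>\<^bsub>free_algebra K ({1..n} \<times> {1..n})\<^esub> delta K [(i, j)]"

definition RC :: "nat \<Rightarrow> (nat list \<times> nat list) set"
  where "RC n = {(r, c). length r = length c \<and> sorted_wrt (<) r \<and> sorted_wrt (<) c \<and>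
    set r \<subseteq> {1..n} \<and> set c \<subseteq> {1..n}}"

text \<open>Sequences are indexed from 1.\<close>

definition ent :: "nat list \<Rightarrow> nat \<Rightarrow> nat"
  where "ent r j = r ! (j - 1)"


subsection \<open>The algebras \<open>R\<^sup>+\<close> and \<open>R\<^sup>-\<close>\<close>

definition Rp0_ideal :: "('k, 'm) ring_scheme \<Rightarrow> 'k \<Rightarrow> nat \<Rightarrow> nat list \<Rightarrow> 'k qmat set"
  where "Rp0_ideal K q n r = Idl\<^bsub>qmat K q n\<^esub> {qmat_X K q n i j | i j.
    i \<in> {1..n} \<and> j \<in> {1..n} \<and> (j > length r \<or> i < ent r j)}"

definition Rp0 :: "('k, 'm) ring_scheme \<Rightarrow> 'k \<Rightarrow> nat \<Rightarrow> nat list \<Rightarrow> ('k, 'k qmat set) module"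
  where "Rp0 K q n r = quot_algebra (qmat K q n) (Rp0_ideal K q n r)"

definition Rp0_Y :: "('k, 'm) ring_scheme \<Rightarrow> 'k \<Rightarrow> nat \<Rightarrow> nat list \<Rightarrow> nat \<Rightarrow> nat \<Rightarrow> 'k qmat set"
  where "Rp0_Y K q n r i j = Rp0_ideal K q n r +>\<^bsub>qmat K q n\<^esub> qmat_X K q n i j"

definition Rm0_ideal :: "('k, 'm) ring_scheme \<Rightarrow> 'k \<Rightarrow> nat \<Rightarrow> nat list \<Rightarrow> 'k qmat set"
  where "Rm0_ideal K q n c = Idl\<^bsub>qmat K q n\<^esub> {qmat_X K q n i j | i j.
    i \<in> {1..n} \<and> j \<in> {1..n} \<and> (i > length c \<or> j < ent c i)}"

definition Rm0 :: "('k, 'm) ring_scheme \<Rightarrow> 'k \<Rightarrow> nat \<Rightarrow> nat list \<Rightarrow> ('k, 'k qmat set) module"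
  where "Rm0 K q n c = quot_algebra (qmat K q n) (Rm0_ideal K q n c)"

definition Rm0_Z :: "('k, 'm) ring_scheme \<Rightarrow> 'k \<Rightarrow> nat \<Rightarrow> nat list \<Rightarrow> nat \<Rightarrow> nat \<Rightarrow> 'k qmat set"
  where "Rm0_Z K q n c i j = Rm0_ideal K q n c +>\<^bsub>qmat K q n\<^esub> qmat_X K q n i j"

definition is_Rp ::
  "('k, 'm) ring_scheme \<Rightarrow> 'k \<Rightarrow> nat \<Rightarrow> nat list \<Rightarrow> ('k, 'a, 'u) module_scheme
    \<Rightarrow> ('k qmat set \<Rightarrow> 'a) \<Rightarrow> bool"
  where "is_Rp K q n r P \<phi> \<longleftrightarrow>
    is_localization K (Rp0 K q n r) {Rp0_Y K q n r (ent r s) s | s. s \<in> {1..length r}} P \<phi>"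

definition is_Rm ::
  "('k, 'm) ring_scheme \<Rightarrow> 'k \<Rightarrow> nat \<Rightarrow> nat list \<Rightarrow> ('k, 'b, 'v) module_scheme
    \<Rightarrow> ('k qmat set \<Rightarrow> 'b) \<Rightarrow> bool"
  where "is_Rm K q n c N \<psi> \<longleftrightarrow>
    is_localization K (Rm0 K q n c) {Rm0_Z K q n c s (ent c s) | s. s \<in> {1..length c}} N \<psi>"

text \<open>In the following, \<open>y\<close> and \<open>z\<close> are the families of the images of the \<open>X\<^sub>i\<^sub>j\<close> in \<open>P = R\<^sup>+\<close> and
  \<open>N = R\<^sup>-\<close>.\<close>

definition Brc ::
  "('k, 'm) ring_scheme \<Rightarrow> nat \<Rightarrow> nat list \<Rightarrow> nat list \<Rightarrow>
    ('k, 'a, 'u) module_scheme \<Rightarrow> (nat \<Rightarrow> nat \<Rightarrow> 'a) \<Rightarrow>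
    ('k, 'b, 'v) module_scheme \<Rightarrow> (nat \<Rightarrow> nat \<Rightarrow> 'b) \<Rightarrow> ('a \<times> 'b \<Rightarrow> 'k) set set"
  where "Brc K n r c P y N z = generated_subalgebra K (tensor_algebra K P N)
    ({tensor K P N (y i l) (z l j) | i j l.
        l \<in> {1..length r} \<and> i \<in> {1..n} \<and> j \<in> {1..n} \<and> i \<ge> ent r l \<and> j \<ge> ent c l} \<union>
     {tensor K P N (inv\<^bsub>P\<^esub> (y (ent r l) l)) (inv\<^bsub>N\<^esub> (z l (ent c l))) | l. l \<in> {1..length r}})"


subsection \<open>The torus action\<close>

definition torus :: "('k, 'm) ring_scheme \<Rightarrow> nat \<Rightarrow> ((nat \<Rightarrow> 'k) \<times> (nat \<Rightarrow> 'k)) set"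
  where "torus K n = ({1..n} \<rightarrow>\<^sub>E Units K) \<times> ({1..n} \<rightarrow>\<^sub>E Units K)"

definition torus_one :: "('k, 'm) ring_scheme \<Rightarrow> nat \<Rightarrow> (nat \<Rightarrow> 'k) \<times> (nat \<Rightarrow> 'k)"
  where "torus_one K n = ((\<lambda>i\<in>{1..n}. \<one>\<^bsub>K\<^esub>), (\<lambda>i\<in>{1..n}. \<one>\<^bsub>K\<^esub>))"

text \<open>The automorphism by which \<open>(\<alpha>, \<beta>)\<close> acts on an algebra \<open>Q\<close> obtained from the algebra of quantum
  matrices by factoring and localizing, where \<open>x\<close> is the family of the images of the \<open>X\<^sub>i\<^sub>j\<close> in \<open>Q\<close>.
  It is unique as \<open>Q\<close> is generated by the \<open>x i j\<close> and the inverses of some of them.\<close>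

definition torus_act ::
  "('k, 'm) ring_scheme \<Rightarrow> nat \<Rightarrow> ('k, 'a, 'u) module_scheme \<Rightarrow> (nat \<Rightarrow> nat \<Rightarrow> 'a)
    \<Rightarrow> (nat \<Rightarrow> 'k) \<times> (nat \<Rightarrow> 'k) \<Rightarrow> 'a \<Rightarrow> 'a"
  where "torus_act K n Q x h = (THE f. f \<in> alg_auto K Q \<and>
    (\<forall>i\<in>{1..n}. \<forall>j\<in>{1..n}. f (x i j) = (fst h i \<otimes>\<^bsub>K\<^esub> snd h j) \<odot>\<^bsub>Q\<^esub> x i j))"

definition torus2_act ::
  "('k, 'm) ring_scheme \<Rightarrow> nat \<Rightarrow> ('k, 'a, 'u) module_scheme \<Rightarrow> (nat \<Rightarrow> nat \<Rightarrow> 'a)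
    \<Rightarrow> ('k, 'b, 'v) module_scheme \<Rightarrow> (nat \<Rightarrow> nat \<Rightarrow> 'b)
    \<Rightarrow> ((nat \<Rightarrow> 'k) \<times> (nat \<Rightarrow> 'k)) \<times> ((nat \<Rightarrow> 'k) \<times> (nat \<Rightarrow> 'k))
    \<Rightarrow> ('a \<times> 'b \<Rightarrow> 'k) set \<Rightarrow> ('a \<times> 'b \<Rightarrow> 'k) set"
  where "torus2_act K n P y N z h =
    tensor_auto K P N (torus_act K n P y (fst h)) (torus_act K n N z (snd h))"

end

(*
  In R^- the element Z_{s c_s} commutes with every Z_{lj} up to the scalar q^([l = s] - [j = c_s]), so
  conjugation by 1 (x) Z_{s c_s} is the action of the torus element with alpha_s = q, beta_{c_s} = q^{-1}
  and all other entries 1. It preserves B, as it multiplies the generators of B by scalars. Together with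
  the 1 (x) Z_{s c_s} and their inverses, B generates the whole tensor product, which is therefore
  spanned over B by the Laurent monomials. For their independence, use that the relations of quantum
  matrices are homogeneous for the degree of columns as well as for that of rows: by the universal
  properties of the free algebra, quotients, localizations and tensor products there is an algebra
  homomorphism from T = R^+ (x) R^- to the group algebra T[Z^t] with Y_{ij} |-> Y_{ij} u^{-e_j} and
  Z_{ij} |-> Z_{ij} u^{e_i}. It is the identity on B and multiplies a Laurent monomial with exponent m by
  u^m, so a relation sum b_m x^m = 0 gives b_m x^m = 0 for each m, and x^m is a unit.
*)

theory Submission
  imports Defs
begin

section \<open>Monoid algebras\<close>

text \<open>The algebras \<open>P\<close> and \<open>N\<close> enter only through the defining
  property of a localization, without any explicit basis, so linear independence cannot be read off
  from normal forms. The grading map takes the place of a basis. Its weights are chosen so that the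
  shared index \<open>l\<close> cancels in \<open>y i l \<otimes> z l j\<close> while
  \<open>z s (ent c s)\<close> receives the s-th unit vector. That the pivots Z_{s c_s} commute with
  generators up to scalars is special to R^-: when the fourth quantum relation applies to a pivot
  and a nonzero generator, one factor of its correction term lies at a position killed in R^-,
  either directly by its column or because \<open>c\<close> is increasing. \<open>torus_act\<close>
  and \<open>tensor_auto\<close> are definite descriptions, so identifying them with conjugations
  needs uniqueness besides existence. Uniqueness comes from generation: a homomorphism is determined
  by the images of the X_{ij}, because these also determine the images of the inverted ones.
  Stability of \<open>B\<close> under conjugation is needed in both directions, by a pivot and by
  its inverse; an eigenvector relation with a unit eigenvalue gives both at once.\<close>

text \<open>The scalar action is a parameter, so that the case \<open>K[M]\<close> and that of a \<open>K\<close>-algebra of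
  coefficients, not necessarily commutative, are treated together.\<close>

definition conv_algebra ::
  "('a, 'm) ring_scheme \<Rightarrow> ('w, 'n) monoid_scheme \<Rightarrow> ('k \<Rightarrow> ('w \<Rightarrow> 'a) \<Rightarrow> 'w \<Rightarrow> 'a)
    \<Rightarrow> ('k, 'w \<Rightarrow> 'a) module"
  where "conv_algebra R M s =
    \<lparr>carrier = carrier (monoid_algebra R M), monoid.mult = monoid.mult (monoid_algebra R M),
     one = one (monoid_algebra R M), ring.zero = ring.zero (monoid_algebra R M),
     add = add (monoid_algebra R M), smult = s\<rparr>"

definition single :: "('a, 'm) ring_scheme \<Rightarrow> 'w \<Rightarrow> 'a \<Rightarrow> 'w \<Rightarrow> 'a"
  where "single R u a = (\<lambda>w. if w = u then a else \<zero>\<^bsub>R\<^esub>)"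

lemma monoid_algebra_eq_conv:
  "monoid_algebra K M = conv_algebra K M (\<lambda>a f w. a \<otimes>\<^bsub>K\<^esub> f w)"
  by (simp add: conv_algebra_def monoid_algebra_def)

lemma delta_eq_single: "delta K u = single K u \<one>\<^bsub>K\<^esub>"
  by (simp add: delta_def single_def)

lemma conv_algebra_simps [simp]:
  "\<zero>\<^bsub>conv_algebra R M s\<^esub> = (\<lambda>w. \<zero>\<^bsub>R\<^esub>)"
  "f \<oplus>\<^bsub>conv_algebra R M s\<^esub> g = (\<lambda>w. f w \<oplus>\<^bsub>R\<^esub> g w)"
  "\<one>\<^bsub>conv_algebra R M s\<^esub> = single R \<one>\<^bsub>M\<^esub> \<one>\<^bsub>R\<^esub>"
  "a \<odot>\<^bsub>conv_algebra R M s\<^esub> f = s a f"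
  by (simp_all add: conv_algebra_def monoid_algebra_def single_def)

lemma mem_carrier_conv:
  "f \<in> carrier (conv_algebra R M s) \<longleftrightarrow>
    (\<forall>w. f w \<in> carrier R \<or> w \<notin> carrier M) \<and> (\<forall>w. w \<notin> carrier M \<longrightarrow> f w = \<zero>\<^bsub>R\<^esub>) \<and>
    finite {w. f w \<noteq> \<zero>\<^bsub>R\<^esub>}"
  by (auto simp add: conv_algebra_def monoid_algebra_def)

text \<open>The action \<open>s\<close> is unconstrained here, because the ring structure of
  \<open>C\<close> does not involve it; the module conditions are imposed only in
  \<open>conv_assoc_algebra\<close>.\<close>

locale monoid_ring = R?: ring R + M?: monoid M
  for R :: "('a, 'm) ring_scheme" (structure) and M :: "('w, 'n) monoid_scheme" (structure) +
  fixes s :: "'k \<Rightarrow> ('w \<Rightarrow> 'a) \<Rightarrow> 'w \<Rightarrow> 'a"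
begin

abbreviation "C \<equiv> conv_algebra R M s"

lemma conv_closed: "f \<in> carrier C \<Longrightarrow> f w \<in> carrier R"
  unfolding mem_carrier_conv by (metis R.zero_closed)

lemma supp_subset: "f \<in> carrier C \<Longrightarrow> {w. f w \<noteq> \<zero>} \<subseteq> carrier M"
  unfolding mem_carrier_conv by auto

lemma carrier_if_nonzero: "\<lbrakk>f \<in> carrier C; f w \<noteq> \<zero>\<rbrakk> \<Longrightarrow> w \<in> carrier M"
  using supp_subset by blast

lemma supp_finite: "f \<in> carrier C \<Longrightarrow> finite {w. f w \<noteq> \<zero>}"
  unfolding mem_carrier_conv by auto

lemma conv_carrierI:
  "\<lbrakk>\<And>w. f w \<in> carrier R; {w. f w \<noteq> \<zero>} \<subseteq> U; U \<subseteq> carrier M; finite U\<rbrakk> \<Longrightarrow> f \<in> carrier C"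
  unfolding mem_carrier_conv using finite_subset by (metis (mono_tags, lifting) mem_Collect_eq subsetD)

lemma single_closed [simp]: "\<lbrakk>u \<in> carrier M; a \<in> carrier R\<rbrakk> \<Longrightarrow> single R u a \<in> carrier C"
  by (rule conv_carrierI[of _ "{u}"]) (auto simp: single_def)

lemma single_supp: "{w. single R u a w \<noteq> \<zero>} \<subseteq> {u}"
  by (auto simp: single_def)

lemma conv_zero_closed: "(\<lambda>w. \<zero>) \<in> carrier C"
  by (rule conv_carrierI[of _ "{}"]) auto

lemma conv_add_closed:
  assumes "f \<in> carrier C" "g \<in> carrier C"
  shows "(\<lambda>w. f w \<oplus> g w) \<in> carrier C"
  by (rule conv_carrierI[of _ "{w. f w \<noteq> \<zero>} \<union> {w. g w \<noteq> \<zero>}"])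
    (use conv_closed[OF assms(1)] conv_closed[OF assms(2)] supp_finite[OF assms(1)] supp_finite[OF assms(2)]
      carrier_if_nonzero[OF assms(1)] carrier_if_nonzero[OF assms(2)] in auto)

lemma conv_map_closed:
  assumes "f \<in> carrier C" "\<And>x. x \<in> carrier R \<Longrightarrow> h x \<in> carrier R" "h \<zero> = \<zero>"
  shows "(\<lambda>w. h (f w)) \<in> carrier C"
  by (rule conv_carrierI[of _ "{w. f w \<noteq> \<zero>}"])
    (use assms conv_closed[OF assms(1)] supp_finite[OF assms(1)] carrier_if_nonzero[OF assms(1)] in auto)

text \<open>The convolution sum in the definition runs over an index set depending on
  \<open>f\<close>, \<open>g\<close> and \<open>w\<close>. Padding it with zeros to a fixed
  rectangle \<open>U \<times> V\<close> lets sums for different functions share one index set, as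
  distributivity requires.\<close>

lemma conv_mult:
  assumes f: "f \<in> carrier C" and g: "g \<in> carrier C"
    and U: "finite U" "{w. f w \<noteq> \<zero>} \<subseteq> U" "U \<subseteq> carrier M"
    and V: "finite V" "{w. g w \<noteq> \<zero>} \<subseteq> V" "V \<subseteq> carrier M"
  shows "(f \<otimes>\<^bsub>C\<^esub> g) w =
    (\<Oplus>p\<in>U \<times> V. if fst p \<otimes>\<^bsub>M\<^esub> snd p = w then f (fst p) \<otimes> g (snd p) else \<zero>)"
proof -
  have "(f \<otimes>\<^bsub>C\<^esub> g) w = (\<Oplus>p\<in>{(u, v). u \<in> carrier M \<and> v \<in> carrier M \<and>
      f u \<noteq> \<zero> \<and> g v \<noteq> \<zero> \<and> u \<otimes>\<^bsub>M\<^esub> v = w}. f (fst p) \<otimes> g (snd p))"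
    by (simp add: conv_algebra_def monoid_algebra_def)
  also have "\<dots> = (\<Oplus>p\<in>U \<times> V. if fst p \<otimes>\<^bsub>M\<^esub> snd p = w then f (fst p) \<otimes> g (snd p) else \<zero>)"
    by (rule R.add.finprod_mono_neutral_cong_left) (use assms conv_closed[OF f] conv_closed[OF g] in auto)
  finally show ?thesis .
qed

lemma conv_mult_closed:
  assumes f: "f \<in> carrier C" and g: "g \<in> carrier C"
  shows "f \<otimes>\<^bsub>C\<^esub> g \<in> carrier C"
proof -
  let ?U = "{w. f w \<noteq> \<zero>}" and ?V = "{w. g w \<noteq> \<zero>}"
  note e = conv_mult[OF f g supp_finite[OF f] subset_refl supp_subset[OF f]
      supp_finite[OF g] subset_refl supp_subset[OF g]]
  show ?thesis
  proof (rule conv_carrierI[of _ "(\<lambda>p. fst p \<otimes>\<^bsub>M\<^esub> snd p) ` (?U \<times> ?V)"])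
    show "(f \<otimes>\<^bsub>C\<^esub> g) w \<in> carrier R" for w
      unfolding e by (rule R.finsum_closed) (use conv_closed[OF f] conv_closed[OF g] in auto)
    show "{w. (f \<otimes>\<^bsub>C\<^esub> g) w \<noteq> \<zero>} \<subseteq> (\<lambda>p. fst p \<otimes>\<^bsub>M\<^esub> snd p) ` (?U \<times> ?V)"
    proof (rule subsetI, rule ccontr)
      fix w assume w: "w \<in> {w. (f \<otimes>\<^bsub>C\<^esub> g) w \<noteq> \<zero>}"
        and n: "w \<notin> (\<lambda>p. fst p \<otimes>\<^bsub>M\<^esub> snd p) ` (?U \<times> ?V)"
      have "(f \<otimes>\<^bsub>C\<^esub> g) w = \<zero>"
        unfolding e by (rule R.add.finprod_one_eqI) (use n in auto)
      with w show False by simp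
    qed
    show "(\<lambda>p. fst p \<otimes>\<^bsub>M\<^esub> snd p) ` (?U \<times> ?V) \<subseteq> carrier M"
      using carrier_if_nonzero[OF f] carrier_if_nonzero[OF g] by auto
    show "finite ((\<lambda>p. fst p \<otimes>\<^bsub>M\<^esub> snd p) ` (?U \<times> ?V))"
      using supp_finite[OF f] supp_finite[OF g] by simp
  qed
qed

lemma conv_l_distr:
  assumes f: "f \<in> carrier C" and g: "g \<in> carrier C" and h: "h \<in> carrier C"
  shows "(f \<oplus>\<^bsub>C\<^esub> g) \<otimes>\<^bsub>C\<^esub> h = (f \<otimes>\<^bsub>C\<^esub> h) \<oplus>\<^bsub>C\<^esub> (g \<otimes>\<^bsub>C\<^esub> h)"
proof
  fix w
  let ?U = "{w. f w \<noteq> \<zero>} \<union> {w. g w \<noteq> \<zero>}" and ?V = "{w. h w \<noteq> \<zero>}"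
  have U: "finite ?U" "?U \<subseteq> carrier M" and V: "finite ?V" "?V \<subseteq> carrier M"
    using supp_finite[OF f] supp_finite[OF g] supp_finite[OF h]
      carrier_if_nonzero[OF f] carrier_if_nonzero[OF g] carrier_if_nonzero[OF h] by auto
  have e1: "(f \<otimes>\<^bsub>C\<^esub> h) w =
    (\<Oplus>p\<in>?U \<times> ?V. if fst p \<otimes>\<^bsub>M\<^esub> snd p = w then f (fst p) \<otimes> h (snd p) else \<zero>)"
    by (rule conv_mult) (use U V f g h in auto)
  have e2: "(g \<otimes>\<^bsub>C\<^esub> h) w =
    (\<Oplus>p\<in>?U \<times> ?V. if fst p \<otimes>\<^bsub>M\<^esub> snd p = w then g (fst p) \<otimes> h (snd p) else \<zero>)"
    by (rule conv_mult) (use U V f g h in auto)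
  have "((f \<oplus>\<^bsub>C\<^esub> g) \<otimes>\<^bsub>C\<^esub> h) w =
    (\<Oplus>p\<in>?U \<times> ?V. if fst p \<otimes>\<^bsub>M\<^esub> snd p = w then (f \<oplus>\<^bsub>C\<^esub> g) (fst p) \<otimes> h (snd p) else \<zero>)"
    by (rule conv_mult) (use U V f g h in \<open>auto simp: conv_add_closed\<close>)
  also have "\<dots> = (\<Oplus>p\<in>?U \<times> ?V.
      (if fst p \<otimes>\<^bsub>M\<^esub> snd p = w then f (fst p) \<otimes> h (snd p) else \<zero>) \<oplus>
      (if fst p \<otimes>\<^bsub>M\<^esub> snd p = w then g (fst p) \<otimes> h (snd p) else \<zero>))"
    by (rule R.finsum_cong') (use conv_closed[OF f] conv_closed[OF g] conv_closed[OF h] in \<open>auto simp: R.l_distr\<close>)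
  also have "\<dots> = (f \<otimes>\<^bsub>C\<^esub> h) w \<oplus> (g \<otimes>\<^bsub>C\<^esub> h) w"
    unfolding e1 e2 by (rule R.finsum_addf) (use conv_closed[OF f] conv_closed[OF g] conv_closed[OF h] in auto)
  finally show "((f \<oplus>\<^bsub>C\<^esub> g) \<otimes>\<^bsub>C\<^esub> h) w = ((f \<otimes>\<^bsub>C\<^esub> h) \<oplus>\<^bsub>C\<^esub> (g \<otimes>\<^bsub>C\<^esub> h)) w"
    by simp
qed

lemma conv_r_distr:
  assumes f: "f \<in> carrier C" and g: "g \<in> carrier C" and h: "h \<in> carrier C"
  shows "h \<otimes>\<^bsub>C\<^esub> (f \<oplus>\<^bsub>C\<^esub> g) = (h \<otimes>\<^bsub>C\<^esub> f) \<oplus>\<^bsub>C\<^esub> (h \<otimes>\<^bsub>C\<^esub> g)"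
proof
  fix w
  let ?V = "{w. f w \<noteq> \<zero>} \<union> {w. g w \<noteq> \<zero>}" and ?U = "{w. h w \<noteq> \<zero>}"
  have U: "finite ?U" "?U \<subseteq> carrier M" and V: "finite ?V" "?V \<subseteq> carrier M"
    using supp_finite[OF f] supp_finite[OF g] supp_finite[OF h]
      carrier_if_nonzero[OF f] carrier_if_nonzero[OF g] carrier_if_nonzero[OF h] by auto
  have e1: "(h \<otimes>\<^bsub>C\<^esub> f) w =
    (\<Oplus>p\<in>?U \<times> ?V. if fst p \<otimes>\<^bsub>M\<^esub> snd p = w then h (fst p) \<otimes> f (snd p) else \<zero>)"
    by (rule conv_mult) (use U V f g h in auto)
  have e2: "(h \<otimes>\<^bsub>C\<^esub> g) w =
    (\<Oplus>p\<in>?U \<times> ?V. if fst p \<otimes>\<^bsub>M\<^esub> snd p = w then h (fst p) \<otimes> g (snd p) else \<zero>)"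
    by (rule conv_mult) (use U V f g h in auto)
  have "(h \<otimes>\<^bsub>C\<^esub> (f \<oplus>\<^bsub>C\<^esub> g)) w =
    (\<Oplus>p\<in>?U \<times> ?V. if fst p \<otimes>\<^bsub>M\<^esub> snd p = w then h (fst p) \<otimes> (f \<oplus>\<^bsub>C\<^esub> g) (snd p) else \<zero>)"
    by (rule conv_mult) (use U V f g h in \<open>auto simp: conv_add_closed\<close>)
  also have "\<dots> = (\<Oplus>p\<in>?U \<times> ?V.
      (if fst p \<otimes>\<^bsub>M\<^esub> snd p = w then h (fst p) \<otimes> f (snd p) else \<zero>) \<oplus>
      (if fst p \<otimes>\<^bsub>M\<^esub> snd p = w then h (fst p) \<otimes> g (snd p) else \<zero>))"
    by (rule R.finsum_cong') (use conv_closed[OF f] conv_closed[OF g] conv_closed[OF h] in \<open>auto simp: R.r_distr\<close>)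
  also have "\<dots> = (h \<otimes>\<^bsub>C\<^esub> f) w \<oplus> (h \<otimes>\<^bsub>C\<^esub> g) w"
    unfolding e1 e2 by (rule R.finsum_addf) (use conv_closed[OF f] conv_closed[OF g] conv_closed[OF h] in auto)
  finally show "(h \<otimes>\<^bsub>C\<^esub> (f \<oplus>\<^bsub>C\<^esub> g)) w = ((h \<otimes>\<^bsub>C\<^esub> f) \<oplus>\<^bsub>C\<^esub> (h \<otimes>\<^bsub>C\<^esub> g)) w"
    by simp
qed

lemma single_mult:
  assumes "u \<in> carrier M" "v \<in> carrier M" "a \<in> carrier R" "b \<in> carrier R"
  shows "single R u a \<otimes>\<^bsub>C\<^esub> single R v b = single R (u \<otimes>\<^bsub>M\<^esub> v) (a \<otimes> b)"
proof
  fix w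
  have "(single R u a \<otimes>\<^bsub>C\<^esub> single R v b) w =
    (\<Oplus>p\<in>{u} \<times> {v}. if fst p \<otimes>\<^bsub>M\<^esub> snd p = w then single R u a (fst p) \<otimes> single R v b (snd p) else \<zero>)"
    by (rule conv_mult) (use assms single_supp in simp_all)
  also have "\<dots> = single R (u \<otimes>\<^bsub>M\<^esub> v) (a \<otimes> b) w"
    using assms by (auto simp: single_def)
  finally show "(single R u a \<otimes>\<^bsub>C\<^esub> single R v b) w = single R (u \<otimes>\<^bsub>M\<^esub> v) (a \<otimes> b) w" .
qed

text \<open>Finite support allows one value at a time to be split off. Additive identities thereby
  reduce to \<open>single\<close>, where \<open>single_mult\<close> computes products
  explicitly.\<close>

lemma conv_induct [consumes 1, case_names zero add]:
  assumes f: "f \<in> carrier C"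
    and zero: "Q (\<lambda>w. \<zero>)"
    and add: "\<And>u a f. \<lbrakk>u \<in> carrier M; a \<in> carrier R; f \<in> carrier C; Q f\<rbrakk> \<Longrightarrow>
      Q (single R u a \<oplus>\<^bsub>C\<^esub> f)"
  shows "Q f"
proof -
  \<comment> \<open>The induction runs over a finite set \<open>U\<close> containing the support
    rather than the support itself, so that \<open>f(u := \<zero>)\<close> is covered by the
    hypothesis for the smaller set.\<close>
  have "\<lbrakk>finite U; f \<in> carrier C; {w. f w \<noteq> \<zero>} \<subseteq> U\<rbrakk> \<Longrightarrow> Q f" for U f
  proof (induct U arbitrary: f rule: finite_induct)
    case empty
    then have "f = (\<lambda>w. \<zero>)" by auto
    with zero show ?case by simp
  next
    case (insert u U)
    show ?case
    proof (cases "f u = \<zero>")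
      case True
      with insert show ?thesis by blast
    next
      case False
      let ?g = "f(u := \<zero>)"
      have u: "u \<in> carrier M" using False insert by (simp add: carrier_if_nonzero)
      have s: "{w. ?g w \<noteq> \<zero>} \<subseteq> {w. f w \<noteq> \<zero>}" "{w. ?g w \<noteq> \<zero>} \<subseteq> U" using insert by auto
      have g: "?g \<in> carrier C"
        by (rule conv_carrierI[of _ "{w. f w \<noteq> \<zero>}"])
          (use conv_closed[OF insert(4)] supp_finite[OF insert(4)] carrier_if_nonzero[OF insert(4)] in auto)
      have "f = single R u (f u) \<oplus>\<^bsub>C\<^esub> ?g"
        using conv_closed[OF insert(4)] by (auto simp: single_def)
      moreover have "Q (single R u (f u) \<oplus>\<^bsub>C\<^esub> ?g)"
        by (rule add[OF u conv_closed[OF insert(4)] g insert(3)[OF g s(2)]])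
      ultimately show ?thesis by simp
    qed
  qed
  from this[OF supp_finite[OF f] f] show ?thesis by simp
qed

lemma conv_abelian_group: "abelian_group C"
proof (rule abelian_groupI)
  fix f assume f: "f \<in> carrier C"
  have "(\<lambda>w. \<ominus> f w) \<in> carrier C" by (rule conv_map_closed[OF f]) auto
  moreover have "(\<lambda>w. \<ominus> f w) \<oplus>\<^bsub>C\<^esub> f = \<zero>\<^bsub>C\<^esub>" using conv_closed[OF f] by (auto simp: R.l_neg)
  ultimately show "\<exists>g\<in>carrier C. g \<oplus>\<^bsub>C\<^esub> f = \<zero>\<^bsub>C\<^esub>" by blast
qed (auto simp: conv_zero_closed conv_add_closed
    intro!: ext R.a_assoc R.a_comm R.l_zero elim: conv_closed)

lemma zero_mult_conv:
  assumes f: "f \<in> carrier C"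
  shows "(\<lambda>w. \<zero>) \<otimes>\<^bsub>C\<^esub> f = (\<lambda>w. \<zero>)" "f \<otimes>\<^bsub>C\<^esub> (\<lambda>w. \<zero>) = (\<lambda>w. \<zero>)"
proof -
  show "(\<lambda>w. \<zero>) \<otimes>\<^bsub>C\<^esub> f = (\<lambda>w. \<zero>)"
    by (rule ext, subst conv_mult[where U = "{}" and V = "{w. f w \<noteq> \<zero>}"])
      (use f supp_finite[OF f] carrier_if_nonzero[OF f] conv_zero_closed in auto)
  show "f \<otimes>\<^bsub>C\<^esub> (\<lambda>w. \<zero>) = (\<lambda>w. \<zero>)"
    by (rule ext, subst conv_mult[where V = "{}" and U = "{w. f w \<noteq> \<zero>}"])
      (use f supp_finite[OF f] carrier_if_nonzero[OF f] conv_zero_closed in auto)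
qed

text \<open>Both sides are additive in each argument, so \<open>h\<close>, then \<open>g\<close>,
  then \<open>f\<close> may be replaced by \<open>single\<close> functions; what remains is
  associativity in \<open>R\<close> and in \<open>M\<close>.\<close>

lemma conv_assoc:
  assumes f: "f \<in> carrier C" and g: "g \<in> carrier C" and h: "h \<in> carrier C"
  shows "(f \<otimes>\<^bsub>C\<^esub> g) \<otimes>\<^bsub>C\<^esub> h = f \<otimes>\<^bsub>C\<^esub> (g \<otimes>\<^bsub>C\<^esub> h)"
proof -
  note [simp del] = conv_algebra_simps
  note [simp] = conv_mult_closed conv_l_distr conv_r_distr single_mult zero_mult_conv
    conv_zero_closed abelian_monoid.a_closed[OF abelian_group.axioms(1)[OF conv_abelian_group]]
  have 1: "(single R u a \<otimes>\<^bsub>C\<^esub> single R v b) \<otimes>\<^bsub>C\<^esub> h = single R u a \<otimes>\<^bsub>C\<^esub> (single R v b \<otimes>\<^bsub>C\<^esub> h)"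
    if "u \<in> carrier M" "a \<in> carrier R" "v \<in> carrier M" "b \<in> carrier R" for u v a b
    using h
  proof (induct h rule: conv_induct)
    case (add w c h)
    with that show ?case
      by (simp add: R.m_assoc M.m_assoc)
  qed (use that in simp)
  have 2: "(single R u a \<otimes>\<^bsub>C\<^esub> g) \<otimes>\<^bsub>C\<^esub> h = single R u a \<otimes>\<^bsub>C\<^esub> (g \<otimes>\<^bsub>C\<^esub> h)"
    if "u \<in> carrier M" "a \<in> carrier R" for u a
    using g
  proof (induct g rule: conv_induct)
    case (add w c g)
    have "(single R u a \<otimes>\<^bsub>C\<^esub> (single R w c)) \<otimes>\<^bsub>C\<^esub> h = single R u a \<otimes>\<^bsub>C\<^esub> ((single R w c) \<otimes>\<^bsub>C\<^esub> h)"
      by (rule 1) (use that add in auto)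
    with that h add show ?case
      by (simp del: single_mult)
  qed (use that h in simp)
  show ?thesis
    using f by (induct f rule: conv_induct) (use g h 2 in simp_all)
qed

lemma conv_one:
  assumes f: "f \<in> carrier C"
  shows "\<one>\<^bsub>C\<^esub> \<otimes>\<^bsub>C\<^esub> f = f" "f \<otimes>\<^bsub>C\<^esub> \<one>\<^bsub>C\<^esub> = f"
proof -
  note [simp del] = conv_algebra_simps(2)
  show "\<one>\<^bsub>C\<^esub> \<otimes>\<^bsub>C\<^esub> f = f"
    using f by (induct f rule: conv_induct)
      (auto simp: zero_mult_conv conv_r_distr single_mult)
  show "f \<otimes>\<^bsub>C\<^esub> \<one>\<^bsub>C\<^esub> = f"
    using f by (induct f rule: conv_induct)
      (auto simp: zero_mult_conv conv_l_distr single_mult)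
qed

lemma conv_ring: "ring C"
proof (rule ringI)
  show "monoid C"
    by (rule monoidI) (use conv_one conv_assoc conv_mult_closed in auto)
qed (use conv_abelian_group conv_l_distr conv_r_distr in auto)

text \<open>\<open>t\<close> is the scalar action on coefficients, tied to \<open>s\<close> by
  \<open>sp\<close>. Since \<open>s a\<close> is additive, every axiom follows from its counterpart
  for \<open>t\<close> by induction over \<open>single\<close> functions.\<close>

lemma conv_assoc_algebra:
  assumes K: "cring K"
    and sc: "\<And>a f. \<lbrakk>a \<in> carrier K; f \<in> carrier C\<rbrakk> \<Longrightarrow> s a f \<in> carrier C"
    and sp: "\<And>a u b. \<lbrakk>a \<in> carrier K; u \<in> carrier M; b \<in> carrier R\<rbrakk> \<Longrightarrow>
      s a (single R u b) = single R u (t a b)"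
    and tc: "\<And>a b. \<lbrakk>a \<in> carrier K; b \<in> carrier R\<rbrakk> \<Longrightarrow> t a b \<in> carrier R"
    and sa: "\<And>a f g. \<lbrakk>a \<in> carrier K; f \<in> carrier C; g \<in> carrier C\<rbrakk> \<Longrightarrow>
      s a (f \<oplus>\<^bsub>C\<^esub> g) = s a f \<oplus>\<^bsub>C\<^esub> s a g"
    and s0: "\<And>a. a \<in> carrier K \<Longrightarrow> s a (\<lambda>w. \<zero>) = (\<lambda>w. \<zero>)"
    and t1: "\<And>b. b \<in> carrier R \<Longrightarrow> t \<one>\<^bsub>K\<^esub> b = b"
    and t2: "\<And>a a' b. \<lbrakk>a \<in> carrier K; a' \<in> carrier K; b \<in> carrier R\<rbrakk> \<Longrightarrow>
      t (a \<otimes>\<^bsub>K\<^esub> a') b = t a (t a' b)"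
    and t3: "\<And>a a' b. \<lbrakk>a \<in> carrier K; a' \<in> carrier K; b \<in> carrier R\<rbrakk> \<Longrightarrow>
      t (a \<oplus>\<^bsub>K\<^esub> a') b = t a b \<oplus> t a' b"
    and t4: "\<And>a b b'. \<lbrakk>a \<in> carrier K; b \<in> carrier R; b' \<in> carrier R\<rbrakk> \<Longrightarrow>
      t a b \<otimes> b' = t a (b \<otimes> b')"
    and t5: "\<And>a b b'. \<lbrakk>a \<in> carrier K; b \<in> carrier R; b' \<in> carrier R\<rbrakk> \<Longrightarrow>
      b \<otimes> t a b' = t a (b \<otimes> b')"
  shows "assoc_algebra K C"
proof -
  interpret K: cring K by fact
  interpret C: ring C by (rule conv_ring)
  note [simp del] = conv_algebra_simps
  have smult: "a \<odot>\<^bsub>C\<^esub> f = s a f" for a f by (simp add: conv_algebra_simps)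
  have zero: "(\<lambda>w. \<zero>) = \<zero>\<^bsub>C\<^esub>" by (simp add: conv_algebra_simps)
  have single_add: "single R u (b \<oplus> b') = single R u b \<oplus>\<^bsub>C\<^esub> single R u b'" for u b b'
    by (auto simp: single_def conv_algebra_simps)
  note s0 = s0[unfolded zero]
  note ind = conv_induct[unfolded zero, consumes 1, case_names zero add]
  have module: "module K C"
  proof (rule moduleI)
    fix a b f assume a: "a \<in> carrier K" and b: "b \<in> carrier K" and f: "f \<in> carrier C"
    show "(a \<oplus>\<^bsub>K\<^esub> b) \<odot>\<^bsub>C\<^esub> f = a \<odot>\<^bsub>C\<^esub> f \<oplus>\<^bsub>C\<^esub> b \<odot>\<^bsub>C\<^esub> f"
      using f by (induct f rule: ind)
        (use a b in \<open>simp_all add: smult s0 sa sp sc t3 tc single_add C.a_ac\<close>)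
    show "(a \<otimes>\<^bsub>K\<^esub> b) \<odot>\<^bsub>C\<^esub> f = a \<odot>\<^bsub>C\<^esub> (b \<odot>\<^bsub>C\<^esub> f)"
      using f by (induct f rule: ind)
        (use a b in \<open>simp_all add: smult s0 sa sp sc t2 tc\<close>)
  next
    fix f assume f: "f \<in> carrier C"
    show "\<one>\<^bsub>K\<^esub> \<odot>\<^bsub>C\<^esub> f = f"
      using f by (induct f rule: ind) (simp_all add: smult s0 sa sp sc t1 tc)
  qed (auto simp: smult sa sc K C.abelian_group_axioms)
  have s_mult: "s a (single R u b) \<otimes>\<^bsub>C\<^esub> g = s a (single R u b \<otimes>\<^bsub>C\<^esub> g)"
     "single R u b \<otimes>\<^bsub>C\<^esub> s a g = s a (single R u b \<otimes>\<^bsub>C\<^esub> g)"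
    if "a \<in> carrier K" "u \<in> carrier M" "b \<in> carrier R" "g \<in> carrier C" for a u b g
  proof -
    show "s a (single R u b) \<otimes>\<^bsub>C\<^esub> g = s a (single R u b \<otimes>\<^bsub>C\<^esub> g)"
      using that(4) by (induct g rule: ind)
        (use that in \<open>simp_all add: s0 sa sp sc tc t4 C.r_distr single_mult\<close>)
    show "single R u b \<otimes>\<^bsub>C\<^esub> s a g = s a (single R u b \<otimes>\<^bsub>C\<^esub> g)"
      using that(4) by (induct g rule: ind)
        (use that in \<open>simp_all add: s0 sa sp sc tc t5 C.r_distr single_mult\<close>)
  qed
  have f_mult: "s a f \<otimes>\<^bsub>C\<^esub> g = s a (f \<otimes>\<^bsub>C\<^esub> g) \<and> f \<otimes>\<^bsub>C\<^esub> s a g = s a (f \<otimes>\<^bsub>C\<^esub> g)"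
    if "a \<in> carrier K" "f \<in> carrier C" "g \<in> carrier C" for a f g
    using that(2)
  proof (induct f rule: ind)
    case zero
    show ?case using that by (simp add: s0 sc)
  next
    case (add u b f)
    then show ?case using that by (simp add: sa sc C.l_distr s_mult)
  qed
  have "assoc_algebra_axioms K C"
  proof
    fix a f g assume "a \<in> carrier K" "f \<in> carrier C" "g \<in> carrier C"
    from f_mult[OF this]
    show "(a \<odot>\<^bsub>C\<^esub> f) \<otimes>\<^bsub>C\<^esub> g = a \<odot>\<^bsub>C\<^esub> (f \<otimes>\<^bsub>C\<^esub> g)"
      "f \<otimes>\<^bsub>C\<^esub> (a \<odot>\<^bsub>C\<^esub> g) = a \<odot>\<^bsub>C\<^esub> (f \<otimes>\<^bsub>C\<^esub> g)"
      unfolding smult by blast+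
  qed
  with module C.ring_axioms show ?thesis by (rule assoc_algebra.intro)
qed

end

section \<open>Monoid algebras over K and over a K-algebra of coefficients\<close>

lemma monoid_algebra_assoc_algebra:
  assumes "cring K" "monoid M"
  shows "assoc_algebra K (monoid_algebra K M)"
proof -
  interpret K: cring K by fact
  interpret monoid_ring K M "\<lambda>a f w. a \<otimes>\<^bsub>K\<^esub> f w"
    using assms by (intro monoid_ring.intro K.ring_axioms)
  show ?thesis unfolding monoid_algebra_eq_conv
  proof (rule conv_assoc_algebra[where t = "monoid.mult K"])
    fix a f assume "a \<in> carrier K" "f \<in> carrier C"
    then show "(\<lambda>w. a \<otimes>\<^bsub>K\<^esub> f w) \<in> carrier C" by (auto intro: conv_map_closed[of f])
  next
    fix a f g assume "a \<in> carrier K" "f \<in> carrier C" "g \<in> carrier C"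
    then show "(\<lambda>w. a \<otimes>\<^bsub>K\<^esub> (f \<oplus>\<^bsub>C\<^esub> g) w) = (\<lambda>w. a \<otimes>\<^bsub>K\<^esub> f w) \<oplus>\<^bsub>C\<^esub> (\<lambda>w. a \<otimes>\<^bsub>K\<^esub> g w)"
      using conv_closed by (auto simp: K.r_distr)
  qed (auto simp: single_def K.l_distr K.m_assoc K.m_lcomm assms)
qed

text \<open>The algebra A[M], in which elements of \<open>M\<close> commute with the coefficients
  while \<open>A\<close> itself may be noncommutative. With \<open>M = deg_group\<close> it is the
  target of the grading maps.\<close>

definition coeff_algebra ::
  "('k, 'a, 'u) module_scheme \<Rightarrow> ('w, 'n) monoid_scheme \<Rightarrow> ('k, 'w \<Rightarrow> 'a) module"
  where "coeff_algebra A M = conv_algebra A M (\<lambda>a f w. a \<odot>\<^bsub>A\<^esub> f w)"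

lemma coeff_algebra_assoc_algebra:
  assumes "assoc_algebra K A" "monoid M"
  shows "assoc_algebra K (coeff_algebra A M)"
proof -
  interpret A: assoc_algebra K A by fact
  interpret monoid_ring A M "\<lambda>a f w. a \<odot>\<^bsub>A\<^esub> f w"
    using assms by (intro monoid_ring.intro A.A.ring_axioms)
  show ?thesis unfolding coeff_algebra_def
  proof (rule conv_assoc_algebra[where t = "\<lambda>a b. a \<odot>\<^bsub>A\<^esub> b"])
    fix a f assume "a \<in> carrier K" "f \<in> carrier C"
    then show "(\<lambda>w. a \<odot>\<^bsub>A\<^esub> f w) \<in> carrier C" by (auto intro: conv_map_closed[of f])
  next
    fix a f g assume "a \<in> carrier K" "f \<in> carrier C" "g \<in> carrier C"
    then show "(\<lambda>w. a \<odot>\<^bsub>A\<^esub> (f \<oplus>\<^bsub>C\<^esub> g) w) = (\<lambda>w. a \<odot>\<^bsub>A\<^esub> f w) \<oplus>\<^bsub>C\<^esub> (\<lambda>w. a \<odot>\<^bsub>A\<^esub> g w)"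
      using conv_closed by (auto simp: A.smult_r_distr)
  qed (auto simp: single_def A.smult_l_distr A.smult_assoc1 A.smult_mult_left
        A.smult_mult_right A.R.cring_axioms)
qed

section \<open>Homomorphisms and subalgebras\<close>

locale algebra_hom = A: assoc_algebra K A + B: assoc_algebra K B
  for K :: "('k, 'm) ring_scheme" and A :: "('k, 'a, 'u) module_scheme"
    and B :: "('k, 'b, 'v) module_scheme" +
  fixes f :: "'a \<Rightarrow> 'b"
  assumes alg_hom: "f \<in> alg_hom K A B"
begin

lemma ring_hom: "f \<in> ring_hom A B"
  using alg_hom by (simp add: alg_hom_def)

lemma closed [simp]: "x \<in> carrier A \<Longrightarrow> f x \<in> carrier B"
  using ring_hom by (rule ring_hom_closed)

lemma mult: "\<lbrakk>x \<in> carrier A; y \<in> carrier A\<rbrakk> \<Longrightarrow> f (x \<otimes>\<^bsub>A\<^esub> y) = f x \<otimes>\<^bsub>B\<^esub> f y"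
  using ring_hom by (rule ring_hom_mult)

lemma add: "\<lbrakk>x \<in> carrier A; y \<in> carrier A\<rbrakk> \<Longrightarrow> f (x \<oplus>\<^bsub>A\<^esub> y) = f x \<oplus>\<^bsub>B\<^esub> f y"
  using ring_hom by (rule ring_hom_add)

lemma one: "f \<one>\<^bsub>A\<^esub> = \<one>\<^bsub>B\<^esub>"
  using ring_hom by (rule ring_hom_one)

lemma smult: "\<lbrakk>a \<in> carrier K; x \<in> carrier A\<rbrakk> \<Longrightarrow> f (a \<odot>\<^bsub>A\<^esub> x) = a \<odot>\<^bsub>B\<^esub> f x"
  using alg_hom by (simp add: alg_hom_def)

sublocale ring_hom_ring A B f
  by (intro ring_hom_ringI2 A.A.ring_axioms B.A.ring_axioms ring_hom)

lemma zero: "f \<zero>\<^bsub>A\<^esub> = \<zero>\<^bsub>B\<^esub>"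
  by simp

lemma minus: "\<lbrakk>x \<in> carrier A; y \<in> carrier A\<rbrakk> \<Longrightarrow> f (x \<ominus>\<^bsub>A\<^esub> y) = f x \<ominus>\<^bsub>B\<^esub> f y"
  by (simp add: A.M.minus_eq B.M.minus_eq add)

lemma unit_inv:
  assumes "x \<in> Units A"
  shows "f x \<in> Units B" "f (inv\<^bsub>A\<^esub> x) = inv\<^bsub>B\<^esub> (f x)"
proof -
  have x: "x \<in> carrier A" "inv\<^bsub>A\<^esub> x \<in> carrier A" using assms by auto
  have "f x \<otimes>\<^bsub>B\<^esub> f (inv\<^bsub>A\<^esub> x) = \<one>\<^bsub>B\<^esub>" "f (inv\<^bsub>A\<^esub> x) \<otimes>\<^bsub>B\<^esub> f x = \<one>\<^bsub>B\<^esub>"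
    using assms x by (simp_all flip: mult one)
  then show "f x \<in> Units B" "f (inv\<^bsub>A\<^esub> x) = inv\<^bsub>B\<^esub> (f x)"
    using x B.A.inv_char[of "f x" "f (inv\<^bsub>A\<^esub> x)"] by (auto simp: Units_def)
qed

end

lemma alg_homI:
  assumes "\<And>x. x \<in> carrier A \<Longrightarrow> f x \<in> carrier B"
    and "\<And>x y. \<lbrakk>x \<in> carrier A; y \<in> carrier A\<rbrakk> \<Longrightarrow> f (x \<otimes>\<^bsub>A\<^esub> y) = f x \<otimes>\<^bsub>B\<^esub> f y"
    and "\<And>x y. \<lbrakk>x \<in> carrier A; y \<in> carrier A\<rbrakk> \<Longrightarrow> f (x \<oplus>\<^bsub>A\<^esub> y) = f x \<oplus>\<^bsub>B\<^esub> f y"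
    and "f \<one>\<^bsub>A\<^esub> = \<one>\<^bsub>B\<^esub>"
    and "\<And>a x. \<lbrakk>a \<in> carrier K; x \<in> carrier A\<rbrakk> \<Longrightarrow> f (a \<odot>\<^bsub>A\<^esub> x) = a \<odot>\<^bsub>B\<^esub> f x"
  shows "f \<in> alg_hom K A B"
  using assms by (simp add: alg_hom_def ring_hom_memI)

lemma alg_hom_comp:
  assumes "f \<in> alg_hom K A B" "g \<in> alg_hom K B C"
  shows "(\<lambda>x. g (f x)) \<in> alg_hom K A C"
  using assms by (fastforce simp: alg_hom_def ring_hom_def Pi_def)

text \<open>The closure property used in \<open>generated_subalgebra\<close>. Generation is
  expressed below in the form: a subalgebra containing the generators is the whole carrier.\<close>

definition subalg :: "('k, 'm) ring_scheme \<Rightarrow> ('k, 'a, 'u) module_scheme \<Rightarrow> 'a set \<Rightarrow> bool"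
  where "subalg K A S \<longleftrightarrow> subring S A \<and> (\<forall>a\<in>carrier K. \<forall>x\<in>S. a \<odot>\<^bsub>A\<^esub> x \<in> S)"

section \<open>Generated subalgebras and centralizers\<close>

context assoc_algebra
begin

lemma uminus_eq_smult: "x \<in> carrier A \<Longrightarrow> \<ominus>\<^bsub>A\<^esub> x = (\<ominus>\<^bsub>K\<^esub> \<one>\<^bsub>K\<^esub>) \<odot>\<^bsub>A\<^esub> x"
  by (simp add: smult_l_minus)

lemma smult_one_mult: "\<lbrakk>a \<in> carrier K; x \<in> carrier A\<rbrakk> \<Longrightarrow> (a \<odot>\<^bsub>A\<^esub> \<one>\<^bsub>A\<^esub>) \<otimes>\<^bsub>A\<^esub> x = a \<odot>\<^bsub>A\<^esub> x"
  by (simp add: smult_mult_left)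

text \<open>Closure under negatives follows from closure under the scalar -1.\<close>

lemma subalgI:
  assumes "S \<subseteq> carrier A" "\<one>\<^bsub>A\<^esub> \<in> S"
    and "\<And>x y. \<lbrakk>x \<in> S; y \<in> S\<rbrakk> \<Longrightarrow> x \<otimes>\<^bsub>A\<^esub> y \<in> S"
    and "\<And>x y. \<lbrakk>x \<in> S; y \<in> S\<rbrakk> \<Longrightarrow> x \<oplus>\<^bsub>A\<^esub> y \<in> S"
    and smult: "\<And>a x. \<lbrakk>a \<in> carrier K; x \<in> S\<rbrakk> \<Longrightarrow> a \<odot>\<^bsub>A\<^esub> x \<in> S"
  shows "subalg K A S"
proof -
  have "\<ominus>\<^bsub>A\<^esub> x \<in> S" if "x \<in> S" for x
    using smult[of "\<ominus>\<^bsub>K\<^esub> \<one>\<^bsub>K\<^esub>" x] that assms(1) by (auto simp: uminus_eq_smult)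
  then show ?thesis unfolding subalg_def using assms by (auto intro!: A.subringI)
qed

lemma generated_subalgebra_minimal:
  "\<lbrakk>subalg K A S; G \<subseteq> S\<rbrakk> \<Longrightarrow> generated_subalgebra K A G \<subseteq> S"
  by (auto simp: generated_subalgebra_def subalg_def)

lemma subset_generated_subalgebra: "G \<subseteq> generated_subalgebra K A G"
  by (auto simp: generated_subalgebra_def)

lemma carrier_subalg: "subalg K A (carrier A)"
  by (rule subalgI) auto

lemma generated_subalgebra_subalg:
  assumes "G \<subseteq> carrier A"
  shows "subalg K A (generated_subalgebra K A G)"
proof (rule subalgI)
  show "generated_subalgebra K A G \<subseteq> carrier A"
    by (rule generated_subalgebra_minimal[OF carrier_subalg assms])
qed (auto simp: generated_subalgebra_def subringE)

text \<open>Extends commutation relations from generators to everything they generate.\<close>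

lemma centralizer_subalg:
  assumes "Y \<subseteq> carrier A"
  shows "subalg K A {x \<in> carrier A. \<forall>y\<in>Y. x \<otimes>\<^bsub>A\<^esub> y = y \<otimes>\<^bsub>A\<^esub> x}"
proof (rule subalgI)
  fix x x' assume x: "x \<in> {x \<in> carrier A. \<forall>y\<in>Y. x \<otimes>\<^bsub>A\<^esub> y = y \<otimes>\<^bsub>A\<^esub> x}"
    and x': "x' \<in> {x \<in> carrier A. \<forall>y\<in>Y. x \<otimes>\<^bsub>A\<^esub> y = y \<otimes>\<^bsub>A\<^esub> x}"
  have "(x \<otimes>\<^bsub>A\<^esub> x') \<otimes>\<^bsub>A\<^esub> y = y \<otimes>\<^bsub>A\<^esub> (x \<otimes>\<^bsub>A\<^esub> x')" if "y \<in> Y" for y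
  proof -
    have y: "y \<in> carrier A" using that assms by blast
    have "(x \<otimes>\<^bsub>A\<^esub> x') \<otimes>\<^bsub>A\<^esub> y = x \<otimes>\<^bsub>A\<^esub> (y \<otimes>\<^bsub>A\<^esub> x')"
      using x x' y that by (simp add: A.m_assoc)
    also have "\<dots> = (y \<otimes>\<^bsub>A\<^esub> x) \<otimes>\<^bsub>A\<^esub> x'"
      using x x' y that by (simp flip: A.m_assoc)
    finally show ?thesis using x x' y by (simp add: A.m_assoc)
  qed
  with x x' show "x \<otimes>\<^bsub>A\<^esub> x' \<in> {x \<in> carrier A. \<forall>y\<in>Y. x \<otimes>\<^bsub>A\<^esub> y = y \<otimes>\<^bsub>A\<^esub> x}"
    by auto
qed (use assms in \<open>auto simp: subset_iff A.l_distr A.r_distr smult_mult_left smult_mult_right\<close>)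

text \<open>Multiply xy = yx by the inverse of x on both sides. This complements
  \<open>centralizer_subalg\<close>, as the generating sets of localizations contain
  inverses.\<close>

lemma centralizer_inv:
  assumes "x \<in> Units A" "y \<in> carrier A" "x \<otimes>\<^bsub>A\<^esub> y = y \<otimes>\<^bsub>A\<^esub> x"
  shows "inv\<^bsub>A\<^esub> x \<otimes>\<^bsub>A\<^esub> y = y \<otimes>\<^bsub>A\<^esub> inv\<^bsub>A\<^esub> x"
proof -
  have x: "x \<in> carrier A" "inv\<^bsub>A\<^esub> x \<in> carrier A" using assms(1) by auto
  have "inv\<^bsub>A\<^esub> x \<otimes>\<^bsub>A\<^esub> y = inv\<^bsub>A\<^esub> x \<otimes>\<^bsub>A\<^esub> (y \<otimes>\<^bsub>A\<^esub> x) \<otimes>\<^bsub>A\<^esub> inv\<^bsub>A\<^esub> x"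
    using x assms(1,2) by (simp add: A.m_assoc)
  also have "\<dots> = (inv\<^bsub>A\<^esub> x \<otimes>\<^bsub>A\<^esub> x) \<otimes>\<^bsub>A\<^esub> y \<otimes>\<^bsub>A\<^esub> inv\<^bsub>A\<^esub> x"
    using x assms(2) unfolding assms(3)[symmetric] by (simp only: A.m_assoc A.m_closed)
  finally show ?thesis using x assms(1,2) by simp
qed

end

lemma subalgD:
  assumes "subalg K A S"
  shows "S \<subseteq> carrier A" "\<zero>\<^bsub>A\<^esub> \<in> S" "\<one>\<^bsub>A\<^esub> \<in> S"
    "\<And>x y. \<lbrakk>x \<in> S; y \<in> S\<rbrakk> \<Longrightarrow> x \<otimes>\<^bsub>A\<^esub> y \<in> S"
    "\<And>x y. \<lbrakk>x \<in> S; y \<in> S\<rbrakk> \<Longrightarrow> x \<oplus>\<^bsub>A\<^esub> y \<in> S"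
    "\<And>x. x \<in> S \<Longrightarrow> \<ominus>\<^bsub>A\<^esub> x \<in> S"
    "\<And>a x. \<lbrakk>a \<in> carrier K; x \<in> S\<rbrakk> \<Longrightarrow> a \<odot>\<^bsub>A\<^esub> x \<in> S"
  using assms subringE[of S A] by (auto simp: subalg_def)

lemma (in algebra_hom) preimage_subalg:
  assumes S: "subalg K B S"
  shows "subalg K A {x \<in> carrier A. f x \<in> S}"
  by (rule A.subalgI) (auto simp: add mult one smult intro: subalgD[OF S])

text \<open>The source of all uniqueness statements: homomorphisms that agree on generators
  agree.\<close>

lemma equalizer_subalg:
  assumes "assoc_algebra K A" "assoc_algebra K B" "f \<in> alg_hom K A B" "g \<in> alg_hom K A B"
  shows "subalg K A {x \<in> carrier A. f x = g x}"
proof -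
  interpret f: algebra_hom K A B f using assms by (intro algebra_hom.intro algebra_hom_axioms.intro)
  interpret g: algebra_hom K A B g using assms by (intro algebra_hom.intro algebra_hom_axioms.intro)
  show ?thesis
    by (rule f.A.subalgI)
      (auto simp: f.add f.mult f.one f.smult g.add g.mult g.one g.smult)
qed

lemma algebra_homI:
  "\<lbrakk>assoc_algebra K A; assoc_algebra K B; f \<in> alg_hom K A B\<rbrakk> \<Longrightarrow> algebra_hom K A B f"
  by (intro algebra_hom.intro algebra_hom_axioms.intro)


section \<open>Universal properties\<close>

lemma delta_mult:
  assumes "cring K" "monoid M" "u \<in> carrier M" "v \<in> carrier M"
  shows "delta K u \<otimes>\<^bsub>monoid_algebra K M\<^esub> delta K v = delta K (u \<otimes>\<^bsub>M\<^esub> v)"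
proof -
  interpret K: cring K by fact
  interpret monoid_ring K M "\<lambda>a f w. a \<otimes>\<^bsub>K\<^esub> f w"
    using assms by (intro monoid_ring.intro K.ring_axioms)
  show ?thesis
    using assms single_mult[of u v "\<one>\<^bsub>K\<^esub>" "\<one>\<^bsub>K\<^esub>"]
    by (simp add: monoid_algebra_eq_conv delta_eq_single)
qed

lemma delta_closed:
  assumes "cring K" "monoid M" "u \<in> carrier M"
  shows "delta K u \<in> carrier (monoid_algebra K M)"
proof -
  interpret K: cring K by fact
  interpret monoid_ring K M "\<lambda>a f w. a \<otimes>\<^bsub>K\<^esub> f w"
    using assms by (intro monoid_ring.intro K.ring_axioms)
  show ?thesis
    using assms by (simp add: monoid_algebra_eq_conv delta_eq_single)
qed

lemma one_eq_delta: "\<one>\<^bsub>monoid_algebra K M\<^esub> = delta K \<one>\<^bsub>M\<^esub>"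
  by (simp add: monoid_algebra_eq_conv delta_eq_single)

lemma monoid_algebra_induct [consumes 3, case_names zero add]:
  assumes "cring K" "monoid M" "f \<in> carrier (monoid_algebra K M)"
    and "Q \<zero>\<^bsub>monoid_algebra K M\<^esub>"
    and "\<And>u a f. \<lbrakk>u \<in> carrier M; a \<in> carrier K; f \<in> carrier (monoid_algebra K M); Q f\<rbrakk> \<Longrightarrow>
      Q (a \<odot>\<^bsub>monoid_algebra K M\<^esub> delta K u \<oplus>\<^bsub>monoid_algebra K M\<^esub> f)"
  shows "Q f"
proof -
  interpret K: cring K by fact
  interpret monoid_ring K M "\<lambda>a f w. a \<otimes>\<^bsub>K\<^esub> f w"
    using assms by (intro monoid_ring.intro K.ring_axioms)
  have s: "single K u a = a \<odot>\<^bsub>monoid_algebra K M\<^esub> delta K u" if "a \<in> carrier K" for u a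
    using that by (auto simp: monoid_algebra_eq_conv delta_eq_single single_def)
  show ?thesis
    by (rule conv_induct[of f])
      (use assms(3-5) in \<open>simp_all add: s flip: monoid_algebra_eq_conv\<close>,
       simp add: monoid_algebra_eq_conv)
qed

text \<open>A multiplicative map on \<open>M\<close> extends linearly to K[M], and the extension
  \<open>L\<close> is multiplicative by bilinearity. The free monoid gives the universal property of
  the free algebra, and the monoid \<open>P \<times>\<times> N\<close> that of the tensor
  product.\<close>

lemma monoid_algebra_lift:
  assumes K: "cring K" and M: "monoid M" and B: "assoc_algebra K B"
    and h: "\<And>u. u \<in> carrier M \<Longrightarrow> h u \<in> carrier B"
    and h_mult: "\<And>u v. \<lbrakk>u \<in> carrier M; v \<in> carrier M\<rbrakk> \<Longrightarrow> h (u \<otimes>\<^bsub>M\<^esub> v) = h u \<otimes>\<^bsub>B\<^esub> h v"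
    and h_one: "h \<one>\<^bsub>M\<^esub> = \<one>\<^bsub>B\<^esub>"
  shows "\<exists>F\<in>alg_hom K (monoid_algebra K M) B. \<forall>u\<in>carrier M. F (delta K u) = h u"
proof -
  interpret K: cring K by fact
  interpret M: monoid M by fact
  interpret B: assoc_algebra K B by fact
  interpret C: monoid_ring K M "\<lambda>a f w. a \<otimes>\<^bsub>K\<^esub> f w"
    by (intro monoid_ring.intro K.ring_axioms M)
  let ?C = "monoid_algebra K M"
  interpret A: assoc_algebra K ?C by (rule monoid_algebra_assoc_algebra[OF K M])
  define L where "L f = (\<Oplus>\<^bsub>B\<^esub>w\<in>{w. f w \<noteq> \<zero>\<^bsub>K\<^esub>}. f w \<odot>\<^bsub>B\<^esub> h w)" for f
  note conv = monoid_algebra_eq_conv[symmetric]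
  \<comment> \<open>Allows the sums for \<open>f\<close>, \<open>g\<close> and \<open>f + g\<close>
    to be taken over one common finite set.\<close>
  have L_eq: "L f = (\<Oplus>\<^bsub>B\<^esub>w\<in>U. f w \<odot>\<^bsub>B\<^esub> h w)"
    if "f \<in> carrier ?C" "finite U" "{w. f w \<noteq> \<zero>\<^bsub>K\<^esub>} \<subseteq> U" "U \<subseteq> carrier M" for f U
  proof -
    have "f w \<in> carrier K" for w using that(1) C.conv_closed by (simp add: conv)
    then show ?thesis unfolding L_def
      by (intro B.M.add.finprod_mono_neutral_cong_left) (use that h in \<open>auto simp: subset_iff\<close>)
  qed
  have fin: "finite {w. f w \<noteq> \<zero>\<^bsub>K\<^esub>}" "{w. f w \<noteq> \<zero>\<^bsub>K\<^esub>} \<subseteq> carrier M" "f w \<in> carrier K"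
    if "f \<in> carrier ?C" for f w
    using that C.supp_finite C.supp_subset C.conv_closed by (simp_all add: conv)
  have L_closed: "L f \<in> carrier B" if f: "f \<in> carrier ?C" for f
    unfolding L_def by (rule B.M.finsum_closed) (use fin[OF f] h in auto)
  have add_eq: "(f \<oplus>\<^bsub>?C\<^esub> g) w = f w \<oplus>\<^bsub>K\<^esub> g w" for f g w
    by (simp add: monoid_algebra_eq_conv)
  have L_add: "L (f \<oplus>\<^bsub>?C\<^esub> g) = L f \<oplus>\<^bsub>B\<^esub> L g" if f: "f \<in> carrier ?C" and g: "g \<in> carrier ?C" for f g
  proof -
    let ?U = "{w. f w \<noteq> \<zero>\<^bsub>K\<^esub>} \<union> {w. g w \<noteq> \<zero>\<^bsub>K\<^esub>}"
    have U: "finite ?U" "?U \<subseteq> carrier M" using fin f g by auto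
    have "L (f \<oplus>\<^bsub>?C\<^esub> g) = (\<Oplus>\<^bsub>B\<^esub>w\<in>?U. (f \<oplus>\<^bsub>?C\<^esub> g) w \<odot>\<^bsub>B\<^esub> h w)"
      by (rule L_eq) (use U f g in \<open>auto simp: add_eq\<close>)
    also have "\<dots> = (\<Oplus>\<^bsub>B\<^esub>w\<in>?U. f w \<odot>\<^bsub>B\<^esub> h w \<oplus>\<^bsub>B\<^esub> g w \<odot>\<^bsub>B\<^esub> h w)"
      by (rule B.M.finsum_cong')
        (use U(2) fin(3)[OF f] fin(3)[OF g] h in \<open>auto simp: add_eq B.smult_l_distr subset_iff\<close>)
    also have "\<dots> = (\<Oplus>\<^bsub>B\<^esub>w\<in>?U. f w \<odot>\<^bsub>B\<^esub> h w) \<oplus>\<^bsub>B\<^esub> (\<Oplus>\<^bsub>B\<^esub>w\<in>?U. g w \<odot>\<^bsub>B\<^esub> h w)"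
      by (rule B.M.finsum_addf) (use U(2) fin(3)[OF f] fin(3)[OF g] h in auto)
    also have "\<dots> = L f \<oplus>\<^bsub>B\<^esub> L g"
      using L_eq[OF f U(1) _ U(2)] L_eq[OF g U(1) _ U(2)] by simp
    finally show ?thesis .
  qed
  have L_mono: "L (a \<odot>\<^bsub>?C\<^esub> delta K u) = a \<odot>\<^bsub>B\<^esub> h u" if "a \<in> carrier K" "u \<in> carrier M" for a u
  proof -
    have e: "(a \<odot>\<^bsub>?C\<^esub> delta K u) w = (if w = u then a else \<zero>\<^bsub>K\<^esub>)" for w
      using that by (simp add: monoid_algebra_eq_conv delta_def)
    have "L (a \<odot>\<^bsub>?C\<^esub> delta K u) = (\<Oplus>\<^bsub>B\<^esub>w\<in>{u}. (a \<odot>\<^bsub>?C\<^esub> delta K u) w \<odot>\<^bsub>B\<^esub> h w)"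
      by (rule L_eq) (use that delta_closed[OF K M] in \<open>auto simp: e split: if_splits\<close>)
    also have "\<dots> = a \<odot>\<^bsub>B\<^esub> h u" using that h by (simp add: e)
    finally show ?thesis .
  qed
  have L_zero: "L \<zero>\<^bsub>?C\<^esub> = \<zero>\<^bsub>B\<^esub>" by (simp add: L_def monoid_algebra_eq_conv)
  have L_delta: "L (delta K u) = h u" if "u \<in> carrier M" for u
    using L_mono[of "\<one>\<^bsub>K\<^esub>" u] that delta_closed[OF K M] h by simp
  note D = delta_closed[OF K M]
  note [simp] = L_closed L_add L_mono L_zero D h
  have L_smult: "L (a \<odot>\<^bsub>?C\<^esub> f) = a \<odot>\<^bsub>B\<^esub> L f" if "a \<in> carrier K" "f \<in> carrier ?C" for a f
    using K M that(2)
  proof (induct f rule: monoid_algebra_induct)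
    case (add u b f)
    have "L (a \<odot>\<^bsub>?C\<^esub> (b \<odot>\<^bsub>?C\<^esub> delta K u \<oplus>\<^bsub>?C\<^esub> f)) = L ((a \<otimes>\<^bsub>K\<^esub> b) \<odot>\<^bsub>?C\<^esub> delta K u) \<oplus>\<^bsub>B\<^esub> L (a \<odot>\<^bsub>?C\<^esub> f)"
      using add that(1) by (simp add: A.smult_r_distr A.smult_assoc1 del: L_mono)
    then show ?case using add that(1) by (simp add: B.smult_r_distr B.smult_assoc1)
  qed (use that in simp)
  have L_mult1: "L (delta K u \<otimes>\<^bsub>?C\<^esub> g) = h u \<otimes>\<^bsub>B\<^esub> L g" if "u \<in> carrier M" "g \<in> carrier ?C" for u g
    using K M that(2)
  proof (induct g rule: monoid_algebra_induct)
    case (add v b g)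
    then show ?case using that(1)
      by (simp add: A.A.r_distr A.smult_mult_right B.A.r_distr B.smult_mult_right delta_mult[OF K M] h_mult)
  qed (use that in simp)
  have L_mult: "L (f \<otimes>\<^bsub>?C\<^esub> g) = L f \<otimes>\<^bsub>B\<^esub> L g" if "f \<in> carrier ?C" "g \<in> carrier ?C" for f g
    using K M that(1)
  proof (induct f rule: monoid_algebra_induct)
    case (add v b f)
    then show ?case using that(2)
      by (simp add: A.A.l_distr A.smult_mult_left B.A.l_distr B.smult_mult_left L_mult1 L_smult L_delta)
  qed (use that in simp)
  have "L \<in> alg_hom K ?C B"
    by (rule alg_homI) (simp_all add: L_smult L_mult one_eq_delta L_delta h_one)
  with L_delta show ?thesis by blast
qed

lemma monoid_algebra_generated:
  assumes "cring K" "monoid M" "subalg K (monoid_algebra K M) S"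
    and "\<And>u. u \<in> carrier M \<Longrightarrow> delta K u \<in> S"
  shows "S = carrier (monoid_algebra K M)"
proof -
  have "f \<in> S" if "f \<in> carrier (monoid_algebra K M)" for f
    using assms(1,2) that
    by (induct f rule: monoid_algebra_induct) (use assms subalgD[OF assms(3)] in auto)
  with subalgD(1)[OF assms(3)] show ?thesis by blast
qed

lemma free_monoid_monoid: "monoid (free_monoid G)"
  by (rule monoidI) (auto simp: free_monoid_def)

lemma free_algebra_assoc_algebra: "cring K \<Longrightarrow> assoc_algebra K (free_algebra K G)"
  unfolding free_algebra_def by (intro monoid_algebra_assoc_algebra free_monoid_monoid)

lemma free_algebra_lift:
  assumes K: "cring K" and B: "assoc_algebra K B" and b: "\<And>g. g \<in> G \<Longrightarrow> b g \<in> carrier B"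
  shows "\<exists>F\<in>alg_hom K (free_algebra K G) B. \<forall>g\<in>G. F (delta K [g]) = b g"
proof -
  interpret B: assoc_algebra K B by fact
  define h where "h w = foldr (\<lambda>g x. b g \<otimes>\<^bsub>B\<^esub> x) w \<one>\<^bsub>B\<^esub>" for w
  have h_closed: "w \<in> lists G \<Longrightarrow> h w \<in> carrier B" for w
    by (induct w) (auto simp: h_def b)
  have h_mult: "u \<in> lists G \<Longrightarrow> v \<in> lists G \<Longrightarrow> h (u @ v) = h u \<otimes>\<^bsub>B\<^esub> h v" for u v
  proof (induct u)
    case Nil
    then show ?case using h_closed by (simp add: h_def)
  next
    case (Cons g u)
    then show ?case using h_closed[of u] h_closed[of v] b[of g]
      by (simp add: h_def B.A.m_assoc)
  qed
  have "\<exists>F\<in>alg_hom K (monoid_algebra K (free_monoid G)) B.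
    \<forall>u\<in>carrier (free_monoid G). F (delta K u) = h u"
    by (rule monoid_algebra_lift[OF K free_monoid_monoid B])
      (auto simp: free_monoid_def h_mult h_closed h_def[of "[]"])
  then obtain F where F: "F \<in> alg_hom K (free_algebra K G) B"
      "\<And>u. u \<in> lists G \<Longrightarrow> F (delta K u) = h u"
    unfolding free_algebra_def by (auto simp: free_monoid_def)
  have "F (delta K [g]) = b g" if "g \<in> G" for g
    using that b by (simp add: F(2) h_def)
  with F(1) show ?thesis by blast
qed

lemma free_algebra_generated:
  assumes K: "cring K" and S: "subalg K (free_algebra K G) S"
    and g: "\<And>g. g \<in> G \<Longrightarrow> delta K [g] \<in> S"
  shows "S = carrier (free_algebra K G)"
proof -
  have "w \<in> lists G \<Longrightarrow> delta K w \<in> S" for w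
  proof (induct w)
    case Nil
    then show ?case using subalgD(3)[OF S] by (simp add: free_algebra_def one_eq_delta free_monoid_def)
  next
    case (Cons x w)
    then have "delta K [x] \<otimes>\<^bsub>free_algebra K G\<^esub> delta K w \<in> S" using g by (auto intro: subalgD[OF S])
    then show ?case
      using Cons delta_mult[OF K free_monoid_monoid[of G], of "[x]" w]
      by (simp add: free_algebra_def free_monoid_def)
  qed
  then show ?thesis unfolding free_algebra_def
    by (intro monoid_algebra_generated K free_monoid_monoid S[unfolded free_algebra_def])
      (simp add: free_monoid_def)
qed

lemma delta_generator_closed:
  "\<lbrakk>cring K; g \<in> G\<rbrakk> \<Longrightarrow> delta K [g] \<in> carrier (free_algebra K G)"
  unfolding free_algebra_def
  by (rule delta_closed[OF _ free_monoid_monoid]) (simp_all add: free_monoid_def)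

subsection \<open>Quotients\<close>

locale quotient_algebra = A: assoc_algebra K A + I: ideal I A
  for K :: "('k, 'm) ring_scheme" and A :: "('k, 'a, 'u) module_scheme" and I
begin

abbreviation "Q \<equiv> quot_algebra A I"
abbreviation "proj x \<equiv> I +>\<^bsub>A\<^esub> x"

lemma quot_simps:
  "carrier Q = proj ` carrier A"
  "\<lbrakk>x \<in> carrier A; y \<in> carrier A\<rbrakk> \<Longrightarrow> proj x \<otimes>\<^bsub>Q\<^esub> proj y = proj (x \<otimes>\<^bsub>A\<^esub> y)"
  "\<lbrakk>x \<in> carrier A; y \<in> carrier A\<rbrakk> \<Longrightarrow> proj x \<oplus>\<^bsub>Q\<^esub> proj y = proj (x \<oplus>\<^bsub>A\<^esub> y)"
  "\<one>\<^bsub>Q\<^esub> = proj \<one>\<^bsub>A\<^esub>"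
  "\<zero>\<^bsub>Q\<^esub> = proj \<zero>\<^bsub>A\<^esub>"
  by (auto simp: quot_algebra_def FactRing_simps I.rcoset_mult_add I.a_rcos_sum
      A.M.a_coset_add_zero I.a_subset)

lemma proj_eq_iff:
  "\<lbrakk>x \<in> carrier A; y \<in> carrier A\<rbrakk> \<Longrightarrow> proj x = proj y \<longleftrightarrow> x \<ominus>\<^bsub>A\<^esub> y \<in> I"
  by (simp add: A.A.quotient_eq_iff_same_a_r_cos[OF I.ideal_axioms])

text \<open>The scalar multiple is the product with (a 1), so a ring ideal is automatically a
  submodule.\<close>

lemma ideal_smult: "\<lbrakk>a \<in> carrier K; x \<in> I\<rbrakk> \<Longrightarrow> a \<odot>\<^bsub>A\<^esub> x \<in> I"
  using I.I_l_closed[of x "a \<odot>\<^bsub>A\<^esub> \<one>\<^bsub>A\<^esub>"] I.a_subset by (auto simp: A.smult_one_mult)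

text \<open>In \<open>quot_algebra\<close> the scalar multiple of a coset is a union over all its
  representatives. By \<open>ideal_smult\<close> every representative contributes the same coset, so
  the union collapses.\<close>

lemma proj_smult:
  assumes a: "a \<in> carrier K" and x: "x \<in> carrier A"
  shows "a \<odot>\<^bsub>Q\<^esub> proj x = proj (a \<odot>\<^bsub>A\<^esub> x)"
proof -
  have "proj (a \<odot>\<^bsub>A\<^esub> y) = proj (a \<odot>\<^bsub>A\<^esub> x)" if y: "y \<in> proj x" for y
  proof -
    have yc: "y \<in> carrier A" using y x I.a_subset A.M.a_r_coset_subset_G by blast
    have "proj y = proj x" using A.M.a_repr_independence[OF y x I.a_subgroup] by simp
    then have "y \<ominus>\<^bsub>A\<^esub> x \<in> I" using proj_eq_iff yc x by simp
    then have "a \<odot>\<^bsub>A\<^esub> (y \<ominus>\<^bsub>A\<^esub> x) \<in> I" using a by (rule ideal_smult[rotated])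
    then have "a \<odot>\<^bsub>A\<^esub> y \<ominus>\<^bsub>A\<^esub> a \<odot>\<^bsub>A\<^esub> x \<in> I"
      using a x yc by (simp add: A.M.minus_eq A.smult_r_distr A.smult_r_minus)
    then show ?thesis using proj_eq_iff a x yc by simp
  qed
  moreover have "x \<in> proj x" using x by (rule I.a_rcos_self)
  ultimately have "(\<Union>y\<in>proj x. proj (a \<odot>\<^bsub>A\<^esub> y)) = proj (a \<odot>\<^bsub>A\<^esub> x)" by blast
  then show ?thesis by (simp add: quot_algebra_def)
qed

lemma quot_assoc_algebra: "assoc_algebra K Q"
proof -
  have ring: "ring Q"
  proof (rule ringI)
    show "abelian_group Q"
    proof (rule abelian_groupI)
      fix C assume "C \<in> carrier Q"
      then obtain x where x: "x \<in> carrier A" "C = proj x" by (auto simp: quot_simps)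
      then have "proj (\<ominus>\<^bsub>A\<^esub> x) \<oplus>\<^bsub>Q\<^esub> C = \<zero>\<^bsub>Q\<^esub>" by (simp add: quot_simps A.M.l_neg)
      with x show "\<exists>D\<in>carrier Q. D \<oplus>\<^bsub>Q\<^esub> C = \<zero>\<^bsub>Q\<^esub>" by (auto simp: quot_simps(1))
    qed (auto simp: quot_simps A.M.a_ac)
    show "monoid Q" by (rule monoidI) (auto simp: quot_simps A.A.m_assoc)
  qed (auto simp: quot_simps A.A.l_distr A.A.r_distr)
  interpret Q: ring Q by (rule ring)
  have "module K Q"
    by (rule moduleI)
      (auto simp: quot_simps proj_smult A.R.cring_axioms Q.abelian_group_axioms A.smult_l_distr
        A.smult_r_distr A.smult_assoc1)
  moreover have "assoc_algebra_axioms K Q"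
    by standard (auto simp: quot_simps proj_smult A.smult_mult_left A.smult_mult_right)
  ultimately show ?thesis using ring by (simp add: assoc_algebra.intro)
qed

lemma proj_alg_hom: "proj \<in> alg_hom K A Q"
  by (rule alg_homI) (auto simp: quot_simps proj_smult)

lemma proj_eq_zero_iff: "x \<in> carrier A \<Longrightarrow> proj x = \<zero>\<^bsub>Q\<^esub> \<longleftrightarrow> x \<in> I"
  using proj_eq_iff[of x "\<zero>\<^bsub>A\<^esub>"] by (simp add: quot_simps A.M.minus_eq)

lemma quot_lift:
  assumes B: "assoc_algebra K B" and f: "f \<in> alg_hom K A B"
    and z: "\<And>x. x \<in> I \<Longrightarrow> f x = \<zero>\<^bsub>B\<^esub>"
  shows "\<exists>g\<in>alg_hom K Q B. \<forall>x\<in>carrier A. g (proj x) = f x"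
proof -
  interpret f: algebra_hom K A B f
    by (intro algebra_homI B f A.assoc_algebra_axioms)
  \<comment> \<open>The representative is arbitrary; two of them differ by an element of
    \<open>I\<close>, which \<open>f\<close> kills.\<close>
  define g where "g C = f (SOME x. x \<in> carrier A \<and> C = proj x)" for C
  have g: "g (proj x) = f x" if x: "x \<in> carrier A" for x
  proof -
    define x' where "x' = (SOME x'. x' \<in> carrier A \<and> proj x = proj x')"
    have x': "x' \<in> carrier A \<and> proj x = proj x'"
      unfolding x'_def by (rule someI[of _ x]) (use x in simp)
    then have "f (x \<ominus>\<^bsub>A\<^esub> x') = \<zero>\<^bsub>B\<^esub>" using z proj_eq_iff x by blast
    then have "f x = f x'" using x x' f.minus by simp
    then show ?thesis by (simp only: g_def flip: x'_def)
  qed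
  have "g \<in> alg_hom K Q B"
    by (rule alg_homI)
      (auto simp: quot_simps(1) g proj_smult f.add f.mult f.one f.smult quot_simps(2-4))
  with g show ?thesis by blast
qed

text \<open>Generation passes to quotients, since the preimage of \<open>S\<close> is a subalgebra
  of \<open>A\<close> containing \<open>G\<close>. The hypothesis \<open>T\<close> expresses that
  \<open>G\<close> generates \<open>A\<close>.\<close>

lemma quot_generated:
  assumes S: "subalg K Q S" and T: "\<And>U. subalg K A U \<Longrightarrow> G \<subseteq> U \<Longrightarrow> U = carrier A"
    and G: "G \<subseteq> carrier A" "proj ` G \<subseteq> S"
  shows "S = carrier Q"
proof -
  interpret p: algebra_hom K A Q proj
    by (intro algebra_homI A.assoc_algebra_axioms quot_assoc_algebra proj_alg_hom)
  have "{x \<in> carrier A. proj x \<in> S} = carrier A"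
    by (rule T[OF p.preimage_subalg[OF S]]) (use G in auto)
  then show ?thesis using subalgD(1)[OF S] by (auto simp: quot_simps(1))
qed

end

text \<open>The kernel is an ideal, so it suffices that it contains the generators.\<close>

lemma genideal_hom_zero:
  assumes "algebra_hom K A B f" "S \<subseteq> carrier A" "\<And>x. x \<in> S \<Longrightarrow> f x = \<zero>\<^bsub>B\<^esub>" "x \<in> Idl\<^bsub>A\<^esub> S"
  shows "f x = \<zero>\<^bsub>B\<^esub>"
proof -
  interpret algebra_hom K A B f by fact
  have "S \<subseteq> a_kernel A B f"
    unfolding a_kernel_def' using assms(2,3) by blast
  then have "Idl\<^bsub>A\<^esub> S \<subseteq> a_kernel A B f"
    by (rule A.A.genideal_minimal[OF kernel_is_ideal])
  with assms(4) show ?thesis unfolding a_kernel_def' by blast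
qed

lemma quotient_algebra_genideal:
  "\<lbrakk>assoc_algebra K A; S \<subseteq> carrier A\<rbrakk> \<Longrightarrow> quotient_algebra K A (Idl\<^bsub>A\<^esub> S)"
  by (intro quotient_algebra.intro ring.genideal_ideal) (auto simp: assoc_algebra_def)

subsection \<open>Localizations\<close>

lemma (in monoid) Units_inv_mult:
  assumes x: "x \<in> Units G" and y: "y \<in> Units G"
  shows "inv (x \<otimes> y) = inv y \<otimes> inv x"
proof -
  have c: "x \<in> carrier G" "y \<in> carrier G" "inv x \<in> carrier G" "inv y \<in> carrier G"
    using x y by auto
  have "(x \<otimes> y) \<otimes> (inv y \<otimes> inv x) = x \<otimes> (y \<otimes> inv y) \<otimes> inv x"
    using c by (simp only: m_assoc m_closed)
  moreover have "(inv y \<otimes> inv x) \<otimes> (x \<otimes> y) = inv y \<otimes> (inv x \<otimes> x) \<otimes> y"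
    using c by (simp only: m_assoc m_closed)
  ultimately show ?thesis
    using x y c by (intro inv_unique'[symmetric]) simp_all
qed

lemma generated_submonoid_submonoid:
  assumes "monoid M" "S \<subseteq> carrier M"
  shows "submonoid (generated_submonoid M S) M"
proof -
  interpret monoid M by fact
  have "submonoid (carrier M) M" by (rule submonoid.intro) auto
  with assms show ?thesis
    by (intro submonoid.intro) (auto simp: generated_submonoid_def submonoid_def)
qed

lemma generated_submonoid_incl: "S \<subseteq> generated_submonoid M S"
  by (auto simp: generated_submonoid_def)

lemma generated_submonoid_induct [consumes 3, case_names one mem mult]:
  assumes "monoid M" "S \<subseteq> carrier M" "s \<in> generated_submonoid M S"
    and "Q \<one>\<^bsub>M\<^esub>" "\<And>s. s \<in> S \<Longrightarrow> Q s"
    and "\<And>s t. \<lbrakk>s \<in> carrier M; t \<in> carrier M; Q s; Q t\<rbrakk> \<Longrightarrow> Q (s \<otimes>\<^bsub>M\<^esub> t)"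
  shows "Q s"
proof -
  interpret monoid M by fact
  have "submonoid {s \<in> carrier M. Q s} M"
    by (rule submonoid.intro) (use assms in auto)
  moreover have "S \<subseteq> {s \<in> carrier M. Q s}" using assms by auto
  ultimately show ?thesis using assms(3) unfolding generated_submonoid_def by blast
qed

locale localization = R: assoc_algebra K R
  for K :: "('k, 'm) ring_scheme" and R :: "('k, 'a, 'u) module_scheme" +
  fixes S :: "'a set" and Q :: "('k, 'b, 'v) module_scheme" and \<phi> :: "'a \<Rightarrow> 'b"
  assumes S: "S \<subseteq> carrier R"
    and loc: "is_localization K R S Q \<phi>"
begin

lemma loc_assoc_algebra: "assoc_algebra K Q"
  using loc by (simp add: is_localization_def)

sublocale \<phi>: algebra_hom K R Q \<phi>
  using loc by (intro algebra_homI R.assoc_algebra_axioms) (auto simp: is_localization_def)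

abbreviation "den \<equiv> generated_submonoid R S"

lemma den_closed: "s \<in> den \<Longrightarrow> s \<in> carrier R"
  using generated_submonoid_submonoid[OF R.A.is_monoid S] by (auto simp: submonoid_def)

lemma den_mult: "\<lbrakk>s \<in> den; t \<in> den\<rbrakk> \<Longrightarrow> s \<otimes>\<^bsub>R\<^esub> t \<in> den"
  using generated_submonoid_submonoid[OF R.A.is_monoid S] by (auto simp: submonoid_def)

lemma den_one: "\<one>\<^bsub>R\<^esub> \<in> den"
  using generated_submonoid_submonoid[OF R.A.is_monoid S] by (auto simp: submonoid_def)

lemma den_unit: "s \<in> den \<Longrightarrow> \<phi> s \<in> Units Q"
  using loc by (simp add: is_localization_def)

lemma fraction:
  assumes x: "x \<in> carrier Q"
  obtains s a where "s \<in> den" "a \<in> carrier R" "\<phi> s \<otimes>\<^bsub>Q\<^esub> x = \<phi> a"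
proof -
  obtain s a where s: "s \<in> den" "a \<in> carrier R" "x = inv\<^bsub>Q\<^esub> (\<phi> s) \<otimes>\<^bsub>Q\<^esub> \<phi> a"
    using loc x by (auto simp: is_localization_def)
  have "\<phi> s \<otimes>\<^bsub>Q\<^esub> x = \<phi> a"
    using den_unit[OF s(1)] den_closed[OF s(1)] s(2) by (simp add: s(3) flip: \<phi>.B.A.m_assoc)
  with s that show ?thesis by blast
qed

text \<open>The right fraction \<phi>(a) \<phi>(s)^{-1} is an element of \<open>Q\<close> and hence
  also a left fraction. Comparing the two gives the Ore condition, but only after applying
  \<open>\<phi>\<close>, that is, up to elements annihilated by a denominator.\<close>

lemma ore:
  assumes s: "s \<in> den" and a: "a \<in> carrier R"
  obtains u v where "u \<in> den" "v \<in> carrier R" "\<phi> (u \<otimes>\<^bsub>R\<^esub> a) = \<phi> (v \<otimes>\<^bsub>R\<^esub> s)"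
proof -
  have sU: "\<phi> s \<in> Units Q" by (rule den_unit[OF s])
  have "\<phi> a \<otimes>\<^bsub>Q\<^esub> inv\<^bsub>Q\<^esub> (\<phi> s) \<in> carrier Q" using sU a by simp
  then obtain u v where u: "u \<in> den" "v \<in> carrier R"
    and e: "\<phi> u \<otimes>\<^bsub>Q\<^esub> (\<phi> a \<otimes>\<^bsub>Q\<^esub> inv\<^bsub>Q\<^esub> (\<phi> s)) = \<phi> v" by (rule fraction)
  have "\<phi> u \<otimes>\<^bsub>Q\<^esub> \<phi> a = \<phi> u \<otimes>\<^bsub>Q\<^esub> (\<phi> a \<otimes>\<^bsub>Q\<^esub> inv\<^bsub>Q\<^esub> (\<phi> s)) \<otimes>\<^bsub>Q\<^esub> \<phi> s"
    using sU a den_closed[OF u(1)] den_closed[OF s] by (simp add: \<phi>.B.A.m_assoc)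
  then have "\<phi> (u \<otimes>\<^bsub>R\<^esub> a) = \<phi> (v \<otimes>\<^bsub>R\<^esub> s)"
    unfolding e using a u den_closed s by (simp add: \<phi>.mult)
  with u that show ?thesis by blast
qed

text \<open>Denominators are products of elements of \<open>S\<close>, and their inverses are the
  reversed products of inverses; so inverting \<open>S\<close> is enough.\<close>

lemma loc_generated:
  assumes U: "subalg K Q U" and a: "\<And>a. a \<in> carrier R \<Longrightarrow> \<phi> a \<in> U"
    and s: "\<And>s. s \<in> S \<Longrightarrow> inv\<^bsub>Q\<^esub> (\<phi> s) \<in> U"
  shows "U = carrier Q"
proof -
  have i: "\<phi> s \<in> Units Q \<and> inv\<^bsub>Q\<^esub> (\<phi> s) \<in> U" if "s \<in> den" for s
    using R.A.is_monoid S that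
  proof (induct s rule: generated_submonoid_induct)
    case one
    show ?case using subalgD(3)[OF U] by (simp add: \<phi>.one)
  next
    case (mem t)
    then have "t \<in> den" using generated_submonoid_incl[of S R] by blast
    with mem show ?case by (simp add: s den_unit)
  next
    case (mult u v)
    then show ?case
      by (simp add: \<phi>.mult \<phi>.B.A.Units_inv_mult subalgD(4)[OF U])
  qed
  have "x \<in> U" if x: "x \<in> carrier Q" for x
  proof -
    obtain s a' where "s \<in> den" "a' \<in> carrier R" "x = inv\<^bsub>Q\<^esub> (\<phi> s) \<otimes>\<^bsub>Q\<^esub> \<phi> a'"
      using loc x by (auto simp: is_localization_def)
    then show ?thesis by (simp add: i a subalgD(4)[OF U])
  qed
  with subalgD(1)[OF U] show ?thesis by blast
qed

text \<open>The image of \<open>x\<close> is characterized by all its representations as a left fraction at once; two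
  representations are compared by means of the Ore condition, which holds as \<open>Q\<close> exists.\<close>

lemma loc_lift:
  assumes B: "assoc_algebra K B" and g: "g \<in> alg_hom K R B"
    and u: "\<And>s. s \<in> S \<Longrightarrow> g s \<in> Units B"
  shows "\<exists>h\<in>alg_hom K Q B. \<forall>a\<in>carrier R. h (\<phi> a) = g a"
proof -
  interpret g: algebra_hom K R B g
    by (intro algebra_homI B g R.assoc_algebra_axioms)
  note [simp] = den_closed
  have gU: "g s \<in> Units B" if "s \<in> den" for s
    using R.A.is_monoid S that
    by (induct s rule: generated_submonoid_induct) (use u in \<open>auto simp: g.one g.mult\<close>)
  have cancel: "y = y'"
    if "s \<in> den" "g s \<otimes>\<^bsub>B\<^esub> y = g s \<otimes>\<^bsub>B\<^esub> y'" "y \<in> carrier B" "y' \<in> carrier B" for s y y'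
    using that gU g.B.A.Units_l_cancel by blast
  \<comment> \<open>If \<open>\<phi>\<close> identifies b and b', then s (b - b') = 0 for some
    denominator s, and \<open>g s\<close> is a unit that can be cancelled. This absorbs the
    ambiguity left by \<open>ore\<close>.\<close>
  have ker: "g b = g b'" if b: "b \<in> carrier R" "b' \<in> carrier R" and e: "\<phi> b = \<phi> b'" for b b'
  proof -
    have "\<phi> (b \<ominus>\<^bsub>R\<^esub> b') = \<zero>\<^bsub>Q\<^esub>" using b e by (simp add: \<phi>.minus)
    then obtain s where s: "s \<in> den" "s \<otimes>\<^bsub>R\<^esub> (b \<ominus>\<^bsub>R\<^esub> b') = \<zero>\<^bsub>R\<^esub>"
      using loc b by (auto simp: is_localization_def)
    have "g s \<otimes>\<^bsub>B\<^esub> (g b \<ominus>\<^bsub>B\<^esub> g b') = g (s \<otimes>\<^bsub>R\<^esub> (b \<ominus>\<^bsub>R\<^esub> b'))"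
      using s(1) b by (simp add: g.mult g.minus)
    also have "\<dots> = g s \<otimes>\<^bsub>B\<^esub> \<zero>\<^bsub>B\<^esub>" using s by simp
    finally have "g b \<ominus>\<^bsub>B\<^esub> g b' = \<zero>\<^bsub>B\<^esub>" by (rule cancel[OF s(1)]) (use s(1) b in simp_all)
    then show ?thesis using b by simp
  qed
  define val where "val x y \<longleftrightarrow> y \<in> carrier B \<and>
    (\<forall>s\<in>den. \<forall>a\<in>carrier R. \<phi> s \<otimes>\<^bsub>Q\<^esub> x = \<phi> a \<longrightarrow> g s \<otimes>\<^bsub>B\<^esub> y = g a)" for x y
  have val_ex: "\<exists>y. val x y" if x: "x \<in> carrier Q" for x
  proof -
    obtain s a where s: "s \<in> den" and a: "a \<in> carrier R" and e: "\<phi> s \<otimes>\<^bsub>Q\<^esub> x = \<phi> a"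
      using x by (rule fraction)
    define y where "y = inv\<^bsub>B\<^esub> (g s) \<otimes>\<^bsub>B\<^esub> g a"
    have y: "y \<in> carrier B" using gU[OF s] a by (simp add: y_def)
    have gs: "g s \<otimes>\<^bsub>B\<^esub> y = g a" using gU[OF s] s a by (simp add: y_def flip: g.B.A.m_assoc)
    have "g s' \<otimes>\<^bsub>B\<^esub> y = g a'"
      if s': "s' \<in> den" and a': "a' \<in> carrier R" and e': "\<phi> s' \<otimes>\<^bsub>Q\<^esub> x = \<phi> a'" for s' a'
    proof -
      obtain u v where u: "u \<in> den" "v \<in> carrier R" and uv: "\<phi> (u \<otimes>\<^bsub>R\<^esub> s') = \<phi> (v \<otimes>\<^bsub>R\<^esub> s)"
        using s den_closed[OF s'] by (rule ore)
      have "\<phi> (u \<otimes>\<^bsub>R\<^esub> a') = \<phi> (u \<otimes>\<^bsub>R\<^esub> s') \<otimes>\<^bsub>Q\<^esub> x"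
        using u s' a' x by (simp add: \<phi>.mult \<phi>.B.A.m_assoc e')
      also have "\<dots> = \<phi> (v \<otimes>\<^bsub>R\<^esub> a)"
        unfolding uv using u s a x by (simp add: \<phi>.mult \<phi>.B.A.m_assoc e)
      finally have "g (u \<otimes>\<^bsub>R\<^esub> a') = g (v \<otimes>\<^bsub>R\<^esub> a)" by (intro ker) (use u a a' in simp_all)
      moreover have "g (u \<otimes>\<^bsub>R\<^esub> s') = g (v \<otimes>\<^bsub>R\<^esub> s)" by (rule ker) (use u s s' uv in simp_all)
      moreover have "g (v \<otimes>\<^bsub>R\<^esub> s) \<otimes>\<^bsub>B\<^esub> y = g (v \<otimes>\<^bsub>R\<^esub> a)"
        using u s a y by (simp add: g.mult g.B.A.m_assoc gs)
      ultimately have "g u \<otimes>\<^bsub>B\<^esub> (g s' \<otimes>\<^bsub>B\<^esub> y) = g u \<otimes>\<^bsub>B\<^esub> g a'"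
        using u s' a' y by (simp add: g.mult flip: g.B.A.m_assoc)
      then show ?thesis by (rule cancel[OF u(1)]) (use u s' a' y in simp_all)
    qed
    with y show ?thesis unfolding val_def by blast
  qed
  define h where "h x = (SOME y. val x y)" for x
  have h: "h x \<in> carrier B" "\<And>s a. \<lbrakk>s \<in> den; a \<in> carrier R; \<phi> s \<otimes>\<^bsub>Q\<^esub> x = \<phi> a\<rbrakk> \<Longrightarrow> g s \<otimes>\<^bsub>B\<^esub> h x = g a"
    if "x \<in> carrier Q" for x
    using someI_ex[OF val_ex[OF that]] by (simp_all add: h_def val_def)
  have h_\<phi>: "h (\<phi> a) = g a" if "a \<in> carrier R" for a
    using h[of "\<phi> a"] h(2)[of "\<phi> a" "\<one>\<^bsub>R\<^esub>" a] that den_one by (simp add: g.one \<phi>.one)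
  have "h \<in> alg_hom K Q B"
  proof (rule alg_homI)
    show "h \<one>\<^bsub>Q\<^esub> = \<one>\<^bsub>B\<^esub>" using h_\<phi>[of "\<one>\<^bsub>R\<^esub>"] by (simp add: g.one \<phi>.one)
  next
    fix x x' assume x: "x \<in> carrier Q" and x': "x' \<in> carrier Q"
    obtain s a where s: "s \<in> den" and a: "a \<in> carrier R" and e: "\<phi> s \<otimes>\<^bsub>Q\<^esub> x = \<phi> a"
      using x by (rule fraction)
    obtain s' a' where s': "s' \<in> den" and a': "a' \<in> carrier R" and e': "\<phi> s' \<otimes>\<^bsub>Q\<^esub> x' = \<phi> a'"
      using x' by (rule fraction)
    show "h (x \<otimes>\<^bsub>Q\<^esub> x') = h x \<otimes>\<^bsub>B\<^esub> h x'"
    proof -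
      \<comment> \<open>With u a = v s' up to the kernel of \<open>\<phi>\<close>, the product of
        fractions s^{-1} a and s'^{-1} a' is (u s)^{-1} (v a').\<close>
      obtain u v where u: "u \<in> den" "v \<in> carrier R" and uv: "\<phi> (u \<otimes>\<^bsub>R\<^esub> a) = \<phi> (v \<otimes>\<^bsub>R\<^esub> s')"
        using s' a by (rule ore)
      have "\<phi> (u \<otimes>\<^bsub>R\<^esub> s) \<otimes>\<^bsub>Q\<^esub> (x \<otimes>\<^bsub>Q\<^esub> x') = \<phi> u \<otimes>\<^bsub>Q\<^esub> (\<phi> s \<otimes>\<^bsub>Q\<^esub> x) \<otimes>\<^bsub>Q\<^esub> x'"
        using u s x x' by (simp add: \<phi>.mult \<phi>.B.A.m_assoc)
      also have "\<dots> = \<phi> (v \<otimes>\<^bsub>R\<^esub> s') \<otimes>\<^bsub>Q\<^esub> x'"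
        using u a by (simp add: e flip: uv \<phi>.mult)
      also have "\<dots> = \<phi> (v \<otimes>\<^bsub>R\<^esub> a')"
        using u s' x' a' by (simp add: \<phi>.mult \<phi>.B.A.m_assoc e')
      finally have "g (u \<otimes>\<^bsub>R\<^esub> s) \<otimes>\<^bsub>B\<^esub> h (x \<otimes>\<^bsub>Q\<^esub> x') = g (v \<otimes>\<^bsub>R\<^esub> a')"
        by (intro h(2)) (use u s x x' a' den_mult in simp_all)
      also have "\<dots> = g (v \<otimes>\<^bsub>R\<^esub> s') \<otimes>\<^bsub>B\<^esub> h x'"
        using u s' a' h[OF x'] e' by (simp add: g.mult g.B.A.m_assoc)
      also have "g (v \<otimes>\<^bsub>R\<^esub> s') = g (u \<otimes>\<^bsub>R\<^esub> a)"
        by (rule ker) (use uv u a s' in simp_all)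
      also have "g (u \<otimes>\<^bsub>R\<^esub> a) \<otimes>\<^bsub>B\<^esub> h x' = g (u \<otimes>\<^bsub>R\<^esub> s) \<otimes>\<^bsub>B\<^esub> (h x \<otimes>\<^bsub>B\<^esub> h x')"
        using u s a h(1)[OF x'] h(1)[OF x] h(2)[OF x s a e, symmetric]
        by (simp add: g.mult g.B.A.m_assoc)
      finally show ?thesis
        by (rule cancel[OF den_mult[OF u(1) s]]) (use x x' h in simp_all)
    qed
    show "h (x \<oplus>\<^bsub>Q\<^esub> x') = h x \<oplus>\<^bsub>B\<^esub> h x'"
    proof -
      \<comment> \<open>Here u s' = v s up to the kernel, so \<open>?d\<close> is a common left
        denominator of x and x'.\<close>
      obtain u v where u: "u \<in> den" "v \<in> carrier R" and uv: "\<phi> (u \<otimes>\<^bsub>R\<^esub> s') = \<phi> (v \<otimes>\<^bsub>R\<^esub> s)"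
        using s den_closed[OF s'] by (rule ore)
      let ?d = "u \<otimes>\<^bsub>R\<^esub> s'"
      have d: "?d \<in> den" using u s' by (simp add: den_mult)
      have dx: "\<phi> ?d \<otimes>\<^bsub>Q\<^esub> x = \<phi> (v \<otimes>\<^bsub>R\<^esub> a)"
        unfolding uv using u s a x by (simp add: \<phi>.mult \<phi>.B.A.m_assoc e)
      have dx': "\<phi> ?d \<otimes>\<^bsub>Q\<^esub> x' = \<phi> (u \<otimes>\<^bsub>R\<^esub> a')"
        using u s' a' x' by (simp add: \<phi>.mult \<phi>.B.A.m_assoc e')
      have "\<phi> ?d \<otimes>\<^bsub>Q\<^esub> (x \<oplus>\<^bsub>Q\<^esub> x') = \<phi> (v \<otimes>\<^bsub>R\<^esub> a \<oplus>\<^bsub>R\<^esub> u \<otimes>\<^bsub>R\<^esub> a')"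
        using x x' u a a' den_closed[OF d] by (simp add: \<phi>.B.A.r_distr dx dx' \<phi>.add)
      then have "g ?d \<otimes>\<^bsub>B\<^esub> h (x \<oplus>\<^bsub>Q\<^esub> x') = g (v \<otimes>\<^bsub>R\<^esub> a \<oplus>\<^bsub>R\<^esub> u \<otimes>\<^bsub>R\<^esub> a')"
        by (intro h(2)) (use x x' u a a' d in simp_all)
      also have "\<dots> = g ?d \<otimes>\<^bsub>B\<^esub> (h x \<oplus>\<^bsub>B\<^esub> h x')"
        using h(2)[OF x d _ dx] h(2)[OF x' d _ dx'] u a a' h(1)[OF x] h(1)[OF x'] den_closed[OF d]
        by (simp add: g.add g.B.A.r_distr)
      finally show ?thesis by (rule cancel[OF d]) (use x x' h in simp_all)
    qed
  next
    fix k x assume k: "k \<in> carrier K" and x: "x \<in> carrier Q"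
    obtain s a where s: "s \<in> den" and a: "a \<in> carrier R" and e: "\<phi> s \<otimes>\<^bsub>Q\<^esub> x = \<phi> a"
      using x by (rule fraction)
    have "\<phi> s \<otimes>\<^bsub>Q\<^esub> (k \<odot>\<^bsub>Q\<^esub> x) = \<phi> (k \<odot>\<^bsub>R\<^esub> a)"
      using s k x a by (simp add: \<phi>.B.smult_mult_right e \<phi>.smult)
    then have "g s \<otimes>\<^bsub>B\<^esub> h (k \<odot>\<^bsub>Q\<^esub> x) = g (k \<odot>\<^bsub>R\<^esub> a)"
      by (intro h(2)) (use s k x a in simp_all)
    also have "\<dots> = g s \<otimes>\<^bsub>B\<^esub> (k \<odot>\<^bsub>B\<^esub> h x)"
      using s k x a h[OF x] e by (simp add: g.smult g.B.smult_mult_right)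
    finally show "h (k \<odot>\<^bsub>Q\<^esub> x) = k \<odot>\<^bsub>B\<^esub> h x"
      by (rule cancel[OF s]) (use k x h in simp_all)
  qed (use h in auto)
  with h_\<phi> show ?thesis by blast
qed

end


subsection \<open>Tensor products\<close>

locale tensor_product = P: assoc_algebra K P + N: assoc_algebra K N
  for K :: "('k, 'm) ring_scheme" and P :: "('k, 'a, 'u) module_scheme"
    and N :: "('k, 'b, 'v) module_scheme"
begin

abbreviation "F \<equiv> monoid_algebra K (P \<times>\<times> N)"
abbreviation "T \<equiv> tensor_algebra K P N"
abbreviation tens (infixl \<open>\<otimes>\<^sub>T\<close> 75) where "p \<otimes>\<^sub>T n \<equiv> tensor K P N p n"

lemma prod_monoid: "monoid (P \<times>\<times> N)"
  by (intro DirProd_monoid P.A.is_monoid N.A.is_monoid)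

sublocale F: assoc_algebra K F
  by (intro monoid_algebra_assoc_algebra P.R.cring_axioms prod_monoid)

lemma pair_closed: "\<lbrakk>p \<in> carrier P; n \<in> carrier N\<rbrakk> \<Longrightarrow> delta K (p, n) \<in> carrier F"
  by (rule delta_closed[OF P.R.cring_axioms prod_monoid]) simp

lemma tensor_relations_closed: "tensor_relations K P N \<subseteq> carrier F"
  by (auto simp: tensor_relations_def Let_def intro!: F.minus_closed F.a_closed F.smult_closed pair_closed)

sublocale Q: quotient_algebra K F "tensor_ideal K P N"
  unfolding tensor_ideal_def
  by (intro quotient_algebra_genideal F.assoc_algebra_axioms tensor_relations_closed)

sublocale T: assoc_algebra K T
  unfolding tensor_algebra_def by (rule Q.quot_assoc_algebra)

sublocale proj: algebra_hom K F T Q.proj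
  unfolding tensor_algebra_def
  by (intro algebra_homI F.assoc_algebra_axioms Q.quot_assoc_algebra Q.proj_alg_hom)

lemma tens_closed [simp]: "\<lbrakk>p \<in> carrier P; n \<in> carrier N\<rbrakk> \<Longrightarrow> p \<otimes>\<^sub>T n \<in> carrier T"
  unfolding tensor_def by (rule proj.closed[OF pair_closed])

lemma relation_zero:
  assumes "x \<in> tensor_relations K P N"
  shows "Q.proj x = \<zero>\<^bsub>T\<^esub>"
proof -
  have "x \<in> tensor_ideal K P N"
    unfolding tensor_ideal_def using F.A.genideal_self[OF tensor_relations_closed] assms by blast
  then show ?thesis
    unfolding tensor_algebra_def using Q.proj_eq_zero_iff tensor_relations_closed assms by blast
qed

lemma tens_add_left:
  assumes "p \<in> carrier P" "p' \<in> carrier P" "n \<in> carrier N"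
  shows "(p \<oplus>\<^bsub>P\<^esub> p') \<otimes>\<^sub>T n = p \<otimes>\<^sub>T n \<oplus>\<^bsub>T\<^esub> p' \<otimes>\<^sub>T n"
proof -
  have "delta K (p \<oplus>\<^bsub>P\<^esub> p', n) \<ominus>\<^bsub>F\<^esub> (delta K (p, n) \<oplus>\<^bsub>F\<^esub> delta K (p', n)) \<in> tensor_relations K P N"
    unfolding tensor_relations_def Let_def using assms by blast
  from relation_zero[OF this] show ?thesis
    using assms by (simp add: proj.minus proj.add pair_closed tensor_def)
qed

lemma tens_add_right:
  assumes "p \<in> carrier P" "n \<in> carrier N" "n' \<in> carrier N"
  shows "p \<otimes>\<^sub>T (n \<oplus>\<^bsub>N\<^esub> n') = p \<otimes>\<^sub>T n \<oplus>\<^bsub>T\<^esub> p \<otimes>\<^sub>T n'"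
proof -
  have "delta K (p, n \<oplus>\<^bsub>N\<^esub> n') \<ominus>\<^bsub>F\<^esub> (delta K (p, n) \<oplus>\<^bsub>F\<^esub> delta K (p, n')) \<in> tensor_relations K P N"
    unfolding tensor_relations_def Let_def using assms by blast
  from relation_zero[OF this] show ?thesis
    using assms by (simp add: proj.minus proj.add pair_closed tensor_def)
qed

lemma tens_smult_left:
  assumes "a \<in> carrier K" "p \<in> carrier P" "n \<in> carrier N"
  shows "(a \<odot>\<^bsub>P\<^esub> p) \<otimes>\<^sub>T n = a \<odot>\<^bsub>T\<^esub> (p \<otimes>\<^sub>T n)"
proof -
  have "delta K (a \<odot>\<^bsub>P\<^esub> p, n) \<ominus>\<^bsub>F\<^esub> (a \<odot>\<^bsub>F\<^esub> delta K (p, n)) \<in> tensor_relations K P N"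
    unfolding tensor_relations_def Let_def using assms by blast
  from relation_zero[OF this] show ?thesis
    using assms by (simp add: proj.minus proj.smult pair_closed tensor_def)
qed

lemma tens_smult_right:
  assumes "a \<in> carrier K" "p \<in> carrier P" "n \<in> carrier N"
  shows "p \<otimes>\<^sub>T (a \<odot>\<^bsub>N\<^esub> n) = a \<odot>\<^bsub>T\<^esub> (p \<otimes>\<^sub>T n)"
proof -
  have "delta K (p, a \<odot>\<^bsub>N\<^esub> n) \<ominus>\<^bsub>F\<^esub> (a \<odot>\<^bsub>F\<^esub> delta K (p, n)) \<in> tensor_relations K P N"
    unfolding tensor_relations_def Let_def using assms by blast
  from relation_zero[OF this] show ?thesis
    using assms by (simp add: proj.minus proj.smult pair_closed tensor_def)
qed

lemma tens_mult:
  assumes "p \<in> carrier P" "p' \<in> carrier P" "n \<in> carrier N" "n' \<in> carrier N"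
  shows "(p \<otimes>\<^sub>T n) \<otimes>\<^bsub>T\<^esub> (p' \<otimes>\<^sub>T n') = (p \<otimes>\<^bsub>P\<^esub> p') \<otimes>\<^sub>T (n \<otimes>\<^bsub>N\<^esub> n')"
  unfolding tensor_def using assms
  by (simp add: pair_closed delta_mult[OF P.R.cring_axioms prod_monoid] flip: proj.mult)

lemma tens_one: "\<one>\<^bsub>P\<^esub> \<otimes>\<^sub>T \<one>\<^bsub>N\<^esub> = \<one>\<^bsub>T\<^esub>"
  unfolding tensor_def by (simp add: one_eq_delta flip: proj.one)

lemma tens_left_hom: "(\<lambda>p. p \<otimes>\<^sub>T \<one>\<^bsub>N\<^esub>) \<in> alg_hom K P T"
  by (rule alg_homI) (simp_all add: tens_mult tens_add_left tens_smult_left tens_one)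

lemma tens_right_hom: "(\<lambda>n. \<one>\<^bsub>P\<^esub> \<otimes>\<^sub>T n) \<in> alg_hom K N T"
  by (rule alg_homI) (simp_all add: tens_mult tens_add_right tens_smult_right tens_one)

text \<open>A pure tensor is the product of p \<otimes> 1 and 1 \<otimes> n, and pure tensors are
  the images of the basis elements of \<open>F\<close>.\<close>

lemma tens_generated:
  assumes S: "subalg K T S" and p: "\<And>p. p \<in> carrier P \<Longrightarrow> p \<otimes>\<^sub>T \<one>\<^bsub>N\<^esub> \<in> S"
    and n: "\<And>n. n \<in> carrier N \<Longrightarrow> \<one>\<^bsub>P\<^esub> \<otimes>\<^sub>T n \<in> S"
  shows "S = carrier T"
proof -
  have pn: "p \<otimes>\<^sub>T n \<in> S" if "p \<in> carrier P" "n \<in> carrier N" for p n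
    using subalgD(4)[OF S p[OF that(1)] n[OF that(2)]] that by (simp add: tens_mult)
  have "subalg K F {x \<in> carrier F. Q.proj x \<in> S}"
    by (rule proj.preimage_subalg[OF S])
  then have "{x \<in> carrier F. Q.proj x \<in> S} = carrier F"
    by (rule monoid_algebra_generated[OF P.R.cring_axioms prod_monoid])
      (use pn pair_closed in \<open>auto simp: tensor_def\<close>)
  moreover have "carrier T = Q.proj ` carrier F"
    unfolding tensor_algebra_def by (rule Q.quot_simps(1))
  ultimately show ?thesis using subalgD(1)[OF S] by auto
qed

text \<open>Because the images of \<open>\<alpha>\<close> and \<open>\<beta>\<close> commute,
  sending (p, n) to \<alpha>(p) \<beta>(n) is multiplicative on pairs and extends to
  \<open>F\<close>. It kills the tensor relations since multiplication in \<open>B\<close> is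
  bilinear.\<close>

lemma tensor_lift:
  assumes B: "assoc_algebra K B" and \<alpha>: "\<alpha> \<in> alg_hom K P B" and \<beta>: "\<beta> \<in> alg_hom K N B"
    and comm: "\<And>p n. \<lbrakk>p \<in> carrier P; n \<in> carrier N\<rbrakk> \<Longrightarrow> \<alpha> p \<otimes>\<^bsub>B\<^esub> \<beta> n = \<beta> n \<otimes>\<^bsub>B\<^esub> \<alpha> p"
  shows "\<exists>\<gamma>\<in>alg_hom K T B. \<forall>p\<in>carrier P. \<forall>n\<in>carrier N. \<gamma> (p \<otimes>\<^sub>T n) = \<alpha> p \<otimes>\<^bsub>B\<^esub> \<beta> n"
proof -
  interpret \<alpha>: algebra_hom K P B \<alpha> by (intro algebra_homI B \<alpha> P.assoc_algebra_axioms)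
  interpret \<beta>: algebra_hom K N B \<beta> by (intro algebra_homI B \<beta> N.assoc_algebra_axioms)
  have swap: "(\<alpha> p \<otimes>\<^bsub>B\<^esub> \<alpha> p') \<otimes>\<^bsub>B\<^esub> (\<beta> n \<otimes>\<^bsub>B\<^esub> \<beta> n') = (\<alpha> p \<otimes>\<^bsub>B\<^esub> \<beta> n) \<otimes>\<^bsub>B\<^esub> (\<alpha> p' \<otimes>\<^bsub>B\<^esub> \<beta> n')"
    if "p \<in> carrier P" "p' \<in> carrier P" "n \<in> carrier N" "n' \<in> carrier N" for p p' n n'
  proof -
    have "(\<alpha> p \<otimes>\<^bsub>B\<^esub> \<alpha> p') \<otimes>\<^bsub>B\<^esub> (\<beta> n \<otimes>\<^bsub>B\<^esub> \<beta> n') = \<alpha> p \<otimes>\<^bsub>B\<^esub> (\<alpha> p' \<otimes>\<^bsub>B\<^esub> \<beta> n) \<otimes>\<^bsub>B\<^esub> \<beta> n'"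
      using that by (simp add: \<alpha>.B.A.m_assoc)
    also have "\<dots> = \<alpha> p \<otimes>\<^bsub>B\<^esub> (\<beta> n \<otimes>\<^bsub>B\<^esub> \<alpha> p') \<otimes>\<^bsub>B\<^esub> \<beta> n'"
      using that by (simp only: comm)
    finally show ?thesis using that by (simp add: \<alpha>.B.A.m_assoc)
  qed
  have "\<exists>H\<in>alg_hom K F B. \<forall>u\<in>carrier (P \<times>\<times> N). H (delta K u) = \<alpha> (fst u) \<otimes>\<^bsub>B\<^esub> \<beta> (snd u)"
    by (rule monoid_algebra_lift[OF P.R.cring_axioms prod_monoid B])
      (auto simp: \<alpha>.mult \<beta>.mult swap \<alpha>.one \<beta>.one)
  then obtain H where H: "H \<in> alg_hom K F B"
    and Hd: "\<And>p n. \<lbrakk>p \<in> carrier P; n \<in> carrier N\<rbrakk> \<Longrightarrow> H (delta K (p, n)) = \<alpha> p \<otimes>\<^bsub>B\<^esub> \<beta> n"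
    by auto
  interpret H: algebra_hom K F B H by (intro algebra_homI B H F.assoc_algebra_axioms)
  have rel: "H x = \<zero>\<^bsub>B\<^esub>" if "x \<in> tensor_relations K P N" for x
    using that unfolding tensor_relations_def Let_def
    by (auto simp: H.minus H.add H.smult Hd pair_closed \<alpha>.add \<beta>.add \<alpha>.smult \<beta>.smult
        \<alpha>.B.A.l_distr \<alpha>.B.A.r_distr \<alpha>.B.smult_mult_left \<alpha>.B.smult_mult_right)
  have "H x = \<zero>\<^bsub>B\<^esub>" if "x \<in> tensor_ideal K P N" for x
    using genideal_hom_zero[OF H.algebra_hom_axioms tensor_relations_closed rel] that
    by (simp add: tensor_ideal_def)
  from Q.quot_lift[OF B H this] obtain \<gamma> where \<gamma>: "\<gamma> \<in> alg_hom K T B"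
      "\<And>x. x \<in> carrier F \<Longrightarrow> \<gamma> (Q.proj x) = H x"
    unfolding tensor_algebra_def by blast
  have "\<gamma> (p \<otimes>\<^sub>T n) = \<alpha> p \<otimes>\<^bsub>B\<^esub> \<beta> n" if "p \<in> carrier P" "n \<in> carrier N" for p n
    using that by (simp add: tensor_def \<gamma>(2) Hd pair_closed)
  with \<gamma>(1) show ?thesis by blast
qed

end

subsection \<open>Algebras graded by integer vectors\<close>

definition deg_group :: "(nat \<Rightarrow> int) monoid"
  where "deg_group = \<lparr>carrier = UNIV, monoid.mult = (\<lambda>f g i. f i + g i), one = (\<lambda>i. 0)\<rparr>"

lemma deg_group_simps [simp]:
  "carrier deg_group = UNIV" "f \<otimes>\<^bsub>deg_group\<^esub> g = (\<lambda>i. f i + g i)" "\<one>\<^bsub>deg_group\<^esub> = (\<lambda>i. 0)"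
  by (simp_all add: deg_group_def)

lemma deg_group_monoid: "monoid deg_group"
  by (rule monoidI) (auto simp: add.assoc)

context assoc_algebra
begin

abbreviation "AG \<equiv> coeff_algebra A deg_group"

lemma AG_assoc_algebra: "assoc_algebra K AG"
  by (rule coeff_algebra_assoc_algebra[OF assoc_algebra_axioms deg_group_monoid])

lemma AG_monoid_ring: "monoid_ring A deg_group"
  by (intro monoid_ring.intro A.ring_axioms deg_group_monoid)

lemma single_AG_closed [simp]: "a \<in> carrier A \<Longrightarrow> single A g a \<in> carrier AG"
  unfolding coeff_algebra_def by (rule monoid_ring.single_closed[OF AG_monoid_ring]) simp_all

lemma single_AG_mult:
  "\<lbrakk>a \<in> carrier A; b \<in> carrier A\<rbrakk> \<Longrightarrow>
    single A g a \<otimes>\<^bsub>AG\<^esub> single A h b = single A (\<lambda>i. g i + h i) (a \<otimes>\<^bsub>A\<^esub> b)"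
  unfolding coeff_algebra_def by (subst monoid_ring.single_mult[OF AG_monoid_ring]) simp_all

lemma AG_add: "(x \<oplus>\<^bsub>AG\<^esub> y) g = x g \<oplus>\<^bsub>A\<^esub> y g"
  by (simp add: coeff_algebra_def)

lemma AG_zero: "\<zero>\<^bsub>AG\<^esub> g = \<zero>\<^bsub>A\<^esub>"
  by (simp add: coeff_algebra_def)

lemma AG_closed: "x \<in> carrier AG \<Longrightarrow> x g \<in> carrier A"
  unfolding coeff_algebra_def by (rule monoid_ring.conv_closed[OF AG_monoid_ring])

lemma single_AG_add:
  "single A g a \<oplus>\<^bsub>AG\<^esub> single A g b = single A g (a \<oplus>\<^bsub>A\<^esub> b)"
  by (rule ext) (simp add: AG_add single_def)

lemma single_AG_smult:
  "k \<in> carrier K \<Longrightarrow> k \<odot>\<^bsub>AG\<^esub> single A g a = single A g (k \<odot>\<^bsub>A\<^esub> a)"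
  by (rule ext) (simp add: coeff_algebra_def single_def)

lemma single_AG_one: "single A (\<lambda>i. 0) \<one>\<^bsub>A\<^esub> = \<one>\<^bsub>AG\<^esub>"
  by (simp add: coeff_algebra_def)

lemma single_AG_zero: "single A g \<zero>\<^bsub>A\<^esub> = \<zero>\<^bsub>AG\<^esub>"
  by (rule ext) (simp add: AG_zero single_def)

lemma single_AG_minus:
  assumes "a \<in> carrier A" "b \<in> carrier A"
  shows "single A g a \<ominus>\<^bsub>AG\<^esub> single A g b = single A g (a \<ominus>\<^bsub>A\<^esub> b)"
proof -
  interpret AG: assoc_algebra K AG by (rule AG_assoc_algebra)
  have "single A g b \<oplus>\<^bsub>AG\<^esub> single A g (\<ominus>\<^bsub>A\<^esub> b) = \<zero>\<^bsub>AG\<^esub>"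
    using assms by (simp add: single_AG_add r_neg single_AG_zero)
  then have "\<ominus>\<^bsub>AG\<^esub> single A g b = single A g (\<ominus>\<^bsub>A\<^esub> b)"
    using assms by (metis AG.M.a_comm AG.M.minus_equality M.a_inv_closed single_AG_closed)
  then show ?thesis by (simp add: AG.M.minus_eq M.minus_eq single_AG_add)
qed

lemma single_AG_inverse:
  assumes "a \<in> Units A"
  shows "single A g a \<in> Units AG" "inv\<^bsub>AG\<^esub> (single A g a) = single A (\<lambda>i. - g i) (inv\<^bsub>A\<^esub> a)"
proof -
  interpret AG: assoc_algebra K AG by (rule AG_assoc_algebra)
  have a: "a \<in> carrier A" "inv\<^bsub>A\<^esub> a \<in> carrier A" using assms by auto
  have e: "single A g a \<otimes>\<^bsub>AG\<^esub> single A (\<lambda>i. - g i) (inv\<^bsub>A\<^esub> a) = \<one>\<^bsub>AG\<^esub>"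
     "single A (\<lambda>i. - g i) (inv\<^bsub>A\<^esub> a) \<otimes>\<^bsub>AG\<^esub> single A g a = \<one>\<^bsub>AG\<^esub>"
    using assms a by (simp_all add: single_AG_mult single_AG_one)
  with a show "single A g a \<in> Units AG" unfolding Units_def
    by (intro CollectI conjI bexI[of _ "single A (\<lambda>i. - g i) (inv\<^bsub>A\<^esub> a)"]) simp_all
  show "inv\<^bsub>AG\<^esub> (single A g a) = single A (\<lambda>i. - g i) (inv\<^bsub>A\<^esub> a)"
    by (rule AG.A.inv_unique'[symmetric, OF _ _ e]) (simp_all add: a)
qed

end


section \<open>Quantum matrices and their localized quotients\<close>

text \<open>The defining relations for an arbitrary family in an arbitrary algebra: transported
  along homomorphisms, and the hypothesis of the universal property
  \<open>qmat_lift\<close>.\<close>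

definition qmat_rel ::
  "('k, 'm) ring_scheme \<Rightarrow> 'k \<Rightarrow> nat \<Rightarrow> ('k, 'a, 'u) module_scheme \<Rightarrow> (nat \<Rightarrow> nat \<Rightarrow> 'a) \<Rightarrow> bool"
  where "qmat_rel K q n B b \<longleftrightarrow>
    (\<forall>i\<in>{1..n}. \<forall>j\<in>{1..n}. \<forall>l\<in>{1..n}. i < l \<longrightarrow>
      b i j \<otimes>\<^bsub>B\<^esub> b l j = q \<odot>\<^bsub>B\<^esub> (b l j \<otimes>\<^bsub>B\<^esub> b i j)) \<and>
    (\<forall>i\<in>{1..n}. \<forall>j\<in>{1..n}. \<forall>m\<in>{1..n}. j < m \<longrightarrow>
      b i j \<otimes>\<^bsub>B\<^esub> b i m = q \<odot>\<^bsub>B\<^esub> (b i m \<otimes>\<^bsub>B\<^esub> b i j)) \<and>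
    (\<forall>i\<in>{1..n}. \<forall>j\<in>{1..n}. \<forall>l\<in>{1..n}. \<forall>m\<in>{1..n}. i < l \<and> m < j \<longrightarrow>
      b i j \<otimes>\<^bsub>B\<^esub> b l m = b l m \<otimes>\<^bsub>B\<^esub> b i j) \<and>
    (\<forall>i\<in>{1..n}. \<forall>j\<in>{1..n}. \<forall>l\<in>{1..n}. \<forall>m\<in>{1..n}. i < l \<and> j < m \<longrightarrow>
      b i j \<otimes>\<^bsub>B\<^esub> b l m \<ominus>\<^bsub>B\<^esub> b l m \<otimes>\<^bsub>B\<^esub> b i j =
        (q \<ominus>\<^bsub>K\<^esub> inv\<^bsub>K\<^esub> q) \<odot>\<^bsub>B\<^esub> (b i m \<otimes>\<^bsub>B\<^esub> b l j))"

lemma qmat_relD: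
  assumes "qmat_rel K q n B b"
  shows "\<lbrakk>i \<in> {1..n}; j \<in> {1..n}; l \<in> {1..n}; i < l\<rbrakk> \<Longrightarrow>
      b i j \<otimes>\<^bsub>B\<^esub> b l j = q \<odot>\<^bsub>B\<^esub> (b l j \<otimes>\<^bsub>B\<^esub> b i j)"
    "\<lbrakk>i \<in> {1..n}; j \<in> {1..n}; m \<in> {1..n}; j < m\<rbrakk> \<Longrightarrow>
      b i j \<otimes>\<^bsub>B\<^esub> b i m = q \<odot>\<^bsub>B\<^esub> (b i m \<otimes>\<^bsub>B\<^esub> b i j)"
    "\<lbrakk>i \<in> {1..n}; j \<in> {1..n}; l \<in> {1..n}; m \<in> {1..n}; i < l; m < j\<rbrakk> \<Longrightarrow>
      b i j \<otimes>\<^bsub>B\<^esub> b l m = b l m \<otimes>\<^bsub>B\<^esub> b i j"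
    "\<lbrakk>i \<in> {1..n}; j \<in> {1..n}; l \<in> {1..n}; m \<in> {1..n}; i < l; j < m\<rbrakk> \<Longrightarrow>
      b i j \<otimes>\<^bsub>B\<^esub> b l m \<ominus>\<^bsub>B\<^esub> b l m \<otimes>\<^bsub>B\<^esub> b i j =
        (q \<ominus>\<^bsub>K\<^esub> inv\<^bsub>K\<^esub> q) \<odot>\<^bsub>B\<^esub> (b i m \<otimes>\<^bsub>B\<^esub> b l j)"
proof -
  note c = assms[unfolded qmat_rel_def]
  show "\<lbrakk>i \<in> {1..n}; j \<in> {1..n}; l \<in> {1..n}; i < l\<rbrakk> \<Longrightarrow>
      b i j \<otimes>\<^bsub>B\<^esub> b l j = q \<odot>\<^bsub>B\<^esub> (b l j \<otimes>\<^bsub>B\<^esub> b i j)"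
    using c[THEN conjunct1] by blast
  show "\<lbrakk>i \<in> {1..n}; j \<in> {1..n}; m \<in> {1..n}; j < m\<rbrakk> \<Longrightarrow>
      b i j \<otimes>\<^bsub>B\<^esub> b i m = q \<odot>\<^bsub>B\<^esub> (b i m \<otimes>\<^bsub>B\<^esub> b i j)"
    using c[THEN conjunct2, THEN conjunct1] by blast
  show "\<lbrakk>i \<in> {1..n}; j \<in> {1..n}; l \<in> {1..n}; m \<in> {1..n}; i < l; m < j\<rbrakk> \<Longrightarrow>
      b i j \<otimes>\<^bsub>B\<^esub> b l m = b l m \<otimes>\<^bsub>B\<^esub> b i j"
    using c[THEN conjunct2, THEN conjunct2, THEN conjunct1] by blast
  show "\<lbrakk>i \<in> {1..n}; j \<in> {1..n}; l \<in> {1..n}; m \<in> {1..n}; i < l; j < m\<rbrakk> \<Longrightarrow>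
      b i j \<otimes>\<^bsub>B\<^esub> b l m \<ominus>\<^bsub>B\<^esub> b l m \<otimes>\<^bsub>B\<^esub> b i j =
        (q \<ominus>\<^bsub>K\<^esub> inv\<^bsub>K\<^esub> q) \<odot>\<^bsub>B\<^esub> (b i m \<otimes>\<^bsub>B\<^esub> b l j)"
    using c[THEN conjunct2, THEN conjunct2, THEN conjunct2] by blast
qed

lemma qmat_rel_hom:
  assumes f: "algebra_hom K A B f" and q: "q \<in> Units K"
    and a: "\<And>i j. \<lbrakk>i \<in> {1..n}; j \<in> {1..n}\<rbrakk> \<Longrightarrow> a i j \<in> carrier A"
    and rel: "qmat_rel K q n A a"
  shows "qmat_rel K q n B (\<lambda>i j. f (a i j))"
proof -
  interpret algebra_hom K A B f by fact
  have k: "q \<in> carrier K" "q \<ominus>\<^bsub>K\<^esub> inv\<^bsub>K\<^esub> q \<in> carrier K" using q by auto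
  note r = qmat_relD[OF rel, THEN arg_cong[of _ _ f]]
  note [simp] = a k mult smult minus
  note [simp del] = One_nat_def atLeastAtMost_iff
  show ?thesis unfolding qmat_rel_def
  proof (intro conjI ballI impI)
    fix i j l assume *: "i \<in> {1..n}" "j \<in> {1..n}" "l \<in> {1..n}" "i < l"
    from r(1)[OF this] this(1-3)
    show "f (a i j) \<otimes>\<^bsub>B\<^esub> f (a l j) = q \<odot>\<^bsub>B\<^esub> (f (a l j) \<otimes>\<^bsub>B\<^esub> f (a i j))" by simp
  next
    fix i j m assume *: "i \<in> {1..n}" "j \<in> {1..n}" "m \<in> {1..n}" "j < m"
    from r(2)[OF this] this(1-3)
    show "f (a i j) \<otimes>\<^bsub>B\<^esub> f (a i m) = q \<odot>\<^bsub>B\<^esub> (f (a i m) \<otimes>\<^bsub>B\<^esub> f (a i j))" by simp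
  next
    fix i j l m assume *: "i \<in> {1..n}" "j \<in> {1..n}" "l \<in> {1..n}" "m \<in> {1..n}" "i < l \<and> m < j"
    from r(3)[of i j l m] *
    show "f (a i j) \<otimes>\<^bsub>B\<^esub> f (a l m) = f (a l m) \<otimes>\<^bsub>B\<^esub> f (a i j)" by simp
  next
    fix i j l m assume *: "i \<in> {1..n}" "j \<in> {1..n}" "l \<in> {1..n}" "m \<in> {1..n}" "i < l \<and> j < m"
    from r(4)[of i j l m] *
    show "f (a i j) \<otimes>\<^bsub>B\<^esub> f (a l m) \<ominus>\<^bsub>B\<^esub> f (a l m) \<otimes>\<^bsub>B\<^esub> f (a i j) =
        (q \<ominus>\<^bsub>K\<^esub> inv\<^bsub>K\<^esub> q) \<odot>\<^bsub>B\<^esub> (f (a i m) \<otimes>\<^bsub>B\<^esub> f (a l j))" by simp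
  qed
qed

section \<open>Quantum matrices by generators and relations\<close>

locale quantum_matrices = cring K for K :: "('k, 'm) ring_scheme" (structure) +
  fixes q :: 'k and n :: nat
  assumes q: "q \<in> Units K"
begin

declare One_nat_def [simp del] atLeastAtMost_iff [simp del]

abbreviation "FA \<equiv> free_algebra K ({1..n} \<times> {1..n})"
abbreviation "A \<equiv> qmat K q n"
abbreviation "QX \<equiv> qmat_X K q n"

lemma q_closed [simp]: "q \<in> carrier K" "inv\<^bsub>K\<^esub> q \<in> carrier K"
  using q by auto

sublocale FA: assoc_algebra K FA
  by (rule free_algebra_assoc_algebra) (rule cring_axioms)

lemma gen_closed [simp]: "\<lbrakk>i \<in> {1..n}; j \<in> {1..n}\<rbrakk> \<Longrightarrow> delta K [(i, j)] \<in> carrier FA"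
  by (rule delta_generator_closed[OF cring_axioms]) simp

lemma qmat_relations_closed: "qmat_relations K q n \<subseteq> carrier FA"
  unfolding qmat_relations_def Let_def
  by (intro Un_least subsetI; elim CollectE exE conjE; simp)

sublocale quot: quotient_algebra K FA "qmat_ideal K q n"
  unfolding qmat_ideal_def
  by (intro quotient_algebra_genideal FA.assoc_algebra_axioms qmat_relations_closed)

sublocale A: assoc_algebra K A
  unfolding qmat_def by (rule quot.quot_assoc_algebra)

sublocale proj: algebra_hom K FA A quot.proj
  unfolding qmat_def
  by (intro algebra_homI FA.assoc_algebra_axioms quot.quot_assoc_algebra quot.proj_alg_hom)

lemma X_closed [simp]: "\<lbrakk>i \<in> {1..n}; j \<in> {1..n}\<rbrakk> \<Longrightarrow> QX i j \<in> carrier A"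
  unfolding qmat_X_def by (intro proj.closed gen_closed)

lemma qmat_relation_zero:
  assumes "x \<in> qmat_relations K q n"
  shows "quot.proj x = \<zero>\<^bsub>A\<^esub>"
proof -
  have "x \<in> qmat_ideal K q n"
    unfolding qmat_ideal_def using FA.A.genideal_self[OF qmat_relations_closed] assms by blast
  then show ?thesis
    unfolding qmat_def using quot.proj_eq_zero_iff qmat_relations_closed assms by blast
qed

lemma qmat_X_rel: "qmat_rel K q n A QX"
  unfolding qmat_rel_def
proof (intro conjI ballI impI)
  fix i j l assume i: "i \<in> {1..n}" and j: "j \<in> {1..n}" and l: "l \<in> {1..n}" and il: "i < l"
  have "delta K [(i, j)] \<otimes>\<^bsub>FA\<^esub> delta K [(l, j)] \<ominus>\<^bsub>FA\<^esub> q \<odot>\<^bsub>FA\<^esub> (delta K [(l, j)] \<otimes>\<^bsub>FA\<^esub> delta K [(i, j)])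
      \<in> qmat_relations K q n"
    unfolding qmat_relations_def Let_def
    by (rule UnI1, rule UnI1, rule UnI1, intro CollectI exI conjI, rule refl) (use i j l il in simp_all)
  from qmat_relation_zero[OF this] show "QX i j \<otimes>\<^bsub>A\<^esub> QX l j = q \<odot>\<^bsub>A\<^esub> (QX l j \<otimes>\<^bsub>A\<^esub> QX i j)"
    using i j l by (simp add: proj.minus proj.mult proj.smult qmat_X_def)
next
  fix i j m assume i: "i \<in> {1..n}" and j: "j \<in> {1..n}" and m: "m \<in> {1..n}" and jm: "j < m"
  have "delta K [(i, j)] \<otimes>\<^bsub>FA\<^esub> delta K [(i, m)] \<ominus>\<^bsub>FA\<^esub> q \<odot>\<^bsub>FA\<^esub> (delta K [(i, m)] \<otimes>\<^bsub>FA\<^esub> delta K [(i, j)])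
      \<in> qmat_relations K q n"
    unfolding qmat_relations_def Let_def
    by (rule UnI1, rule UnI1, rule UnI2, intro CollectI exI conjI, rule refl) (use i j m jm in simp_all)
  from qmat_relation_zero[OF this] show "QX i j \<otimes>\<^bsub>A\<^esub> QX i m = q \<odot>\<^bsub>A\<^esub> (QX i m \<otimes>\<^bsub>A\<^esub> QX i j)"
    using i j m by (simp add: proj.minus proj.mult proj.smult qmat_X_def)
next
  fix i j l m assume i: "i \<in> {1..n}" and j: "j \<in> {1..n}" and l: "l \<in> {1..n}" and m: "m \<in> {1..n}"
    and lt: "i < l \<and> m < j"
  have "delta K [(i, j)] \<otimes>\<^bsub>FA\<^esub> delta K [(l, m)] \<ominus>\<^bsub>FA\<^esub> delta K [(l, m)] \<otimes>\<^bsub>FA\<^esub> delta K [(i, j)]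
      \<in> qmat_relations K q n"
    unfolding qmat_relations_def Let_def
    by (rule UnI1, rule UnI2, intro CollectI exI conjI, rule refl) (use i j l m lt in simp_all)
  from qmat_relation_zero[OF this] show "QX i j \<otimes>\<^bsub>A\<^esub> QX l m = QX l m \<otimes>\<^bsub>A\<^esub> QX i j"
    using i j l m by (simp add: proj.minus proj.mult proj.smult qmat_X_def)
next
  fix i j l m assume i: "i \<in> {1..n}" and j: "j \<in> {1..n}" and l: "l \<in> {1..n}" and m: "m \<in> {1..n}"
    and lt: "i < l \<and> j < m"
  have "(delta K [(i, j)] \<otimes>\<^bsub>FA\<^esub> delta K [(l, m)] \<ominus>\<^bsub>FA\<^esub> delta K [(l, m)] \<otimes>\<^bsub>FA\<^esub> delta K [(i, j)])
      \<ominus>\<^bsub>FA\<^esub> (q \<ominus>\<^bsub>K\<^esub> inv\<^bsub>K\<^esub> q) \<odot>\<^bsub>FA\<^esub> (delta K [(i, m)] \<otimes>\<^bsub>FA\<^esub> delta K [(l, j)])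
      \<in> qmat_relations K q n"
    unfolding qmat_relations_def Let_def
    by (rule UnI2, intro CollectI exI conjI, rule refl) (use i j l m lt in simp_all)
  from qmat_relation_zero[OF this]
  show "QX i j \<otimes>\<^bsub>A\<^esub> QX l m \<ominus>\<^bsub>A\<^esub> QX l m \<otimes>\<^bsub>A\<^esub> QX i j =
      (q \<ominus>\<^bsub>K\<^esub> inv\<^bsub>K\<^esub> q) \<odot>\<^bsub>A\<^esub> (QX i m \<otimes>\<^bsub>A\<^esub> QX l j)"
    using i j l m by (simp add: proj.minus proj.mult proj.smult qmat_X_def)
qed

lemma qmat_lift:
  assumes B: "assoc_algebra K B"
    and b: "\<And>i j. \<lbrakk>i \<in> {1..n}; j \<in> {1..n}\<rbrakk> \<Longrightarrow> b i j \<in> carrier B"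
    and rel: "qmat_rel K q n B b"
  shows "\<exists>f\<in>alg_hom K A B. \<forall>i\<in>{1..n}. \<forall>j\<in>{1..n}. f (QX i j) = b i j"
proof -
  interpret B: assoc_algebra K B by fact
  have "\<exists>h\<in>alg_hom K FA B. \<forall>g\<in>{1..n} \<times> {1..n}. h (delta K [g]) = (case g of (i, j) \<Rightarrow> b i j)"
    by (rule free_algebra_lift[OF cring_axioms B]) (use b in auto)
  then obtain h where h: "h \<in> alg_hom K FA B"
    and hd: "\<And>i j. \<lbrakk>i \<in> {1..n}; j \<in> {1..n}\<rbrakk> \<Longrightarrow> h (delta K [(i, j)]) = b i j"
    by auto
  interpret h: algebra_hom K FA B h by (intro algebra_homI B h FA.assoc_algebra_axioms)
  have "qmat_relations K q n \<subseteq> {x. h x = \<zero>\<^bsub>B\<^esub>}"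
    unfolding qmat_relations_def Let_def
    by (intro Un_least subsetI; elim CollectE exE conjE;
        simp add: h.minus h.mult h.smult hd b; rule qmat_relD[OF rel]; simp)
  then have "h x = \<zero>\<^bsub>B\<^esub>" if "x \<in> qmat_ideal K q n" for x
    using genideal_hom_zero[OF h.algebra_hom_axioms qmat_relations_closed] that
    by (auto simp: qmat_ideal_def)
  from quot.quot_lift[OF B h this] obtain f where f: "f \<in> alg_hom K A B"
      "\<And>x. x \<in> carrier FA \<Longrightarrow> f (quot.proj x) = h x"
    unfolding qmat_def by blast
  have "f (QX i j) = b i j" if "i \<in> {1..n}" "j \<in> {1..n}" for i j
    unfolding qmat_X_def using that by (simp only: f(2) gen_closed hd)
  with f(1) show ?thesis by blast
qed

lemma qmat_generated:
  assumes U: "subalg K A U" and x: "\<And>i j. \<lbrakk>i \<in> {1..n}; j \<in> {1..n}\<rbrakk> \<Longrightarrow> QX i j \<in> U"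
  shows "U = carrier A"
  unfolding qmat_def
proof (rule quot.quot_generated[OF U[unfolded qmat_def]])
  show "V = carrier FA"
    if "subalg K FA V" "(\<lambda>g. delta K [g]) ` ({1..n} \<times> {1..n}) \<subseteq> V" for V
    by (rule free_algebra_generated[OF cring_axioms that(1)]) (use that(2) in auto)
  show "(\<lambda>g. delta K [g]) ` ({1..n} \<times> {1..n}) \<subseteq> carrier FA" by auto
  show "quot.proj ` (\<lambda>g. delta K [g]) ` ({1..n} \<times> {1..n}) \<subseteq> U"
    using x by (auto simp: qmat_X_def)
qed

end

text \<open>Covers R^+ and R^- together: \<open>D\<close> is the set of positions whose generators
  are set to zero, \<open>E\<close> the set of positions whose generators are inverted.\<close>

locale localized_quotient = quantum_matrices K q n
  for K :: "('k, 'm) ring_scheme" (structure) and q :: 'k and n :: nat +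
  fixes D E :: "(nat \<times> nat) set" and Q :: "('k, 'a, 'u) module_scheme"
    and \<phi> :: "'k qmat set \<Rightarrow> 'a" and I
  assumes I_def: "I = Idl\<^bsub>qmat K q n\<^esub> ((\<lambda>(i, j). qmat_X K q n i j) ` D)"
    and D: "D \<subseteq> {1..n} \<times> {1..n}" and E: "E \<subseteq> {1..n} \<times> {1..n}"
    and loc: "is_localization K (quot_algebra (qmat K q n) I)
      ((\<lambda>(i, j). I +>\<^bsub>qmat K q n\<^esub> qmat_X K q n i j) ` E) Q \<phi>"
begin

definition "x i j = \<phi> (I +>\<^bsub>A\<^esub> QX i j)"

lemma killed_closed: "(\<lambda>(i, j). QX i j) ` D \<subseteq> carrier A"
  using D by auto

sublocale R: quotient_algebra K A I
  unfolding I_def by (intro quotient_algebra_genideal A.assoc_algebra_axioms killed_closed)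

sublocale p: algebra_hom K A R.Q R.proj
  by (intro algebra_homI A.assoc_algebra_axioms R.quot_assoc_algebra R.proj_alg_hom)

sublocale L: localization K R.Q "(\<lambda>(i, j). R.proj (QX i j)) ` E" Q \<phi>
proof (rule localization.intro[OF R.quot_assoc_algebra], rule localization_axioms.intro)
  show "(\<lambda>(i, j). R.proj (QX i j)) ` E \<subseteq> carrier R.Q" using E by auto
qed (rule loc)

lemma Q_assoc_algebra: "assoc_algebra K Q"
  by (rule L.loc_assoc_algebra)

lemma comp_hom: "algebra_hom K A Q (\<lambda>a. \<phi> (R.proj a))"
  by (intro algebra_homI A.assoc_algebra_axioms Q_assoc_algebra
      alg_hom_comp[OF R.proj_alg_hom L.\<phi>.alg_hom])

sublocale comp: algebra_hom K A Q "\<lambda>a. \<phi> (R.proj a)"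
  by (rule comp_hom)

lemma x_closed [simp]: "\<lbrakk>i \<in> {1..n}; j \<in> {1..n}\<rbrakk> \<Longrightarrow> x i j \<in> carrier Q"
  unfolding x_def by (rule comp.closed[OF X_closed])

lemma x_rel: "qmat_rel K q n Q x"
  using qmat_rel_hom[OF comp_hom q X_closed qmat_X_rel] by (simp add: x_def[abs_def])

lemma x_zero: "(i, j) \<in> D \<Longrightarrow> x i j = \<zero>\<^bsub>Q\<^esub>"
proof -
  assume d: "(i, j) \<in> D"
  then have "QX i j \<in> I" unfolding I_def using A.A.genideal_self[OF killed_closed] by blast
  moreover have "QX i j \<in> carrier A" using d D by auto
  ultimately have "R.proj (QX i j) = \<zero>\<^bsub>R.Q\<^esub>" by (simp add: R.proj_eq_zero_iff)
  then show ?thesis by (simp add: x_def)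
qed

lemma x_unit: "(i, j) \<in> E \<Longrightarrow> x i j \<in> Units Q"
  unfolding x_def
  by (rule L.den_unit, rule subsetD[OF generated_submonoid_incl], rule image_eqI[of _ _ "(i, j)"])
    simp_all

lemma Q_generated:
  assumes U: "subalg K Q U" and x: "\<And>i j. \<lbrakk>i \<in> {1..n}; j \<in> {1..n}\<rbrakk> \<Longrightarrow> x i j \<in> U"
    and i: "\<And>i j. (i, j) \<in> E \<Longrightarrow> inv\<^bsub>Q\<^esub> (x i j) \<in> U"
  shows "U = carrier Q"
proof (rule L.loc_generated[OF U])
  have "{a \<in> carrier A. \<phi> (R.proj a) \<in> U} = carrier A"
    by (rule qmat_generated[OF comp.preimage_subalg[OF U]]) (use x in \<open>simp add: x_def\<close>)
  then show "\<phi> a \<in> U" if "a \<in> carrier R.Q" for a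
    using that unfolding R.quot_simps(1) by blast
  show "inv\<^bsub>Q\<^esub> (\<phi> s) \<in> U" if "s \<in> (\<lambda>(i, j). R.proj (QX i j)) ` E" for s
    using that i by (auto simp: x_def)
qed

text \<open>Composes the universal properties of the presentation, the quotient and the
  localization: a family lifts if it satisfies the quantum relations, vanishes on \<open>D\<close>
  and is invertible on \<open>E\<close>.\<close>

lemma Q_lift:
  assumes B: "assoc_algebra K B"
    and b: "\<And>i j. \<lbrakk>i \<in> {1..n}; j \<in> {1..n}\<rbrakk> \<Longrightarrow> b i j \<in> carrier B"
    and rel: "qmat_rel K q n B b"
    and z: "\<And>i j. (i, j) \<in> D \<Longrightarrow> b i j = \<zero>\<^bsub>B\<^esub>"
    and u: "\<And>i j. (i, j) \<in> E \<Longrightarrow> b i j \<in> Units B"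
  shows "\<exists>f\<in>alg_hom K Q B. \<forall>i\<in>{1..n}. \<forall>j\<in>{1..n}. f (x i j) = b i j"
proof -
  obtain f where f: "f \<in> alg_hom K A B"
      "\<And>i j. \<lbrakk>i \<in> {1..n}; j \<in> {1..n}\<rbrakk> \<Longrightarrow> f (QX i j) = b i j"
    using qmat_lift[OF B b rel] by blast
  have "f a = \<zero>\<^bsub>B\<^esub>" if "a \<in> I" for a
    by (rule genideal_hom_zero[OF algebra_homI[OF A.assoc_algebra_axioms B f(1)] killed_closed])
      (use that D f(2) z in \<open>auto simp: I_def\<close>)
  from R.quot_lift[OF B f(1) this] obtain g where g: "g \<in> alg_hom K R.Q B"
      "\<And>a. a \<in> carrier A \<Longrightarrow> g (R.proj a) = f a" by blast
  have gX: "g (R.proj (QX i j)) = b i j" if "i \<in> {1..n}" "j \<in> {1..n}" for i j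
    using that by (simp add: g(2) f(2))
  have "g s \<in> Units B" if "s \<in> (\<lambda>(i, j). R.proj (QX i j)) ` E" for s
    using that E u gX by auto
  from L.loc_lift[OF B g(1) this] obtain h where h: "h \<in> alg_hom K Q B"
      "\<And>a. a \<in> carrier R.Q \<Longrightarrow> h (\<phi> a) = g a" by blast
  have "h (x i j) = b i j" if "i \<in> {1..n}" "j \<in> {1..n}" for i j
    unfolding x_def using that by (simp only: h(2) p.closed X_closed gX)
  with h(1) show ?thesis by blast
qed

text \<open>The values at the inverted generators need no separate hypothesis, as homomorphisms
  preserve inverses.\<close>

lemma Q_hom_eq:
  assumes B: "assoc_algebra K B" and f: "f \<in> alg_hom K Q B" and g: "g \<in> alg_hom K Q B"
    and eq: "\<And>i j. \<lbrakk>i \<in> {1..n}; j \<in> {1..n}\<rbrakk> \<Longrightarrow> f (x i j) = g (x i j)"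
    and a: "a \<in> carrier Q"
  shows "f a = g a"
proof -
  interpret f: algebra_hom K Q B f by (intro algebra_homI B f Q_assoc_algebra)
  interpret g: algebra_hom K Q B g by (intro algebra_homI B g Q_assoc_algebra)
  have "{a \<in> carrier Q. f a = g a} = carrier Q"
  proof (rule Q_generated[OF equalizer_subalg[OF Q_assoc_algebra B f g]])
    show "x i j \<in> {a \<in> carrier Q. f a = g a}" if "i \<in> {1..n}" "j \<in> {1..n}" for i j
      using that eq by simp
    show "inv\<^bsub>Q\<^esub> (x i j) \<in> {a \<in> carrier Q. f a = g a}" if "(i, j) \<in> E" for i j
    proof -
      have "f (x i j) = g (x i j)" using that E by (intro eq) auto
      with x_unit[OF that] show ?thesis by (simp add: f.unit_inv g.unit_inv)
    qed
  qed
  with a show ?thesis by blast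
qed

text \<open>Uniqueness in the definite description: on the carrier by \<open>Q_hom_eq\<close>,
  outside it by extensionality.\<close>

lemma torus_act_eq:
  assumes f: "f \<in> alg_auto K Q"
    and fx: "\<And>i j. \<lbrakk>i \<in> {1..n}; j \<in> {1..n}\<rbrakk> \<Longrightarrow> f (x i j) = (fst h i \<otimes>\<^bsub>K\<^esub> snd h j) \<odot>\<^bsub>Q\<^esub> x i j"
  shows "torus_act K n Q x h = f"
  unfolding torus_act_def
proof (rule the_equality)
  show "f \<in> alg_auto K Q \<and> (\<forall>i\<in>{1..n}. \<forall>j\<in>{1..n}. f (x i j) = (fst h i \<otimes>\<^bsub>K\<^esub> snd h j) \<odot>\<^bsub>Q\<^esub> x i j)"
    using f fx by blast
next
  fix g assume g: "g \<in> alg_auto K Q \<and>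
    (\<forall>i\<in>{1..n}. \<forall>j\<in>{1..n}. g (x i j) = (fst h i \<otimes>\<^bsub>K\<^esub> snd h j) \<odot>\<^bsub>Q\<^esub> x i j)"
  show "g = f"
  proof (rule extensionalityI)
    show "g \<in> extensional (carrier Q)" "f \<in> extensional (carrier Q)"
      using f g by (auto simp: alg_auto_def)
    show "g a = f a" if "a \<in> carrier Q" for a
      by (rule Q_hom_eq[OF Q_assoc_algebra _ _ _ that])
        (use f g fx in \<open>simp_all add: alg_auto_def\<close>)
  qed
qed

text \<open>By the condition on \<open>w\<close>, both monomials x i j x l m and x i m x l j have
  the same weight, so all terms of each quantum relation are homogeneous of one degree. A relation
  valid in \<open>T\<close> then holds for the \<open>single\<close> functions, zeros stay zero and
  units stay units.\<close>

lemma graded_hom: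
  assumes T: "assoc_algebra K T" and f: "f \<in> alg_hom K Q T"
    and w: "\<And>i j l m k. w i j k + w l m k = w i m k + w l j k"
  shows "\<exists>\<alpha>\<in>alg_hom K Q (coeff_algebra T deg_group).
    \<forall>i\<in>{1..n}. \<forall>j\<in>{1..n}. \<alpha> (x i j) = single T (w i j) (f (x i j))"
proof -
  interpret T: assoc_algebra K T by fact
  interpret f: algebra_hom K Q T f by (intro algebra_homI T f Q_assoc_algebra)
  note r = qmat_relD[OF x_rel]
  have swap: "(\<lambda>k. w i j k + w l m k) = (\<lambda>k. w l m k + w i j k)"
    "(\<lambda>k. w i j k + w l m k) = (\<lambda>k. w i m k + w l j k)" for i j l m
    using w by (auto simp: add.commute)
  show ?thesis
  proof (rule Q_lift[OF T.AG_assoc_algebra])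
    show "qmat_rel K q n T.AG (\<lambda>i j. single T (w i j) (f (x i j)))"
      unfolding qmat_rel_def
    proof (intro conjI ballI impI)
      fix i j l assume *: "i \<in> {1..n}" "j \<in> {1..n}" "l \<in> {1..n}" "i < l"
      then have "f (x i j) \<otimes>\<^bsub>T\<^esub> f (x l j) = q \<odot>\<^bsub>T\<^esub> (f (x l j) \<otimes>\<^bsub>T\<^esub> f (x i j))"
        by (simp add: r(1) flip: f.mult f.smult)
      with * show "single T (w i j) (f (x i j)) \<otimes>\<^bsub>T.AG\<^esub> single T (w l j) (f (x l j)) =
        q \<odot>\<^bsub>T.AG\<^esub> (single T (w l j) (f (x l j)) \<otimes>\<^bsub>T.AG\<^esub> single T (w i j) (f (x i j)))"
        by (simp add: T.single_AG_mult T.single_AG_smult swap(1)[of l j i j])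
    next
      fix i j m assume *: "i \<in> {1..n}" "j \<in> {1..n}" "m \<in> {1..n}" "j < m"
      then have "f (x i j) \<otimes>\<^bsub>T\<^esub> f (x i m) = q \<odot>\<^bsub>T\<^esub> (f (x i m) \<otimes>\<^bsub>T\<^esub> f (x i j))"
        by (simp add: r(2) flip: f.mult f.smult)
      with * show "single T (w i j) (f (x i j)) \<otimes>\<^bsub>T.AG\<^esub> single T (w i m) (f (x i m)) =
        q \<odot>\<^bsub>T.AG\<^esub> (single T (w i m) (f (x i m)) \<otimes>\<^bsub>T.AG\<^esub> single T (w i j) (f (x i j)))"
        by (simp add: T.single_AG_mult T.single_AG_smult swap(1)[of i m i j])
    next
      fix i j l m assume *: "i \<in> {1..n}" "j \<in> {1..n}" "l \<in> {1..n}" "m \<in> {1..n}" "i < l \<and> m < j"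
      then have "x i j \<otimes>\<^bsub>Q\<^esub> x l m = x l m \<otimes>\<^bsub>Q\<^esub> x i j" by (intro r(3)) simp_all
      then have "f (x i j \<otimes>\<^bsub>Q\<^esub> x l m) = f (x l m \<otimes>\<^bsub>Q\<^esub> x i j)" by simp
      with * have "f (x i j) \<otimes>\<^bsub>T\<^esub> f (x l m) = f (x l m) \<otimes>\<^bsub>T\<^esub> f (x i j)"
        by (simp add: f.mult)
      with * show "single T (w i j) (f (x i j)) \<otimes>\<^bsub>T.AG\<^esub> single T (w l m) (f (x l m)) =
        single T (w l m) (f (x l m)) \<otimes>\<^bsub>T.AG\<^esub> single T (w i j) (f (x i j))"
        by (simp add: T.single_AG_mult swap(1)[of i j l m])
    next
      fix i j l m assume *: "i \<in> {1..n}" "j \<in> {1..n}" "l \<in> {1..n}" "m \<in> {1..n}" "i < l \<and> j < m"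
      then have "f (x i j) \<otimes>\<^bsub>T\<^esub> f (x l m) \<ominus>\<^bsub>T\<^esub> f (x l m) \<otimes>\<^bsub>T\<^esub> f (x i j) =
          (q \<ominus>\<^bsub>K\<^esub> inv\<^bsub>K\<^esub> q) \<odot>\<^bsub>T\<^esub> (f (x i m) \<otimes>\<^bsub>T\<^esub> f (x l j))"
        by (simp add: r(4) flip: f.mult f.smult f.minus)
      with * show "single T (w i j) (f (x i j)) \<otimes>\<^bsub>T.AG\<^esub> single T (w l m) (f (x l m)) \<ominus>\<^bsub>T.AG\<^esub>
          single T (w l m) (f (x l m)) \<otimes>\<^bsub>T.AG\<^esub> single T (w i j) (f (x i j)) =
        (q \<ominus>\<^bsub>K\<^esub> inv\<^bsub>K\<^esub> q) \<odot>\<^bsub>T.AG\<^esub>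
          (single T (w i m) (f (x i m)) \<otimes>\<^bsub>T.AG\<^esub> single T (w l j) (f (x l j)))"
        by (simp add: T.single_AG_mult T.single_AG_smult T.single_AG_minus
            swap(1)[of l m i j] swap(2)[of i j l m])
    qed
  next
    fix i j assume "(i, j) \<in> D"
    then show "single T (w i j) (f (x i j)) = \<zero>\<^bsub>T.AG\<^esub>"
      by (simp add: x_zero T.single_AG_zero)
  next
    fix i j assume "(i, j) \<in> E"
    then show "single T (w i j) (f (x i j)) \<in> Units T.AG"
      by (intro T.single_AG_inverse f.unit_inv x_unit)
  qed simp
qed

end

section \<open>Conjugation by units\<close>

text \<open>Restricted to the carrier, since elements of \<open>alg_auto\<close> are extensional and
  the torus action is to equal a conjugation as a function.\<close>

definition conj_by :: "('a, 'm) ring_scheme \<Rightarrow> 'a \<Rightarrow> 'a \<Rightarrow> 'a"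
  where "conj_by A u = (\<lambda>x\<in>carrier A. (u \<otimes>\<^bsub>A\<^esub> x) \<otimes>\<^bsub>A\<^esub> inv\<^bsub>A\<^esub> u)"

context assoc_algebra
begin

lemma conj_by_closed [simp]: "\<lbrakk>u \<in> Units A; x \<in> carrier A\<rbrakk> \<Longrightarrow> conj_by A u x \<in> carrier A"
  by (simp add: conj_by_def A.Units_closed)

lemma conj_by_mult_unit:
  assumes "u \<in> Units A" "x \<in> carrier A"
  shows "conj_by A u x \<otimes>\<^bsub>A\<^esub> u = u \<otimes>\<^bsub>A\<^esub> x"
  using assms by (simp add: conj_by_def A.m_assoc A.Units_closed)

lemma conj_by_eqI:
  assumes "u \<in> Units A" "x \<in> carrier A" "y \<in> carrier A" "u \<otimes>\<^bsub>A\<^esub> x = y \<otimes>\<^bsub>A\<^esub> u"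
  shows "conj_by A u x = y"
  using assms by (simp add: conj_by_def A.m_assoc A.Units_closed)

lemma conj_by_one: "x \<in> carrier A \<Longrightarrow> conj_by A \<one>\<^bsub>A\<^esub> x = x"
  by (rule conj_by_eqI) simp_all

lemma conj_by_comp:
  assumes u: "u \<in> Units A" and v: "v \<in> Units A" and x: "x \<in> carrier A"
  shows "conj_by A (u \<otimes>\<^bsub>A\<^esub> v) x = conj_by A u (conj_by A v x)"
proof (rule conj_by_eqI)
  note [simp] = A.Units_closed[OF u] A.Units_closed[OF v]
  have "conj_by A u (conj_by A v x) \<otimes>\<^bsub>A\<^esub> (u \<otimes>\<^bsub>A\<^esub> v) = (conj_by A u (conj_by A v x) \<otimes>\<^bsub>A\<^esub> u) \<otimes>\<^bsub>A\<^esub> v"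
    using u v x by (simp add: A.m_assoc)
  also have "\<dots> = u \<otimes>\<^bsub>A\<^esub> (conj_by A v x \<otimes>\<^bsub>A\<^esub> v)"
    using u v x by (simp add: conj_by_mult_unit A.m_assoc)
  also have "\<dots> = u \<otimes>\<^bsub>A\<^esub> v \<otimes>\<^bsub>A\<^esub> x"
    using u v x by (simp add: conj_by_mult_unit A.m_assoc)
  finally show "u \<otimes>\<^bsub>A\<^esub> v \<otimes>\<^bsub>A\<^esub> x = conj_by A u (conj_by A v x) \<otimes>\<^bsub>A\<^esub> (u \<otimes>\<^bsub>A\<^esub> v)" by simp
qed (use u v x in simp_all)

lemma conj_by_inv:
  assumes "u \<in> Units A" "x \<in> carrier A"
  shows "conj_by A u (conj_by A (inv\<^bsub>A\<^esub> u) x) = x" "conj_by A (inv\<^bsub>A\<^esub> u) (conj_by A u x) = x"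
  using conj_by_comp[of u "inv\<^bsub>A\<^esub> u" x] conj_by_comp[of "inv\<^bsub>A\<^esub> u" u x] assms
  by (simp_all add: conj_by_one)

lemma conj_by_mult:
  assumes u: "u \<in> Units A" and x: "x \<in> carrier A" and y: "y \<in> carrier A"
  shows "conj_by A u (x \<otimes>\<^bsub>A\<^esub> y) = conj_by A u x \<otimes>\<^bsub>A\<^esub> conj_by A u y"
proof (rule conj_by_eqI)
  note [simp] = A.Units_closed[OF u]
  have "conj_by A u x \<otimes>\<^bsub>A\<^esub> conj_by A u y \<otimes>\<^bsub>A\<^esub> u = conj_by A u x \<otimes>\<^bsub>A\<^esub> (u \<otimes>\<^bsub>A\<^esub> y)"
    using u x y by (simp add: A.m_assoc conj_by_mult_unit)
  also have "\<dots> = (conj_by A u x \<otimes>\<^bsub>A\<^esub> u) \<otimes>\<^bsub>A\<^esub> y"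
    using u x y by (simp add: A.m_assoc)
  finally show "u \<otimes>\<^bsub>A\<^esub> (x \<otimes>\<^bsub>A\<^esub> y) = conj_by A u x \<otimes>\<^bsub>A\<^esub> conj_by A u y \<otimes>\<^bsub>A\<^esub> u"
    using u x y by (simp add: A.m_assoc conj_by_mult_unit)
qed (use u x y in simp_all)

lemma conj_by_alg_hom:
  assumes u: "u \<in> Units A"
  shows "conj_by A u \<in> alg_hom K A A"
proof (rule alg_homI)
  note [simp] = A.Units_closed[OF u]
  show "conj_by A u (x \<oplus>\<^bsub>A\<^esub> y) = conj_by A u x \<oplus>\<^bsub>A\<^esub> conj_by A u y"
    if "x \<in> carrier A" "y \<in> carrier A" for x y
    using u that by (simp add: conj_by_def A.l_distr A.r_distr)
  show "conj_by A u \<one>\<^bsub>A\<^esub> = \<one>\<^bsub>A\<^esub>"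
    using u by (simp add: conj_by_def)
  show "conj_by A u (k \<odot>\<^bsub>A\<^esub> x) = k \<odot>\<^bsub>A\<^esub> conj_by A u x" if "k \<in> carrier K" "x \<in> carrier A" for k x
    using u that by (simp add: conj_by_def smult_mult_left smult_mult_right)
qed (use u conj_by_mult in simp_all)

lemma conj_by_alg_auto:
  assumes u: "u \<in> Units A"
  shows "conj_by A u \<in> alg_auto K A"
proof -
  have "bij_betw (conj_by A u) (carrier A) (carrier A)"
    by (rule bij_betwI[where g = "conj_by A (inv\<^bsub>A\<^esub> u)"]) (use u conj_by_inv in simp_all)
  moreover have "conj_by A u \<in> extensional (carrier A)"
    by (simp add: conj_by_def)
  ultimately show ?thesis using conj_by_alg_hom[OF u] by (simp add: alg_auto_def)
qed

text \<open>An eigenvector of conjugation by u with unit eigenvalue k is one for the inverse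
  conjugation with eigenvalue k^{-1}; one commutation relation thus controls both
  directions.\<close>

lemma conj_by_eigenvector:
  assumes u: "u \<in> Units A" and x: "x \<in> carrier A" and k: "k \<in> Units K"
    and e: "u \<otimes>\<^bsub>A\<^esub> x = k \<odot>\<^bsub>A\<^esub> (x \<otimes>\<^bsub>A\<^esub> u)"
  shows "conj_by A u x = k \<odot>\<^bsub>A\<^esub> x" "conj_by A (inv\<^bsub>A\<^esub> u) x = inv\<^bsub>K\<^esub> k \<odot>\<^bsub>A\<^esub> x"
proof -
  have kc: "k \<in> carrier K" "inv\<^bsub>K\<^esub> k \<in> carrier K" using k by auto
  show 1: "conj_by A u x = k \<odot>\<^bsub>A\<^esub> x"
    by (rule conj_by_eqI) (use u x kc e in \<open>simp_all add: smult_mult_left A.Units_closed\<close>)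
  interpret c: algebra_hom K A A "conj_by A (inv\<^bsub>A\<^esub> u)"
    by (intro algebra_homI assoc_algebra_axioms conj_by_alg_hom) (use u in simp)
  have "inv\<^bsub>K\<^esub> k \<odot>\<^bsub>A\<^esub> x = inv\<^bsub>K\<^esub> k \<odot>\<^bsub>A\<^esub> conj_by A (inv\<^bsub>A\<^esub> u) (k \<odot>\<^bsub>A\<^esub> x)"
    using conj_by_inv(2)[OF u x] by (simp add: 1)
  also have "\<dots> = conj_by A (inv\<^bsub>A\<^esub> u) x"
    using kc x u k by (simp add: c.smult flip: smult_assoc1)
  finally show "conj_by A (inv\<^bsub>A\<^esub> u) x = inv\<^bsub>K\<^esub> k \<odot>\<^bsub>A\<^esub> x" by simp
qed

text \<open>Conjugation is an algebra homomorphism, so the preimage of the generated subalgebra is a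
  subalgebra, and it contains the generators.\<close>

lemma conj_by_generated:
  assumes u: "u \<in> Units A" and G: "G \<subseteq> carrier A"
    and g: "\<And>g. g \<in> G \<Longrightarrow> conj_by A u g \<in> generated_subalgebra K A G"
    and b: "b \<in> generated_subalgebra K A G"
  shows "conj_by A u b \<in> generated_subalgebra K A G"
proof -
  interpret c: algebra_hom K A A "conj_by A u"
    by (intro algebra_homI assoc_algebra_axioms conj_by_alg_hom u)
  have "generated_subalgebra K A G \<subseteq> {x \<in> carrier A. conj_by A u x \<in> generated_subalgebra K A G}"
    by (rule generated_subalgebra_minimal[OF c.preimage_subalg[OF generated_subalgebra_subalg[OF G]]])
      (use G g in auto)
  with b show ?thesis by blast
qed

end

section \<open>Laurent monomials\<close>

context monoid
begin

text \<open>Integer powers of a unit are computed in the group of units, where the usual power laws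
  hold.\<close>

lemma Units_int_pow: "u \<in> Units G \<Longrightarrow> u [^] (z::int) = u [^]\<^bsub>units_of G\<^esub> z"
  using group.is_monoid[OF units_group]
  by (simp add: int_pow_def2 units_of_pow units_of_inv units_of_carrier Units_pow_closed del: pow_nat)

lemma Units_int_pow_closed: "u \<in> Units G \<Longrightarrow> u [^] (z::int) \<in> Units G"
  using group.int_pow_closed[OF units_group] by (simp add: Units_int_pow units_of_carrier)

lemma Units_int_pow_add: "u \<in> Units G \<Longrightarrow> u [^] (y + z::int) = u [^] y \<otimes> u [^] z"
  using group.int_pow_mult[OF units_group, of u y z]
  by (simp add: Units_int_pow units_of_carrier units_of_mult)

lemma Units_int_pow_1: "u \<in> Units G \<Longrightarrow> u [^] (1::int) = u"
  using group.int_pow_1[OF units_group] by (simp add: Units_int_pow units_of_carrier)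

lemma Units_int_pow_mem:
  assumes H: "H \<subseteq> Units G" "\<one> \<in> H" "\<And>u v. \<lbrakk>u \<in> H; v \<in> H\<rbrakk> \<Longrightarrow> u \<otimes> v \<in> H"
    "\<And>u. u \<in> H \<Longrightarrow> inv u \<in> H" and u: "u \<in> H"
  shows "u [^] (z::int) \<in> H"
proof -
  have "u [^] (n::nat) \<in> H" for n by (induct n) (use assms in simp_all)
  then show ?thesis using H(4) by (simp add: int_pow_def2 del: pow_nat)
qed

lemma laurent_monomial_0: "laurent_monomial G 0 x m = \<one>"
  by (simp add: laurent_monomial_def)

text \<open>The definition exposes the first factor of the monomial; induction on the number of
  variables needs the last one.\<close>

lemma laurent_monomial_Suc:
  assumes "\<And>i. i \<in> {1..Suc k} \<Longrightarrow> x i \<in> Units G"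
  shows "laurent_monomial G (Suc k) x m = laurent_monomial G k x m \<otimes> x (Suc k) [^] m (Suc k)"
proof -
  let ?f = "\<lambda>i y. (x i [^] m i) \<otimes> y"
  have c: "x i [^] m i \<in> carrier G" if "i \<in> {1..Suc k}" for i
    using Units_int_pow_closed[OF assms[OF that]] by (rule Units_closed)
  have cl: "set is \<subseteq> {1..Suc k} \<Longrightarrow> foldr ?f is \<one> \<in> carrier G" for "is"
    by (induct "is") (use c in auto)
  have fold: "set is \<subseteq> {1..Suc k} \<Longrightarrow> y \<in> carrier G \<Longrightarrow> foldr ?f is y = foldr ?f is \<one> \<otimes> y" for "is" y
  proof (induct "is")
    case (Cons i "is")
    then show ?case using c[of i] cl[of "is"] by (simp add: m_assoc)
  qed simp
  let ?y = "x (Suc k) [^] m (Suc k)"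
  have y: "?y \<in> carrier G" using c[of "Suc k"] by simp
  have "[1..<Suc (Suc k)] = [1..<Suc k] @ [Suc k]" by simp
  then have "laurent_monomial G (Suc k) x m = foldr ?f [1..<Suc k] ?y"
    unfolding laurent_monomial_def using y by (simp only: foldr_append foldr.simps o_apply id_apply r_one)
  also have "\<dots> = foldr ?f [1..<Suc k] \<one> \<otimes> ?y"
    by (rule fold[OF _ y]) auto
  finally show ?thesis by (simp only: laurent_monomial_def)
qed

end

section \<open>Laurent monomials in commuting units of an algebra\<close>

locale commuting_units = assoc_algebra K T
  for K :: "('k, 'm) ring_scheme" and T :: "('k, 'a, 'u) module_scheme" +
  fixes t :: nat and x :: "nat \<Rightarrow> 'a"
  assumes x_unit: "i \<in> {1..t} \<Longrightarrow> x i \<in> Units T"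
    and x_comm: "\<lbrakk>i \<in> {1..t}; j \<in> {1..t}\<rbrakk> \<Longrightarrow> x i \<otimes>\<^bsub>T\<^esub> x j = x j \<otimes>\<^bsub>T\<^esub> x i"
begin

lemma x_closed: "i \<in> {1..t} \<Longrightarrow> x i \<in> carrier T"
  using x_unit by blast

abbreviation "lmon k m \<equiv> laurent_monomial T k x m"

lemma mon_Suc: "Suc k \<le> t \<Longrightarrow> lmon (Suc k) m = lmon k m \<otimes>\<^bsub>T\<^esub> x (Suc k) [^]\<^bsub>T\<^esub> m (Suc k)"
  by (rule A.laurent_monomial_Suc) (use x_unit in simp)

text \<open>Induction principle for monomials, applied to units in a centralizer and to units whose
  conjugation preserves \<open>B\<close>.\<close>

lemma mon_mem:
  assumes H: "H \<subseteq> Units T" "\<one>\<^bsub>T\<^esub> \<in> H" "\<And>u v. \<lbrakk>u \<in> H; v \<in> H\<rbrakk> \<Longrightarrow> u \<otimes>\<^bsub>T\<^esub> v \<in> H"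
    "\<And>u. u \<in> H \<Longrightarrow> inv\<^bsub>T\<^esub> u \<in> H" and x: "\<And>i. i \<in> {1..t} \<Longrightarrow> x i \<in> H"
  shows "k \<le> t \<Longrightarrow> lmon k m \<in> H"
proof (induct k)
  case 0
  then show ?case using H by (simp add: A.laurent_monomial_0)
next
  case (Suc k)
  then show ?case using H A.Units_int_pow_mem[OF H x[of "Suc k"]] by (simp add: mon_Suc)
qed

lemma mon_unit: "k \<le> t \<Longrightarrow> lmon k m \<in> Units T"
  by (rule mon_mem) (use x_unit in auto)

lemma mon_closed [simp]: "k \<le> t \<Longrightarrow> lmon k m \<in> carrier T"
  using mon_unit by blast

text \<open>The units commuting with \<open>w\<close> are closed under products and inverses, so
  \<open>mon_mem\<close> applies.\<close>

lemma mon_commute_unit: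
  assumes w: "w \<in> carrier T" and c: "\<And>i. i \<in> {1..t} \<Longrightarrow> x i \<otimes>\<^bsub>T\<^esub> w = w \<otimes>\<^bsub>T\<^esub> x i" and k: "k \<le> t"
  shows "lmon k m \<otimes>\<^bsub>T\<^esub> w = w \<otimes>\<^bsub>T\<^esub> lmon k m"
proof -
  let ?Z = "{v \<in> carrier T. \<forall>y\<in>{w}. v \<otimes>\<^bsub>T\<^esub> y = y \<otimes>\<^bsub>T\<^esub> v}"
  have Z: "subalg K T ?Z" by (rule centralizer_subalg) (use w in simp)
  have "lmon k m \<in> Units T \<inter> ?Z"
  proof (rule mon_mem)
    fix u v assume "u \<in> Units T \<inter> ?Z" "v \<in> Units T \<inter> ?Z"
    then show "u \<otimes>\<^bsub>T\<^esub> v \<in> Units T \<inter> ?Z" using subalgD(4)[OF Z, of u v] by simp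
  next
    fix u assume "u \<in> Units T \<inter> ?Z"
    then show "inv\<^bsub>T\<^esub> u \<in> Units T \<inter> ?Z" using centralizer_inv[of u w] w by simp
  qed (use x_unit x_closed c k subalgD(3)[OF Z] in simp_all)
  then show ?thesis by simp
qed

lemma int_pow_commute_mon:
  assumes j: "j \<in> {1..t}" and k: "k \<le> t"
  shows "lmon k m \<otimes>\<^bsub>T\<^esub> x j [^]\<^bsub>T\<^esub> (z::int) = x j [^]\<^bsub>T\<^esub> z \<otimes>\<^bsub>T\<^esub> lmon k m"
proof (rule mon_commute_unit[OF _ _ k])
  show "x j [^]\<^bsub>T\<^esub> z \<in> carrier T"
    using A.Units_int_pow_closed[OF x_unit[OF j]] by blast
  fix i assume i: "i \<in> {1..t}"
  let ?Z = "{v \<in> carrier T. \<forall>y\<in>{x i}. v \<otimes>\<^bsub>T\<^esub> y = y \<otimes>\<^bsub>T\<^esub> v}"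
  have Z: "subalg K T ?Z" by (rule centralizer_subalg) (use x_closed i in simp)
  have "x j [^]\<^bsub>T\<^esub> z \<in> Units T \<inter> ?Z"
  proof (rule A.Units_int_pow_mem)
    fix u v assume "u \<in> Units T \<inter> ?Z" "v \<in> Units T \<inter> ?Z"
    then show "u \<otimes>\<^bsub>T\<^esub> v \<in> Units T \<inter> ?Z" using subalgD(4)[OF Z, of u v] by simp
  next
    fix u assume "u \<in> Units T \<inter> ?Z"
    then show "inv\<^bsub>T\<^esub> u \<in> Units T \<inter> ?Z" using centralizer_inv[of u "x i"] x_closed[OF i] by simp
  qed (use x_unit[OF j] x_closed[OF j] x_comm[OF j i] subalgD(3)[OF Z] in simp_all)
  then show "x i \<otimes>\<^bsub>T\<^esub> x j [^]\<^bsub>T\<^esub> z = x j [^]\<^bsub>T\<^esub> z \<otimes>\<^bsub>T\<^esub> x i" by simp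
qed

text \<open>The last power in the first monomial has to move past the remaining factors of the
  second one, which is \<open>int_pow_commute_mon\<close>.\<close>

lemma mon_add: "k \<le> t \<Longrightarrow> lmon k (\<lambda>i. m i + m' i) = lmon k m \<otimes>\<^bsub>T\<^esub> lmon k m'"
proof (induct k)
  case 0
  then show ?case by (simp add: A.laurent_monomial_0)
next
  case (Suc k)
  let ?a = "x (Suc k) [^]\<^bsub>T\<^esub> m (Suc k)" and ?b = "x (Suc k) [^]\<^bsub>T\<^esub> m' (Suc k)"
  have u: "x (Suc k) \<in> Units T" using x_unit Suc by simp
  have c: "?a \<in> carrier T" "?b \<in> carrier T" using A.Units_int_pow_closed[OF u] by blast+
  have "lmon (Suc k) (\<lambda>i. m i + m' i) = lmon k m \<otimes>\<^bsub>T\<^esub> (lmon k m' \<otimes>\<^bsub>T\<^esub> ?a) \<otimes>\<^bsub>T\<^esub> ?b"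
    using Suc c u by (simp add: mon_Suc A.Units_int_pow_add A.m_assoc)
  also have "\<dots> = lmon k m \<otimes>\<^bsub>T\<^esub> (?a \<otimes>\<^bsub>T\<^esub> lmon k m') \<otimes>\<^bsub>T\<^esub> ?b"
    using int_pow_commute_mon[of "Suc k" k m'] Suc(2) by simp
  also have "\<dots> = lmon (Suc k) m \<otimes>\<^bsub>T\<^esub> lmon (Suc k) m'"
    using Suc(2) c by (simp add: mon_Suc A.m_assoc)
  finally show ?case .
qed

lemma mon_zero: "k \<le> t \<Longrightarrow> lmon k (\<lambda>i. 0) = \<one>\<^bsub>T\<^esub>"
  by (induct k) (simp_all add: A.laurent_monomial_0 mon_Suc)

text \<open>Exponents outside the index range are invisible, which later permits replacing an
  exponent function by its restriction to \<open>{1..t}\<close>.\<close>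

lemma mon_cong: "\<lbrakk>k \<le> t; \<And>i. i \<in> {1..k} \<Longrightarrow> m i = m' i\<rbrakk> \<Longrightarrow> lmon k m = lmon k m'"
  by (induct k) (simp_all add: A.laurent_monomial_0 mon_Suc)

lemma mon_unit_vector:
  assumes "j \<in> {1..t}"
  shows "lmon t (\<lambda>i. if i = j then 1 else 0) = x j"
proof -
  have "k \<le> t \<Longrightarrow> lmon k (\<lambda>i. if i = j then 1 else 0) = (if j \<le> k then x j else \<one>\<^bsub>T\<^esub>)" for k
  proof (induct k)
    case 0
    then show ?case using assms by (simp add: A.laurent_monomial_0)
  next
    case (Suc k)
    consider "j \<le> k" | "j = Suc k" | "Suc k < j" by linarith
    then show ?case using Suc x_unit[OF assms] x_closed[OF assms]
      by cases (simp_all add: mon_Suc A.Units_int_pow_1)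
  qed
  with assms show ?thesis by simp
qed

lemma mon_minus_unit_vector:
  assumes j: "j \<in> {1..t}"
  shows "lmon t (\<lambda>i. if i = j then - 1 else 0) = inv\<^bsub>T\<^esub> (x j)"
proof (rule A.inv_unique'[OF x_closed[OF j]])
  let ?e = "\<lambda>i. if i = j then 1 else (0::int)" and ?f = "\<lambda>i. if i = j then - 1 else (0::int)"
  have "(\<lambda>i. ?e i + ?f i) = (\<lambda>i. 0)" "(\<lambda>i. ?f i + ?e i) = (\<lambda>i. 0)" by auto
  then have "lmon t ?e \<otimes>\<^bsub>T\<^esub> lmon t ?f = \<one>\<^bsub>T\<^esub>" "lmon t ?f \<otimes>\<^bsub>T\<^esub> lmon t ?e = \<one>\<^bsub>T\<^esub>"
    by (simp_all add: mon_zero flip: mon_add)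
  then show "x j \<otimes>\<^bsub>T\<^esub> lmon t ?f = \<one>\<^bsub>T\<^esub>" "lmon t ?f \<otimes>\<^bsub>T\<^esub> x j = \<one>\<^bsub>T\<^esub>"
    by (simp_all add: mon_unit_vector[OF j])
qed simp

end

text \<open>A criterion for skew-Laurent extensions. Stability of \<open>B\<close> under both
  conjugations makes them bijective on \<open>B\<close> and lets monomials move past coefficients;
  \<open>generated\<close> yields spanning and \<open>\<Delta>\<close> yields independence.\<close>

locale graded_laurent = commuting_units K T t x
  for K :: "('k, 'm) ring_scheme" and T :: "('k, 'a, 'u) module_scheme" and t :: nat
    and x :: "nat \<Rightarrow> 'a" +
  fixes B :: "'a set" and \<Delta> :: "'a \<Rightarrow> (nat \<Rightarrow> int) \<Rightarrow> 'a"
  assumes B: "subalg K T B"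
    and conj_B: "\<lbrakk>i \<in> {1..t}; b \<in> B\<rbrakk> \<Longrightarrow> conj_by T (x i) b \<in> B"
    and conj_inv_B: "\<lbrakk>i \<in> {1..t}; b \<in> B\<rbrakk> \<Longrightarrow> conj_by T (inv\<^bsub>T\<^esub> (x i)) b \<in> B"
    and generated: "\<lbrakk>subalg K T U; B \<subseteq> U; \<And>i. i \<in> {1..t} \<Longrightarrow> x i \<in> U \<and> inv\<^bsub>T\<^esub> (x i) \<in> U\<rbrakk> \<Longrightarrow>
      U = carrier T"
    and \<Delta>: "\<Delta> \<in> alg_hom K T (coeff_algebra T deg_group)"
    and \<Delta>_B: "b \<in> B \<Longrightarrow> \<Delta> b = single T (\<lambda>i. 0) b"
    and \<Delta>_x: "j \<in> {1..t} \<Longrightarrow> \<Delta> (x j) = single T (\<lambda>i. if i = j then 1 else 0) (x j)"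
begin

sublocale \<Delta>: algebra_hom K T AG \<Delta>
  by (intro algebra_homI assoc_algebra_axioms AG_assoc_algebra \<Delta>)

lemma B_closed: "b \<in> B \<Longrightarrow> b \<in> carrier T"
  using subalgD(1)[OF B] by blast

lemma conj_mon_B:
  assumes b: "b \<in> B"
  shows "conj_by T (lmon t m) b \<in> B"
proof -
  \<comment> \<open>Stability under the inverse conjugation is built into \<open>?H\<close>, as
    \<open>mon_mem\<close> asks for a set closed under inverses.\<close>
  let ?H = "{u \<in> Units T. \<forall>b\<in>B. conj_by T u b \<in> B \<and> conj_by T (inv\<^bsub>T\<^esub> u) b \<in> B}"
  have "lmon t m \<in> ?H"
  proof (rule mon_mem)
    show "\<one>\<^bsub>T\<^esub> \<in> ?H" by (simp add: conj_by_one B_closed)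
    show "u \<otimes>\<^bsub>T\<^esub> v \<in> ?H" if "u \<in> ?H" "v \<in> ?H" for u v
      using that by (simp add: conj_by_comp B_closed A.Units_inv_mult)
    show "inv\<^bsub>T\<^esub> u \<in> ?H" if "u \<in> ?H" for u
      using that by simp
    show "x i \<in> ?H" if "i \<in> {1..t}" for i
      using that x_unit conj_B conj_inv_B by simp
  qed auto
  with b show ?thesis by blast
qed

section \<open>Degrees of the Laurent monomials\<close>

lemma \<Delta>_inv:
  assumes "u \<in> Units T" "\<Delta> u = single T g u"
  shows "\<Delta> (inv\<^bsub>T\<^esub> u) = single T (\<lambda>i. - g i) (inv\<^bsub>T\<^esub> u)"
  using assms by (simp add: \<Delta>.unit_inv single_AG_inverse)

lemma \<Delta>_int_pow:
  assumes u: "u \<in> Units T" and d: "\<Delta> u = single T g u"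
  shows "\<Delta> (u [^]\<^bsub>T\<^esub> (z::int)) = single T (\<lambda>i. z * g i) (u [^]\<^bsub>T\<^esub> z)"
proof -
  have uc: "u \<in> carrier T" using u by blast
  have n: "\<Delta> (u [^]\<^bsub>T\<^esub> (k::nat)) = single T (\<lambda>i. int k * g i) (u [^]\<^bsub>T\<^esub> k)" for k
  proof (induct k)
    case 0
    then show ?case by (simp add: \<Delta>.one single_AG_one)
  next
    case (Suc k)
    then show ?case using uc by (simp add: \<Delta>.mult d single_AG_mult algebra_simps)
  qed
  show ?thesis
  proof (cases "z < 0")
    case True
    have "u [^]\<^bsub>T\<^esub> nat (- z) \<in> Units T" using u by (rule A.Units_pow_closed)
    from \<Delta>_inv[OF this n] True show ?thesis by (simp add: int_pow_def2 del: pow_nat)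
  next
    case False
    then show ?thesis using n[of "nat z"] by (simp add: int_pow_def2 del: pow_nat)
  qed
qed

lemma \<Delta>_mon: "k \<le> t \<Longrightarrow> \<Delta> (lmon k m) = single T (\<lambda>i. if i \<in> {1..k} then m i else 0) (lmon k m)"
proof (induct k)
  case 0
  then show ?case by (simp add: A.laurent_monomial_0 \<Delta>.one single_AG_one)
next
  case (Suc k)
  let ?p = "x (Suc k) [^]\<^bsub>T\<^esub> m (Suc k)"
  have u: "x (Suc k) \<in> Units T" using x_unit Suc by simp
  have c: "?p \<in> carrier T" using A.Units_int_pow_closed[OF u] by blast
  have "\<Delta> ?p = single T (\<lambda>i. m (Suc k) * (if i = Suc k then 1 else 0)) ?p"
    by (rule \<Delta>_int_pow[OF u \<Delta>_x]) (use Suc in simp)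
  with Suc c have "\<Delta> (lmon (Suc k) m) = single T (\<lambda>i. (if i \<in> {1..k} then m i else 0) +
      m (Suc k) * (if i = Suc k then 1 else 0)) (lmon (Suc k) m)"
    by (simp add: mon_Suc \<Delta>.mult single_AG_mult)
  also have "(\<lambda>i. (if i \<in> {1..k} then m i else 0) + m (Suc k) * (if i = Suc k then 1 else 0)) =
      (\<lambda>i. if i \<in> {1..Suc k} then m i else 0)" by (auto simp: fun_eq_iff)
  finally show ?case .
qed

text \<open>The left \<open>B\<close>-span of the monomials, built one term at a time. Repeated
  exponents and arbitrary exponent functions are allowed, which makes closure under the operations
  easy; \<open>V_sum\<close> normalizes afterwards.\<close>

inductive_set V where
  zero: "\<zero>\<^bsub>T\<^esub> \<in> V"
| add: "\<lbrakk>b \<in> B; v \<in> V\<rbrakk> \<Longrightarrow> b \<otimes>\<^bsub>T\<^esub> lmon t m \<oplus>\<^bsub>T\<^esub> v \<in> V"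

lemma V_closed: "v \<in> V \<Longrightarrow> v \<in> carrier T"
  by (induct rule: V.induct) (simp_all add: B_closed)

lemma V_add: "\<lbrakk>v \<in> V; w \<in> V\<rbrakk> \<Longrightarrow> v \<oplus>\<^bsub>T\<^esub> w \<in> V"
  by (induct rule: V.induct) (simp_all add: B_closed V_closed M.a_assoc V.add)

lemma V_monomial: "b \<in> B \<Longrightarrow> b \<otimes>\<^bsub>T\<^esub> lmon t m \<in> V"
  using V.add[OF _ V.zero] by (simp add: B_closed)

lemma V_smult: "\<lbrakk>v \<in> V; k \<in> carrier K\<rbrakk> \<Longrightarrow> k \<odot>\<^bsub>T\<^esub> v \<in> V"
proof (induct rule: V.induct)
  case zero
  then show ?case by (simp add: V.zero)
next
  case (add b v m)
  then have "(k \<odot>\<^bsub>T\<^esub> b) \<otimes>\<^bsub>T\<^esub> lmon t m \<oplus>\<^bsub>T\<^esub> k \<odot>\<^bsub>T\<^esub> v \<in> V"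
    by (intro V.add subalgD(7)[OF B])
  with add show ?case by (simp add: B_closed V_closed smult_r_distr smult_mult_left)
qed

text \<open>Moving x^m past a coefficient b' conjugates it: (b x^m)(b' x^{m'}) = b (x^m b' x^{-m})
  x^{m + m'}, and the conjugate lies in \<open>B\<close> by \<open>conj_mon_B\<close>.\<close>

lemma V_mult_monomial: "\<lbrakk>v \<in> V; b \<in> B\<rbrakk> \<Longrightarrow> (b \<otimes>\<^bsub>T\<^esub> lmon t m) \<otimes>\<^bsub>T\<^esub> v \<in> V"
proof (induct rule: V.induct)
  case zero
  then show ?case by (simp add: B_closed V.zero)
next
  case (add b' v m')
  let ?c = "conj_by T (lmon t m) b'"
  have c: "?c \<in> B" using add by (intro conj_mon_B)
  have "(b \<otimes>\<^bsub>T\<^esub> lmon t m) \<otimes>\<^bsub>T\<^esub> (b' \<otimes>\<^bsub>T\<^esub> lmon t m') = b \<otimes>\<^bsub>T\<^esub> (lmon t m \<otimes>\<^bsub>T\<^esub> b') \<otimes>\<^bsub>T\<^esub> lmon t m'"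
    using add by (simp add: B_closed A.m_assoc)
  also have "\<dots> = b \<otimes>\<^bsub>T\<^esub> (?c \<otimes>\<^bsub>T\<^esub> lmon t m) \<otimes>\<^bsub>T\<^esub> lmon t m'"
    using add by (simp add: conj_by_mult_unit mon_unit B_closed)
  also have "\<dots> = (b \<otimes>\<^bsub>T\<^esub> ?c) \<otimes>\<^bsub>T\<^esub> lmon t (\<lambda>i. m i + m' i)"
    using add c by (simp add: B_closed A.m_assoc mon_add)
  finally have e: "(b \<otimes>\<^bsub>T\<^esub> lmon t m) \<otimes>\<^bsub>T\<^esub> (b' \<otimes>\<^bsub>T\<^esub> lmon t m') =
    (b \<otimes>\<^bsub>T\<^esub> ?c) \<otimes>\<^bsub>T\<^esub> lmon t (\<lambda>i. m i + m' i)" .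
  have "(b \<otimes>\<^bsub>T\<^esub> ?c) \<otimes>\<^bsub>T\<^esub> lmon t (\<lambda>i. m i + m' i) \<oplus>\<^bsub>T\<^esub> (b \<otimes>\<^bsub>T\<^esub> lmon t m) \<otimes>\<^bsub>T\<^esub> v \<in> V"
    using add c by (intro V.add subalgD(4)[OF B]) auto
  then show ?case using add by (simp add: B_closed V_closed A.r_distr e)
qed

lemma V_mult: "\<lbrakk>v \<in> V; w \<in> V\<rbrakk> \<Longrightarrow> v \<otimes>\<^bsub>T\<^esub> w \<in> V"
proof (induct rule: V.induct)
  case zero
  then show ?case by (simp add: V_closed V.zero)
next
  case (add b v m)
  then show ?case
    using V_add[OF V_mult_monomial] by (simp add: B_closed V_closed A.l_distr)
qed

text \<open>\<open>V\<close> is a subalgebra; unit vectors and their negatives as exponents show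
  that it contains the generators x_i and their inverses.\<close>

lemma V_eq: "V = carrier T"
proof (rule generated)
  have one: "\<one>\<^bsub>T\<^esub> \<in> B" by (rule subalgD(3)[OF B])
  have B_V: "b \<in> V" if "b \<in> B" for b
    using V_monomial[OF that, of "\<lambda>i. 0"] that by (simp add: mon_zero B_closed)
  show "B \<subseteq> V" using B_V by blast
  show "subalg K T V"
    by (rule subalgI) (use V_closed V_mult V_add V_smult B_V[OF one] in auto)
  show "x i \<in> V \<and> inv\<^bsub>T\<^esub> (x i) \<in> V" if "i \<in> {1..t}" for i
    using V_monomial[OF one, of "\<lambda>j. if j = i then 1 else 0"]
      V_monomial[OF one, of "\<lambda>j. if j = i then - 1 else 0"] that
    by (simp add: mon_unit_vector mon_minus_unit_vector x_closed x_unit)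
qed

abbreviation "exponents \<equiv> {1..t} \<rightarrow>\<^sub>E (UNIV :: int set)"

text \<open>A basis expansion runs over a set of distinct exponents, so terms with equal exponents
  have to be merged.\<close>

lemma V_sum:
  assumes "y \<in> V"
  shows "\<exists>F a. finite F \<and> F \<subseteq> exponents \<and> a \<in> F \<rightarrow> B \<and> y = (\<Oplus>\<^bsub>T\<^esub>m\<in>F. a m \<otimes>\<^bsub>T\<^esub> lmon t m)"
  using assms
proof (induct rule: V.induct)
  case zero
  show ?case by (intro exI[of _ "{}"]) auto
next
  case (add b v m')
  then obtain F a where F: "finite F" "F \<subseteq> exponents" "a \<in> F \<rightarrow> B"
    and v: "v = (\<Oplus>\<^bsub>T\<^esub>m\<in>F. a m \<otimes>\<^bsub>T\<^esub> lmon t m)" by blast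
  \<comment> \<open>Makes the exponent extensional on \<open>{1..t}\<close>, as membership in
    \<open>exponents\<close> requires; the monomial does not change.\<close>
  define m where "m = restrict m' {1..t}"
  have m: "m \<in> exponents" and lmon: "lmon t m' = lmon t m"
    by (auto simp: m_def intro: mon_cong)
  have aB: "a n \<in> carrier T" if "n \<in> F" for n using F(3) that B_closed by blast
  have b: "b \<in> carrier T" using add B_closed by blast
  \<comment> \<open>If \<open>m\<close> already occurs, \<open>b\<close> is added to its
    coefficient; otherwise \<open>m\<close> becomes a new index with coefficient
    \<open>b\<close>.\<close>
  let ?a = "\<lambda>n. if n = m then (if m \<in> F then b \<oplus>\<^bsub>T\<^esub> a m else b) else a n"
  have fin: "finite (F - {m})" using F by simp
  have rest: "(\<Oplus>\<^bsub>T\<^esub>n\<in>F - {m}. ?a n \<otimes>\<^bsub>T\<^esub> lmon t n) = (\<Oplus>\<^bsub>T\<^esub>n\<in>F - {m}. a n \<otimes>\<^bsub>T\<^esub> lmon t n)"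
    by (rule M.finsum_cong') (use aB in auto)
  have c: "(\<Oplus>\<^bsub>T\<^esub>n\<in>F - {m}. a n \<otimes>\<^bsub>T\<^esub> lmon t n) \<in> carrier T"
    by (rule M.finsum_closed) (use aB in auto)
  have "(\<Oplus>\<^bsub>T\<^esub>n\<in>insert m (F - {m}). ?a n \<otimes>\<^bsub>T\<^esub> lmon t n) =
      ?a m \<otimes>\<^bsub>T\<^esub> lmon t m \<oplus>\<^bsub>T\<^esub> (\<Oplus>\<^bsub>T\<^esub>n\<in>F - {m}. ?a n \<otimes>\<^bsub>T\<^esub> lmon t n)"
    by (rule M.finsum_insert) (use fin aB b in auto)
  also have "\<dots> = b \<otimes>\<^bsub>T\<^esub> lmon t m \<oplus>\<^bsub>T\<^esub> v"
  proof (cases "m \<in> F")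
    case True
    then have "v = (\<Oplus>\<^bsub>T\<^esub>n\<in>insert m (F - {m}). a n \<otimes>\<^bsub>T\<^esub> lmon t n)"
      unfolding v by (simp add: insert_absorb)
    also have "\<dots> = a m \<otimes>\<^bsub>T\<^esub> lmon t m \<oplus>\<^bsub>T\<^esub> (\<Oplus>\<^bsub>T\<^esub>n\<in>F - {m}. a n \<otimes>\<^bsub>T\<^esub> lmon t n)"
      by (rule M.finsum_insert) (use fin aB True in auto)
    finally show ?thesis unfolding rest using True aB b c by (simp add: A.l_distr M.a_assoc)
  next
    case False
    then show ?thesis unfolding rest v by simp
  qed
  finally have "b \<otimes>\<^bsub>T\<^esub> lmon t m' \<oplus>\<^bsub>T\<^esub> v = (\<Oplus>\<^bsub>T\<^esub>n\<in>insert m (F - {m}). ?a n \<otimes>\<^bsub>T\<^esub> lmon t n)"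
    by (simp add: lmon)
  moreover have "?a \<in> insert m (F - {m}) \<rightarrow> B"
    using F(3) add(1) by (auto intro!: subalgD(5)[OF B] intro: funcset_mem)
  ultimately show ?case
    using F m by (intro exI[of _ "insert m (F - {m})"] exI[of _ ?a]) auto
qed

section \<open>Independence of the monomials over B\<close>

lemma coeff_sum:
  assumes "finite F" "f \<in> F \<rightarrow> carrier T"
  shows "\<Delta> (\<Oplus>\<^bsub>T\<^esub>m\<in>F. f m) g = (\<Oplus>\<^bsub>T\<^esub>m\<in>F. \<Delta> (f m) g)"
  using assms
proof (induct F)
  case empty
  then show ?case by (simp add: \<Delta>.zero AG_zero)
next
  case (insert n F)
  then have "(\<lambda>m. \<Delta> (f m) g) \<in> F \<rightarrow> carrier T" "\<Delta> (f n) g \<in> carrier T"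
    using AG_closed by (auto simp: Pi_iff)
  with insert show ?case by (simp add: \<Delta>.add AG_add Pi_iff)
qed

lemma mon_independent:
  assumes F: "finite F" "F \<subseteq> exponents" and a: "a \<in> F \<rightarrow> B"
    and z: "(\<Oplus>\<^bsub>T\<^esub>m\<in>F. a m \<otimes>\<^bsub>T\<^esub> lmon t m) = \<zero>\<^bsub>T\<^esub>" and n: "n \<in> F"
  shows "a n = \<zero>\<^bsub>T\<^esub>"
proof -
  \<comment> \<open>Elements of \<open>exponents\<close> are undefined outside
    \<open>{1..t}\<close>, whereas degrees are zero there. The translation is injective on
    \<open>exponents\<close>, since extensional functions are determined by their values on
    \<open>{1..t}\<close>.\<close>
  let ?d = "\<lambda>m i. if i \<in> {1..t} then m i else (0::int)"
  have aB: "a m \<in> B" "a m \<in> carrier T" if "m \<in> F" for m using a that B_closed by blast+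
  have d: "\<Delta> (a m \<otimes>\<^bsub>T\<^esub> lmon t m) (?d n) = (if m = n then a m \<otimes>\<^bsub>T\<^esub> lmon t m else \<zero>\<^bsub>T\<^esub>)"
    if m: "m \<in> F" for m
  proof -
    have "?d n = ?d m \<longleftrightarrow> m = n"
    proof
      assume e: "?d n = ?d m"
      have me: "m \<in> exponents" and ne: "n \<in> exponents" using F(2) m n by blast+
      show "m = n"
      proof (rule PiE_ext[OF me ne])
        fix i assume "i \<in> {1..t}"
        then show "m i = n i" using fun_cong[OF e, of i] by simp
      qed
    next
      assume "m = n"
      then show "?d n = ?d m" by (simp only:)
    qed
    moreover have "\<Delta> (a m \<otimes>\<^bsub>T\<^esub> lmon t m) = single T (?d m) (a m \<otimes>\<^bsub>T\<^esub> lmon t m)"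
      using aB[OF m] by (simp add: \<Delta>.mult \<Delta>_mon \<Delta>_B single_AG_mult)
    ultimately show ?thesis by (simp add: single_def)
  qed
  have "\<zero>\<^bsub>T\<^esub> = \<Delta> (\<Oplus>\<^bsub>T\<^esub>m\<in>F. a m \<otimes>\<^bsub>T\<^esub> lmon t m) (?d n)"
    by (simp only: z \<Delta>.zero AG_zero)
  also have "\<dots> = (\<Oplus>\<^bsub>T\<^esub>m\<in>F. \<Delta> (a m \<otimes>\<^bsub>T\<^esub> lmon t m) (?d n))"
    by (rule coeff_sum) (use F aB in auto)
  also have "\<dots> = (\<Oplus>\<^bsub>T\<^esub>m\<in>F. if m = n then a m \<otimes>\<^bsub>T\<^esub> lmon t m else \<zero>\<^bsub>T\<^esub>)"
    by (rule M.finsum_cong') (use d aB in auto)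
  also have "\<dots> = a n \<otimes>\<^bsub>T\<^esub> lmon t n"
    by (rule M.add.finprod_singleton_swap) (use F n aB in auto)
  finally have "a n \<otimes>\<^bsub>T\<^esub> lmon t n = \<zero>\<^bsub>T\<^esub>" by simp
  then have "(a n \<otimes>\<^bsub>T\<^esub> lmon t n) \<otimes>\<^bsub>T\<^esub> inv\<^bsub>T\<^esub> (lmon t n) = \<zero>\<^bsub>T\<^esub>"
    using mon_unit[of t n] by simp
  then show ?thesis
    using mon_unit[of t n] aB[OF n] by (simp add: A.m_assoc)
qed

lemma left_basis: "left_basis T B exponents (laurent_monomial T t x)"
  unfolding left_basis_def
proof (intro conjI allI ballI impI)
  show "laurent_monomial T t x \<in> exponents \<rightarrow> carrier T" by simp
  fix y assume "y \<in> carrier T"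
  then show "\<exists>F a. finite F \<and> F \<subseteq> exponents \<and> a \<in> F \<rightarrow> B \<and> y = (\<Oplus>\<^bsub>T\<^esub>m\<in>F. a m \<otimes>\<^bsub>T\<^esub> lmon t m)"
    using V_sum V_eq by blast
qed (use mon_independent in blast)

lemma conj_by_ring_iso:
  assumes i: "i \<in> {1..t}"
  shows "conj_by T (x i) \<in> ring_iso (T\<lparr>carrier := B\<rparr>) (T\<lparr>carrier := B\<rparr>)"
proof -
  note u = x_unit[OF i]
  interpret c: algebra_hom K T T "conj_by T (x i)"
    by (intro algebra_homI assoc_algebra_axioms conj_by_alg_hom u)
  have "bij_betw (conj_by T (x i)) B B"
    by (rule bij_betwI[where g = "conj_by T (inv\<^bsub>T\<^esub> (x i))"])
      (use i u B_closed conj_B conj_inv_B conj_by_inv in auto)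
  moreover have "conj_by T (x i) \<in> ring_hom (T\<lparr>carrier := B\<rparr>) (T\<lparr>carrier := B\<rparr>)"
    by (rule ring_hom_memI) (simp_all add: conj_B[OF i] c.mult c.add c.one B_closed)
  ultimately show ?thesis by (simp add: ring_iso_def)
qed

lemma skew_laurent: "skew_laurent_extension T B t x (\<lambda>i. conj_by T (x i))"
  unfolding skew_laurent_extension_def
  using B x_unit x_comm conj_by_ring_iso left_basis
  by (simp add: A.ring_axioms subalg_def conj_by_mult_unit B_closed)

end

text \<open>Uniqueness in the definite description: two candidates agree on p \<otimes> 1 and 1
  \<otimes> n, hence on the carrier, and extensionality settles the rest.\<close>

lemma (in tensor_product) tensor_auto_eq:
  assumes H: "H \<in> alg_auto K T"
    and Ft: "\<And>p n. \<lbrakk>p \<in> carrier P; n \<in> carrier N\<rbrakk> \<Longrightarrow> H (p \<otimes>\<^sub>T n) = f p \<otimes>\<^sub>T g n"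
  shows "tensor_auto K P N f g = H"
  unfolding tensor_auto_def
proof (rule the_equality)
  show "H \<in> alg_auto K T \<and> (\<forall>a\<in>carrier P. \<forall>b\<in>carrier N. H (a \<otimes>\<^sub>T b) = f a \<otimes>\<^sub>T g b)"
    using H Ft by blast
next
  fix H' assume H': "H' \<in> alg_auto K T \<and> (\<forall>a\<in>carrier P. \<forall>b\<in>carrier N. H' (a \<otimes>\<^sub>T b) = f a \<otimes>\<^sub>T g b)"
  have "subalg K T {x \<in> carrier T. H' x = H x}"
    by (rule equalizer_subalg) (use H H' T.assoc_algebra_axioms in \<open>auto simp: alg_auto_def\<close>)
  then have e: "{x \<in> carrier T. H' x = H x} = carrier T"
    by (rule tens_generated) (use H' Ft in simp_all)
  show "H' = H"
  proof (rule extensionalityI)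
    show "H' \<in> extensional (carrier T)" "H \<in> extensional (carrier T)"
      using H H' by (auto simp: alg_auto_def)
    show "H' x = H x" if "x \<in> carrier T" for x using that e by blast
  qed
qed

section \<open>The skew-Laurent structure\<close>

text \<open>The torus action is identified with conjugation only at indices in
  \<open>{1..t}\<close>, so the two families need not be equal as functions.\<close>

lemma skew_laurent_extension_cong:
  assumes "skew_laurent_extension T S t x \<sigma>" "\<And>i. i \<in> {1..t} \<Longrightarrow> \<tau> i = \<sigma> i"
  shows "skew_laurent_extension T S t x \<tau>"
proof -
  have "\<forall>i\<in>{1..t}. \<sigma> i \<in> ring_iso (T\<lparr>carrier := S\<rparr>) (T\<lparr>carrier := S\<rparr>)"
    "\<forall>i\<in>{1..t}. \<forall>s\<in>S. x i \<otimes>\<^bsub>T\<^esub> s = \<sigma> i s \<otimes>\<^bsub>T\<^esub> x i"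
    using assms(1) unfolding skew_laurent_extension_def by blast+
  then have "\<forall>i\<in>{1..t}. \<tau> i \<in> ring_iso (T\<lparr>carrier := S\<rparr>) (T\<lparr>carrier := S\<rparr>)"
    "\<forall>i\<in>{1..t}. \<forall>s\<in>S. x i \<otimes>\<^bsub>T\<^esub> s = \<tau> i s \<otimes>\<^bsub>T\<^esub> x i"
    using assms(2) by simp_all
  with assms(1) show ?thesis unfolding skew_laurent_extension_def by blast
qed

section \<open>The algebras R^+ and R^- of a pair of index sequences\<close>

locale quantum_pair = quantum_matrices K q n
  for K :: "('k, 'm) ring_scheme" (structure) and q :: 'k and n :: nat +
  fixes r c :: "nat list" and t :: nat
    and P :: "('k, 'a, 'u) module_scheme" and \<phi> :: "'k qmat set \<Rightarrow> 'a"
    and N :: "('k, 'b, 'v) module_scheme" and \<psi> :: "'k qmat set \<Rightarrow> 'b"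
  assumes rc: "(r, c) \<in> RC n" and len_r: "length r = t" and len_c: "length c = t"
    and loc_Rp: "is_Rp K q n r P \<phi>"
    and loc_Rm: "is_Rm K q n c N \<psi>"
begin

sublocale tensor_product K P N
  using loc_Rp loc_Rm
  by (intro tensor_product.intro) (simp_all add: is_Rp_def is_Rm_def is_localization_def)

definition "y i j = \<phi> (Rp0_Y K q n r i j)"
definition "z i j = \<psi> (Rm0_Z K q n c i j)"

text \<open>A strictly increasing sequence in \<open>{1..n}\<close> has at most \<open>n\<close>
  entries; hence every \<open>s \<le> t\<close> with \<open>s \<ge> 1\<close> is a legitimate row or
  column index.\<close>

lemma t_le: "t \<le> n"
proof -
  have "distinct r" "set r \<subseteq> {1..n}" using rc by (auto simp: RC_def strict_sorted_iff)
  then have "length r \<le> card {1..n}" by (metis card_mono distinct_card finite_atLeastAtMost)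
  then show ?thesis using len_r by simp
qed

lemma index_mem: "s \<in> {1..t} \<Longrightarrow> s \<in> {1..n}"
  using t_le by (auto simp: atLeastAtMost_iff)

lemma ent_mem: "s \<in> {1..t} \<Longrightarrow> ent r s \<in> {1..n}" "s \<in> {1..t} \<Longrightarrow> ent c s \<in> {1..n}"
proof -
  assume s: "s \<in> {1..t}"
  then have "ent r s \<in> set r" "ent c s \<in> set c"
    using len_r len_c by (auto simp: ent_def atLeastAtMost_iff)
  then show "ent r s \<in> {1..n}" "ent c s \<in> {1..n}" using rc by (auto simp: RC_def)
qed

lemma ent_less: "\<lbrakk>s \<in> {1..t}; s' \<in> {1..t}; s < s'\<rbrakk> \<Longrightarrow> ent c s < ent c s'"
  using sorted_wrt_nth_less[of "(<)" c "s - 1" "s' - 1"] rc len_c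
  by (auto simp: RC_def ent_def atLeastAtMost_iff)

text \<open>Killed positions (\<open>D\<close>) and inverted positions (\<open>E\<close>) for R^+
  (suffix \<open>p\<close>) and R^- (suffix \<open>m\<close>), as required by
  \<open>localized_quotient\<close>.\<close>

abbreviation "Dp \<equiv> {(i, j). i \<in> {1..n} \<and> j \<in> {1..n} \<and> (j > length r \<or> i < ent r j)}"
abbreviation "Dm \<equiv> {(i, j). i \<in> {1..n} \<and> j \<in> {1..n} \<and> (i > length c \<or> j < ent c i)}"
abbreviation "Ep \<equiv> (\<lambda>s. (ent r s, s)) ` {1..t}"
abbreviation "Em \<equiv> (\<lambda>s. (s, ent c s)) ` {1..t}"

sublocale Rp: localized_quotient K q n Dp Ep P \<phi> "Rp0_ideal K q n r"
proof unfold_locales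
  have "{QX i j | i j. i \<in> {1..n} \<and> j \<in> {1..n} \<and> (j > length r \<or> i < ent r j)} =
      (\<lambda>(i, j). QX i j) ` Dp" by auto
  then show "Rp0_ideal K q n r = Idl\<^bsub>A\<^esub> ((\<lambda>(i, j). QX i j) ` Dp)"
    by (simp only: Rp0_ideal_def)
  show "Dp \<subseteq> {1..n} \<times> {1..n}" by auto
  show "Ep \<subseteq> {1..n} \<times> {1..n}" using ent_mem index_mem by auto
  have "{Rp0_Y K q n r (ent r s) s | s. s \<in> {1..length r}} =
      (\<lambda>(i, j). Rp0_ideal K q n r +>\<^bsub>A\<^esub> QX i j) ` Ep"
    by (auto simp: Rp0_Y_def len_r)
  with loc_Rp show "is_localization K (quot_algebra A (Rp0_ideal K q n r))
      ((\<lambda>(i, j). Rp0_ideal K q n r +>\<^bsub>A\<^esub> QX i j) ` Ep) P \<phi>"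
    by (simp only: is_Rp_def Rp0_def)
qed

sublocale Rm: localized_quotient K q n Dm Em N \<psi> "Rm0_ideal K q n c"
proof unfold_locales
  have "{QX i j | i j. i \<in> {1..n} \<and> j \<in> {1..n} \<and> (i > length c \<or> j < ent c i)} =
      (\<lambda>(i, j). QX i j) ` Dm" by auto
  then show "Rm0_ideal K q n c = Idl\<^bsub>A\<^esub> ((\<lambda>(i, j). QX i j) ` Dm)"
    by (simp only: Rm0_ideal_def)
  show "Dm \<subseteq> {1..n} \<times> {1..n}" by auto
  show "Em \<subseteq> {1..n} \<times> {1..n}" using ent_mem index_mem by auto
  have "{Rm0_Z K q n c s (ent c s) | s. s \<in> {1..length c}} =
      (\<lambda>(i, j). Rm0_ideal K q n c +>\<^bsub>A\<^esub> QX i j) ` Em"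
    by (auto simp: Rm0_Z_def len_c)
  with loc_Rm show "is_localization K (quot_algebra A (Rm0_ideal K q n c))
      ((\<lambda>(i, j). Rm0_ideal K q n c +>\<^bsub>A\<^esub> QX i j) ` Em) N \<psi>"
    by (simp only: is_Rm_def Rm0_def)
qed

lemma y_eq: "Rp.x = y"
  by (simp add: fun_eq_iff Rp.x_def y_def Rp0_Y_def)

lemma z_eq: "Rm.x = z"
  by (simp add: fun_eq_iff Rm.x_def z_def Rm0_Z_def)

lemmas y_closed [simp] = Rp.x_closed[unfolded y_eq]
lemmas z_closed [simp] = Rm.x_closed[unfolded z_eq]
lemmas z_rel = qmat_relD[OF Rm.x_rel[unfolded z_eq]]

lemma y_zero: "\<lbrakk>i \<in> {1..n}; j \<in> {1..n}; j > t \<or> i < ent r j\<rbrakk> \<Longrightarrow> y i j = \<zero>\<^bsub>P\<^esub>"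
  using Rp.x_zero[of i j] by (simp add: y_eq len_r)

lemma z_zero: "\<lbrakk>i \<in> {1..n}; j \<in> {1..n}; i > t \<or> j < ent c i\<rbrakk> \<Longrightarrow> z i j = \<zero>\<^bsub>N\<^esub>"
  using Rm.x_zero[of i j] by (simp add: z_eq len_c)

lemma y_unit: "s \<in> {1..t} \<Longrightarrow> y (ent r s) s \<in> Units P"
  using Rp.x_unit[of "ent r s" s] by (auto simp: y_eq)

lemma z_unit: "s \<in> {1..t} \<Longrightarrow> z s (ent c s) \<in> Units N"
  using Rm.x_unit[of s "ent c s"] by (auto simp: z_eq)

text \<open>Split into a row factor and a column factor so as to match alpha_l beta_j for the torus
  element \<open>\<tau> s\<close>.\<close>

definition "scal s l j = (if l = s then q else \<one>) \<otimes> (if j = ent c s then inv q else \<one>)"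

lemma scal_unit: "scal s l j \<in> Units K"
  using q by (simp add: scal_def)

lemma scal_closed [simp]: "scal s l j \<in> carrier K"
  by (rule Units_closed[OF scal_unit])

text \<open>The relation producing \<open>(q - q\<^sup>-\<^sup>1) X\<^sub>i\<^sub>m X\<^sub>l\<^sub>j\<close> only enters with one of its two factors in the
  defining ideal of \<open>R\<^sup>-\<close>.\<close>

lemma z_eigen:
  assumes s: "s \<in> {1..t}" and l: "l \<in> {1..n}" and j: "j \<in> {1..n}"
  shows "z s (ent c s) \<otimes>\<^bsub>N\<^esub> z l j = scal s l j \<odot>\<^bsub>N\<^esub> (z l j \<otimes>\<^bsub>N\<^esub> z s (ent c s))"
proof (cases "l > t \<or> j < ent c l")
  case True
  then show ?thesis using s l j by (simp add: z_zero index_mem ent_mem)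
next
  case False
  let ?m = "ent c s"
  note sn = index_mem[OF s] and m = ent_mem(2)[OF s]
  have lt: "l \<in> {1..t}" using l False by (simp add: atLeastAtMost_iff)
  have jl: "ent c l \<le> j" using False by simp
  have zz: "z l j \<otimes>\<^bsub>N\<^esub> z s ?m \<in> carrier N" "z s ?m \<otimes>\<^bsub>N\<^esub> z l j \<in> carrier N"
    using sn m l j by simp_all
  \<comment> \<open>For \<open>l = s\<close> the bound \<open>jl\<close> excludes
    \<open>j < ?m\<close>. For \<open>s < l\<close> no split by \<open>j\<close> is needed, since
    ent c s < ent c l \<le> j.\<close>
  consider "l = s" "j = ?m" | "l = s" "?m < j" | "l < s" "j = ?m" | "l < s" "?m < j"
    | "l < s" "j < ?m" | "s < l" using jl
    by (cases l s rule: linorder_cases; cases j ?m rule: linorder_cases) auto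
  then show ?thesis
  proof cases
    case 1
    then show ?thesis using q zz by (simp add: scal_def)
  next
    case 2
    then show ?thesis using z_rel(2)[OF sn m j] zz by (simp add: scal_def)
  next
    case 3
    \<comment> \<open>The column relation has the generator with smaller row index first, here
      \<open>z l j\<close>, so q is moved across and its inverse appears.\<close>
    have "z l j \<otimes>\<^bsub>N\<^esub> z s j = q \<odot>\<^bsub>N\<^esub> (z s j \<otimes>\<^bsub>N\<^esub> z l j)"
      using z_rel(1)[OF l j sn] 3 by simp
    then have "inv q \<odot>\<^bsub>N\<^esub> (z l j \<otimes>\<^bsub>N\<^esub> z s j) = (inv q \<otimes> q) \<odot>\<^bsub>N\<^esub> (z s j \<otimes>\<^bsub>N\<^esub> z l j)"
      using sn j l by (simp add: N.smult_assoc1)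
    then show ?thesis using 3 q zz by (simp add: scal_def)
  next
    case 4
    then show ?thesis using z_rel(3)[OF l j sn m] zz by (simp add: scal_def)
  next
    case 5
    \<comment> \<open>The correction term is z l ?m z s j, and (s, j) lies to the left of the pivot
      in row s.\<close>
    have "z s j = \<zero>\<^bsub>N\<^esub>" using sn j 5 by (simp add: z_zero)
    then show ?thesis using z_rel(4)[OF l j sn m] 5 zz sn m l j by (simp add: scal_def)
  next
    case 6
    \<comment> \<open>Now the correction term is z s j z l ?m, and it is (l, ?m) that lies to the
      left of the pivot in its row.\<close>
    then have mj: "?m < ent c l" using ent_less s lt by simp
    then have "z l ?m = \<zero>\<^bsub>N\<^esub>" using l m by (simp add: z_zero)
    then show ?thesis using z_rel(4)[OF sn m l j] 6 mj jl zz sn m l j by (simp add: scal_def)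
  qed
qed

text \<open>Distinct pivots differ in row and, as \<open>c\<close> is strictly increasing, in
  column, so the scalar in \<open>z_eigen\<close> is 1.\<close>

lemma z_commute:
  assumes s: "s \<in> {1..t}" and s': "s' \<in> {1..t}"
  shows "z s (ent c s) \<otimes>\<^bsub>N\<^esub> z s' (ent c s') = z s' (ent c s') \<otimes>\<^bsub>N\<^esub> z s (ent c s)"
proof (cases "s = s'")
  case False
  then have "ent c s' \<noteq> ent c s"
    using ent_less[OF s s'] ent_less[OF s' s] by linarith
  with False z_eigen[OF s index_mem[OF s'] ent_mem(2)[OF s']] show ?thesis
    using s s' by (simp add: scal_def index_mem ent_mem)
qed simp

section \<open>Conjugation by the pivots in the tensor product, and the torus action\<close>

definition "Z s = \<one>\<^bsub>P\<^esub> \<otimes>\<^sub>T z s (ent c s)"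

sublocale l: algebra_hom K P T "\<lambda>p. p \<otimes>\<^sub>T \<one>\<^bsub>N\<^esub>"
  by (intro algebra_homI P.assoc_algebra_axioms T.assoc_algebra_axioms tens_left_hom)

sublocale r: algebra_hom K N T "\<lambda>n. \<one>\<^bsub>P\<^esub> \<otimes>\<^sub>T n"
  by (intro algebra_homI N.assoc_algebra_axioms T.assoc_algebra_axioms tens_right_hom)

lemma Z_unit: "s \<in> {1..t} \<Longrightarrow> Z s \<in> Units T"
  unfolding Z_def by (intro r.unit_inv z_unit)

lemma Z_inv: "s \<in> {1..t} \<Longrightarrow> inv\<^bsub>T\<^esub> (Z s) = \<one>\<^bsub>P\<^esub> \<otimes>\<^sub>T inv\<^bsub>N\<^esub> (z s (ent c s))"
  unfolding Z_def by (rule r.unit_inv(2)[OF z_unit, symmetric])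

lemma Z_commute:
  assumes s: "s \<in> {1..t}" and s': "s' \<in> {1..t}"
  shows "Z s \<otimes>\<^bsub>T\<^esub> Z s' = Z s' \<otimes>\<^bsub>T\<^esub> Z s"
proof -
  note c = N.A.Units_closed[OF z_unit[OF s]] N.A.Units_closed[OF z_unit[OF s']]
  show ?thesis
    unfolding Z_def r.mult[OF c, symmetric] r.mult[OF c(2,1), symmetric] z_commute[OF s s'] ..
qed

definition "\<tau> s = (torus_one K n,
  ((\<lambda>a\<in>{1..n}. if a = s then q else \<one>), (\<lambda>b\<in>{1..n}. if b = ent c s then inv q else \<one>)))"

lemma \<tau>_mem: "\<tau> s \<in> {torus_one K n} \<times> torus K n"
  using q by (auto simp: \<tau>_def torus_def)

lemma torus_act_one: "torus_act K n P y (torus_one K n) = (\<lambda>p\<in>carrier P. p)"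
  unfolding y_eq[symmetric]
proof (rule Rp.torus_act_eq)
  show "(\<lambda>p\<in>carrier P. p) \<in> alg_auto K P"
    unfolding alg_auto_def by (auto intro!: alg_homI bij_betwI[where g = "\<lambda>p. p"])
qed (simp add: torus_one_def)

text \<open>By \<open>z_eigen\<close> each generator is an eigenvector of the conjugation with the
  eigenvalue prescribed by the torus element; \<open>torus_act_eq\<close> then identifies the two
  automorphisms.\<close>

lemma torus_act_\<tau>:
  assumes s: "s \<in> {1..t}"
  shows "torus_act K n N z (snd (\<tau> s)) = conj_by N (z s (ent c s))"
  unfolding z_eq[symmetric]
proof (rule Rm.torus_act_eq)
  show "conj_by N (Rm.x s (ent c s)) \<in> alg_auto K N"
    unfolding z_eq by (intro N.conj_by_alg_auto z_unit s)
  fix l j assume "l \<in> {1..n}" "j \<in> {1..n}"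
  with N.conj_by_eigenvector(1)[OF z_unit[OF s] _ scal_unit z_eigen[OF s]]
  show "conj_by N (Rm.x s (ent c s)) (Rm.x l j) = (fst (snd (\<tau> s)) l \<otimes> snd (snd (\<tau> s)) j) \<odot>\<^bsub>N\<^esub> Rm.x l j"
    unfolding z_eq by (simp add: \<tau>_def scal_def)
qed

text \<open>The left factor of \<open>Z s\<close> is 1, so only the right factor is conjugated. This
  is why the torus elements can be trivial in the first copy of H.\<close>

lemma conj_Z_tens:
  assumes s: "s \<in> {1..t}" and p: "p \<in> carrier P" and m: "m \<in> carrier N"
  shows "conj_by T (Z s) (p \<otimes>\<^sub>T m) = p \<otimes>\<^sub>T conj_by N (z s (ent c s)) m"
proof (rule T.conj_by_eqI[OF Z_unit[OF s]])
  note u = z_unit[OF s]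
  show "Z s \<otimes>\<^bsub>T\<^esub> p \<otimes>\<^sub>T m = p \<otimes>\<^sub>T conj_by N (z s (ent c s)) m \<otimes>\<^bsub>T\<^esub> Z s"
    using u p m N.A.Units_closed[OF u]
    by (simp add: Z_def tens_mult N.conj_by_mult_unit)
qed (use z_unit[OF s] p m in simp_all)

lemma torus2_act_\<tau>:
  assumes s: "s \<in> {1..t}"
  shows "torus2_act K n P y N z (\<tau> s) = conj_by T (Z s)"
proof -
  have "fst (\<tau> s) = torus_one K n" by (simp add: \<tau>_def)
  then have "torus2_act K n P y N z (\<tau> s) =
      tensor_auto K P N (\<lambda>p\<in>carrier P. p) (conj_by N (z s (ent c s)))"
    by (simp add: torus2_act_def torus_act_one torus_act_\<tau>[OF s])
  also have "\<dots> = conj_by T (Z s)"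
    by (rule tensor_auto_eq) (use s in \<open>simp_all add: T.conj_by_alg_auto Z_unit conj_Z_tens\<close>)
  finally show ?thesis .
qed

section \<open>The subalgebra B: stability, generation and grading\<close>

definition "gens =
  {y i l \<otimes>\<^sub>T z l j | i j l. l \<in> {1..t} \<and> i \<in> {1..n} \<and> j \<in> {1..n} \<and> ent r l \<le> i \<and> ent c l \<le> j} \<union>
  {inv\<^bsub>P\<^esub> (y (ent r l) l) \<otimes>\<^sub>T inv\<^bsub>N\<^esub> (z l (ent c l)) | l. l \<in> {1..t}}"

abbreviation "B \<equiv> Brc K n r c P y N z"

lemma B_def: "B = generated_subalgebra K T gens"
  by (simp only: Brc_def len_r gens_def)

lemma gens_closed: "gens \<subseteq> carrier T"
  unfolding gens_def
  by (intro Un_least subsetI; elim CollectE exE conjE)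
    (simp_all add: index_mem P.A.Units_inv_closed[OF y_unit] N.A.Units_inv_closed[OF z_unit])

lemma B_subalg: "subalg K T B"
  unfolding B_def by (rule T.generated_subalgebra_subalg[OF gens_closed])

lemma gens_B: "g \<in> gens \<Longrightarrow> g \<in> B"
  unfolding B_def using T.subset_generated_subalgebra ..

text \<open>Every generator of \<open>B\<close> is an eigenvector of conjugation by
  \<open>Z s\<close> with a unit eigenvalue, and \<open>B\<close> is closed under scalars.\<close>

lemma conj_gen:
  assumes s: "s \<in> {1..t}" and g: "g \<in> gens"
  shows "conj_by T (Z s) g \<in> B" "conj_by T (inv\<^bsub>T\<^esub> (Z s)) g \<in> B"
proof -
  have gc: "g \<in> carrier T" using g gens_closed by blast
  have zc: "z s (ent c s) \<in> carrier N" using z_unit[OF s] by blast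
  have "\<exists>k\<in>Units K. Z s \<otimes>\<^bsub>T\<^esub> g = k \<odot>\<^bsub>T\<^esub> (g \<otimes>\<^bsub>T\<^esub> Z s)"
    using g unfolding gens_def
  proof
    assume "g \<in> {y i l \<otimes>\<^sub>T z l j | i j l. l \<in> {1..t} \<and> i \<in> {1..n} \<and> j \<in> {1..n} \<and> ent r l \<le> i \<and> ent c l \<le> j}"
    then obtain i j l where e: "g = y i l \<otimes>\<^sub>T z l j" "l \<in> {1..n}" "i \<in> {1..n}" "j \<in> {1..n}"
      using index_mem by blast
    have "Z s \<otimes>\<^bsub>T\<^esub> g = scal s l j \<odot>\<^bsub>T\<^esub> (g \<otimes>\<^bsub>T\<^esub> Z s)"
      using e zc by (simp add: Z_def tens_mult z_eigen[OF s] tens_smult_right)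
    with scal_unit show ?thesis by blast
  next
    assume "g \<in> {inv\<^bsub>P\<^esub> (y (ent r l) l) \<otimes>\<^sub>T inv\<^bsub>N\<^esub> (z l (ent c l)) | l. l \<in> {1..t}}"
    then obtain l where l: "l \<in> {1..t}"
      and e: "g = inv\<^bsub>P\<^esub> (y (ent r l) l) \<otimes>\<^sub>T inv\<^bsub>N\<^esub> (z l (ent c l))" by blast
    \<comment> \<open>The pivots commute with each other and hence with each other's inverses, so
      the eigenvalue is 1.\<close>
    have "Z s \<otimes>\<^bsub>T\<^esub> g = \<one> \<odot>\<^bsub>T\<^esub> (g \<otimes>\<^bsub>T\<^esub> Z s)"
      using P.A.Units_inv_closed[OF y_unit[OF l]] N.A.Units_inv_closed[OF z_unit[OF l]] zc
        N.centralizer_inv[OF z_unit[OF l] zc z_commute[OF l s]]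
      by (simp add: e Z_def tens_mult)
    then show ?thesis by blast
  qed
  then obtain k where k: "k \<in> Units K" and e: "Z s \<otimes>\<^bsub>T\<^esub> g = k \<odot>\<^bsub>T\<^esub> (g \<otimes>\<^bsub>T\<^esub> Z s)" by blast
  show "conj_by T (Z s) g \<in> B" "conj_by T (inv\<^bsub>T\<^esub> (Z s)) g \<in> B"
    unfolding T.conj_by_eigenvector[OF Z_unit[OF s] gc k e]
    by (rule subalgD(7)[OF B_subalg _ gens_B[OF g]], use k in blast)+
qed

lemma conj_B: "\<lbrakk>s \<in> {1..t}; b \<in> B\<rbrakk> \<Longrightarrow> conj_by T (Z s) b \<in> B"
  "\<lbrakk>s \<in> {1..t}; b \<in> B\<rbrakk> \<Longrightarrow> conj_by T (inv\<^bsub>T\<^esub> (Z s)) b \<in> B"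
proof -
  assume s: "s \<in> {1..t}" and b: "b \<in> B"
  show "conj_by T (Z s) b \<in> B"
    using T.conj_by_generated[OF Z_unit[OF s] gens_closed] conj_gen(1)[OF s] b
    unfolding B_def by blast
  show "conj_by T (inv\<^bsub>T\<^esub> (Z s)) b \<in> B"
    using T.conj_by_generated[OF T.A.Units_inv_Units[OF Z_unit[OF s]] gens_closed] conj_gen(2)[OF s] b
    unfolding B_def by blast
qed

text \<open>The tensor factors are separated in order: Y_{il} \<otimes> Z_{l c_l} times the inverse
  of \<open>Z l\<close> gives Y_{il} \<otimes> 1; the inverse generator times \<open>Z l\<close>
  gives Y_{r_l l}^{-1} \<otimes> 1; and the latter times Y_{r_l l} \<otimes> Z_{lj} gives 1
  \<otimes> Z_{lj}. All other generators vanish.\<close>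

lemma B_Z_generated:
  assumes U: "subalg K T U" and BU: "B \<subseteq> U"
    and ZU: "\<And>s. s \<in> {1..t} \<Longrightarrow> Z s \<in> U \<and> inv\<^bsub>T\<^esub> (Z s) \<in> U"
  shows "U = carrier T"
proof -
  note m = subalgD(4)[OF U]
  have gU: "g \<in> U" if "g \<in> gens" for g using gens_B[OF that] BU by blast
  have yz: "y i l \<otimes>\<^sub>T z l j \<in> U"
    if "l \<in> {1..t}" "i \<in> {1..n}" "j \<in> {1..n}" "ent r l \<le> i" "ent c l \<le> j" for i j l
    by (rule gU) (unfold gens_def, use that in blast)
  have yz_inv: "inv\<^bsub>P\<^esub> (y (ent r l) l) \<otimes>\<^sub>T inv\<^bsub>N\<^esub> (z l (ent c l)) \<in> U" if "l \<in> {1..t}" for l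
    by (rule gU) (unfold gens_def, use that in blast)
  have closed: "y (ent r l) l \<in> carrier P" "inv\<^bsub>P\<^esub> (y (ent r l) l) \<in> carrier P"
    "z l (ent c l) \<in> carrier N" "inv\<^bsub>N\<^esub> (z l (ent c l)) \<in> carrier N" if "l \<in> {1..t}" for l
    using y_unit[OF that] z_unit[OF that] by auto
  have yU: "y i l \<otimes>\<^sub>T \<one>\<^bsub>N\<^esub> \<in> U" if i: "i \<in> {1..n}" and l: "l \<in> {1..n}" for i l
  proof (cases "l > t \<or> i < ent r l")
    case True
    with that have "y i l = \<zero>\<^bsub>P\<^esub>" by (simp add: y_zero)
    then show ?thesis using subalgD(2)[OF U] by (simp add: l.zero)
  next
    case False
    then have lt: "l \<in> {1..t}" using l by (simp add: atLeastAtMost_iff)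
    have "(y i l \<otimes>\<^sub>T z l (ent c l)) \<otimes>\<^bsub>T\<^esub> inv\<^bsub>T\<^esub> (Z l) \<in> U"
      using lt i l False ZU ent_mem by (intro m yz) auto
    then show ?thesis using lt i l closed[OF lt] z_unit[OF lt] by (simp add: Z_inv tens_mult)
  qed
  have y_invU: "inv\<^bsub>P\<^esub> (y (ent r l) l) \<otimes>\<^sub>T \<one>\<^bsub>N\<^esub> \<in> U" if l: "l \<in> {1..t}" for l
  proof -
    have "(inv\<^bsub>P\<^esub> (y (ent r l) l) \<otimes>\<^sub>T inv\<^bsub>N\<^esub> (z l (ent c l))) \<otimes>\<^bsub>T\<^esub> Z l \<in> U"
      using l ZU yz_inv by (intro m) auto
    then show ?thesis using closed[OF l] z_unit[OF l] by (simp add: Z_def tens_mult)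
  qed
  have zU: "\<one>\<^bsub>P\<^esub> \<otimes>\<^sub>T z l j \<in> U" if l: "l \<in> {1..n}" and j: "j \<in> {1..n}" for l j
  proof (cases "l > t \<or> j < ent c l")
    case True
    with that have "z l j = \<zero>\<^bsub>N\<^esub>" by (simp add: z_zero)
    then show ?thesis using subalgD(2)[OF U] by (simp add: r.zero)
  next
    case False
    then have lt: "l \<in> {1..t}" using l by (simp add: atLeastAtMost_iff)
    have "(inv\<^bsub>P\<^esub> (y (ent r l) l) \<otimes>\<^sub>T \<one>\<^bsub>N\<^esub>) \<otimes>\<^bsub>T\<^esub> (y (ent r l) l \<otimes>\<^sub>T z l j) \<in> U"
      using lt j l False ent_mem by (intro m yz y_invU) auto
    then show ?thesis using lt j l closed[OF lt] y_unit[OF lt] by (simp add: tens_mult)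
  qed
  have "{p \<in> carrier P. p \<otimes>\<^sub>T \<one>\<^bsub>N\<^esub> \<in> U} = carrier P"
  proof (rule Rp.Q_generated[OF l.preimage_subalg[OF U]])
    show "inv\<^bsub>P\<^esub> (Rp.x i j) \<in> {p \<in> carrier P. p \<otimes>\<^sub>T \<one>\<^bsub>N\<^esub> \<in> U}" if "(i, j) \<in> Ep" for i j
      using that closed y_invU by (auto simp: y_eq)
  qed (use yU in \<open>simp add: y_eq\<close>)
  moreover have "{m \<in> carrier N. \<one>\<^bsub>P\<^esub> \<otimes>\<^sub>T m \<in> U} = carrier N"
  proof (rule Rm.Q_generated[OF r.preimage_subalg[OF U]])
    show "inv\<^bsub>N\<^esub> (Rm.x i j) \<in> {m \<in> carrier N. \<one>\<^bsub>P\<^esub> \<otimes>\<^sub>T m \<in> U}" if "(i, j) \<in> Em" for i j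
      using that closed ZU by (auto simp: z_eq simp flip: Z_inv)
  qed (use zU in \<open>simp add: z_eq\<close>)
  ultimately show ?thesis by (intro tens_generated[OF U]) blast+
qed

text \<open>Grading \<open>R\<^sup>+\<close> by minus the column and \<open>R\<^sup>-\<close> by the row of the generators puts \<open>B\<close> into
  degree \<open>0\<close>.\<close>

lemma grading:
  "\<exists>\<Delta>\<in>alg_hom K T (coeff_algebra T deg_group). (\<forall>b\<in>B. \<Delta> b = single T (\<lambda>i. 0) b) \<and>
    (\<forall>j\<in>{1..t}. \<Delta> (Z j) = single T (\<lambda>i. if i = j then 1 else 0) (Z j))"
proof -
  define e where "e j = (\<lambda>i. if i = j then 1 else (0::int))" for j :: nat
  interpret AG: assoc_algebra K T.AG by (rule T.AG_assoc_algebra)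
  \<comment> \<open>A weight depending on the column alone satisfies the exchange condition of
    \<open>graded_hom\<close>, as does one depending on the row alone, used for
    \<open>\<beta>\<close> below.\<close>
  obtain \<alpha> where \<alpha>: "\<alpha> \<in> alg_hom K P T.AG"
    and \<alpha>y: "\<And>i j. \<lbrakk>i \<in> {1..n}; j \<in> {1..n}\<rbrakk> \<Longrightarrow>
      \<alpha> (y i j) = single T (\<lambda>k. - e j k) (y i j \<otimes>\<^sub>T \<one>\<^bsub>N\<^esub>)"
    using Rp.graded_hom[OF T.assoc_algebra_axioms tens_left_hom, of "\<lambda>i j k. - e j k"]
    by (auto simp: y_eq)
  obtain \<beta> where \<beta>: "\<beta> \<in> alg_hom K N T.AG"
    and \<beta>z: "\<And>i j. \<lbrakk>i \<in> {1..n}; j \<in> {1..n}\<rbrakk> \<Longrightarrow> \<beta> (z i j) = single T (e i) (\<one>\<^bsub>P\<^esub> \<otimes>\<^sub>T z i j)"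
    using Rm.graded_hom[OF T.assoc_algebra_axioms tens_right_hom, of "\<lambda>i j k. e i k"]
    by (auto simp: z_eq)
  interpret \<alpha>: algebra_hom K P T.AG \<alpha> by (intro algebra_homI P.assoc_algebra_axioms AG.assoc_algebra_axioms \<alpha>)
  interpret \<beta>: algebra_hom K N T.AG \<beta> by (intro algebra_homI N.assoc_algebra_axioms AG.assoc_algebra_axioms \<beta>)
  \<comment> \<open>Commuting images are what \<open>tensor_lift\<close> requires. On generators the
    coefficients lie in different tensor factors and degrees add commutatively.\<close>
  have comm_gen: "\<alpha> (y i l) \<otimes>\<^bsub>T.AG\<^esub> \<beta> (z l' j) = \<beta> (z l' j) \<otimes>\<^bsub>T.AG\<^esub> \<alpha> (y i l)"
    if "i \<in> {1..n}" "l \<in> {1..n}" "l' \<in> {1..n}" "j \<in> {1..n}" for i l l' j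
    using that by (simp add: \<alpha>y \<beta>z T.single_AG_mult tens_mult add.commute)
  \<comment> \<open>The commutation is extended in two stages, first to all of \<open>P\<close> with
    a generator of \<open>N\<close> fixed, then to all of \<open>N\<close> with an element of
    \<open>P\<close> fixed; each stage uses a centralizer and its closure under inverses.\<close>
  have comm_z: "\<alpha> p \<otimes>\<^bsub>T.AG\<^esub> \<beta> (z l' j) = \<beta> (z l' j) \<otimes>\<^bsub>T.AG\<^esub> \<alpha> p"
    if p: "p \<in> carrier P" and lj: "l' \<in> {1..n}" "j \<in> {1..n}" for p l' j
  proof -
    let ?C = "{x \<in> carrier T.AG. \<forall>w\<in>{\<beta> (z l' j)}. x \<otimes>\<^bsub>T.AG\<^esub> w = w \<otimes>\<^bsub>T.AG\<^esub> x}"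
    have C: "subalg K T.AG ?C" by (rule AG.centralizer_subalg) (use lj in simp)
    have "{p \<in> carrier P. \<alpha> p \<in> ?C} = carrier P"
    proof (rule Rp.Q_generated[OF \<alpha>.preimage_subalg[OF C]])
      show x: "Rp.x i l \<in> {p \<in> carrier P. \<alpha> p \<in> ?C}" if "i \<in> {1..n}" "l \<in> {1..n}" for i l
        using that lj comm_gen by (simp add: y_eq)
      show "inv\<^bsub>P\<^esub> (Rp.x i l) \<in> {p \<in> carrier P. \<alpha> p \<in> ?C}" if il: "(i, l) \<in> Ep" for i l
      proof -
        note u = Rp.x_unit[OF il]
        have "Rp.x i l \<in> {p \<in> carrier P. \<alpha> p \<in> ?C}" using il ent_mem index_mem by (intro x) auto
        then show ?thesis
          using u AG.centralizer_inv[OF \<alpha>.unit_inv(1)[OF u], of "\<beta> (z l' j)"] lj \<alpha>.unit_inv[OF u]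
          by simp
      qed
    qed
    with p show ?thesis by blast
  qed
  have comm: "\<alpha> p \<otimes>\<^bsub>T.AG\<^esub> \<beta> m = \<beta> m \<otimes>\<^bsub>T.AG\<^esub> \<alpha> p" if p: "p \<in> carrier P" and m: "m \<in> carrier N" for p m
  proof -
    let ?C = "{x \<in> carrier T.AG. \<forall>w\<in>{\<alpha> p}. x \<otimes>\<^bsub>T.AG\<^esub> w = w \<otimes>\<^bsub>T.AG\<^esub> x}"
    have C: "subalg K T.AG ?C" by (rule AG.centralizer_subalg) (use p in simp)
    have "{m \<in> carrier N. \<beta> m \<in> ?C} = carrier N"
    proof (rule Rm.Q_generated[OF \<beta>.preimage_subalg[OF C]])
      show x: "Rm.x i l \<in> {m \<in> carrier N. \<beta> m \<in> ?C}" if "i \<in> {1..n}" "l \<in> {1..n}" for i l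
        using that p comm_z by (simp add: z_eq)
      show "inv\<^bsub>N\<^esub> (Rm.x i l) \<in> {m \<in> carrier N. \<beta> m \<in> ?C}" if il: "(i, l) \<in> Em" for i l
      proof -
        note u = Rm.x_unit[OF il]
        have "Rm.x i l \<in> {m \<in> carrier N. \<beta> m \<in> ?C}" using il ent_mem index_mem by (intro x) auto
        then show ?thesis
          using u AG.centralizer_inv[OF \<beta>.unit_inv(1)[OF u], of "\<alpha> p"] p \<beta>.unit_inv[OF u]
          by simp
      qed
    qed
    with m have "\<beta> m \<in> ?C" by blast
    then show ?thesis by simp
  qed
  obtain \<Delta> where \<Delta>: "\<Delta> \<in> alg_hom K T T.AG"
    and \<Delta>t: "\<And>p m. \<lbrakk>p \<in> carrier P; m \<in> carrier N\<rbrakk> \<Longrightarrow> \<Delta> (p \<otimes>\<^sub>T m) = \<alpha> p \<otimes>\<^bsub>T.AG\<^esub> \<beta> m"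
    using tensor_lift[OF AG.assoc_algebra_axioms \<alpha> \<beta> comm] by blast
  have \<Delta>Z: "\<Delta> (Z j) = single T (e j) (Z j)" if j: "j \<in> {1..t}" for j
    using j z_unit[OF j] index_mem[OF j] ent_mem[OF j]
    by (simp add: Z_def \<Delta>t \<alpha>.one \<beta>z)
  have zero: "\<Delta> g = single T (\<lambda>i. 0) g" if "g \<in> gens" for g
    using that unfolding gens_def
  proof
    assume "g \<in> {y i l \<otimes>\<^sub>T z l j | i j l. l \<in> {1..t} \<and> i \<in> {1..n} \<and> j \<in> {1..n} \<and> ent r l \<le> i \<and> ent c l \<le> j}"
    then obtain i j l where "g = y i l \<otimes>\<^sub>T z l j" "l \<in> {1..n}" "i \<in> {1..n}" "j \<in> {1..n}"
      using index_mem by blast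
    then show ?thesis by (simp add: \<Delta>t \<alpha>y \<beta>z T.single_AG_mult tens_mult)
  next
    assume "g \<in> {inv\<^bsub>P\<^esub> (y (ent r l) l) \<otimes>\<^sub>T inv\<^bsub>N\<^esub> (z l (ent c l)) | l. l \<in> {1..t}}"
    then obtain l where l: "l \<in> {1..t}"
      and g: "g = inv\<^bsub>P\<^esub> (y (ent r l) l) \<otimes>\<^sub>T inv\<^bsub>N\<^esub> (z l (ent c l))" by blast
    note u = y_unit[OF l] z_unit[OF l]
    have c: "inv\<^bsub>P\<^esub> (y (ent r l) l) \<in> carrier P" "inv\<^bsub>N\<^esub> (z l (ent c l)) \<in> carrier N"
      using u by auto
    \<comment> \<open>Inversion flips both weights, so the inverse pivots have degrees
      \<open>e l\<close> and \<open>- e l\<close>, which again cancel.\<close>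
    have "\<alpha> (inv\<^bsub>P\<^esub> (y (ent r l) l)) = single T (\<lambda>k. - (- e l k)) (inv\<^bsub>P\<^esub> (y (ent r l) l) \<otimes>\<^sub>T \<one>\<^bsub>N\<^esub>)"
      using u l.unit_inv[OF u(1)] T.single_AG_inverse(2)[OF l.unit_inv(1)[OF u(1)], of "\<lambda>k. - e l k"]
      by (simp add: \<alpha>.unit_inv \<alpha>y index_mem ent_mem l)
    moreover have "\<beta> (inv\<^bsub>N\<^esub> (z l (ent c l))) = single T (\<lambda>k. - e l k) (\<one>\<^bsub>P\<^esub> \<otimes>\<^sub>T inv\<^bsub>N\<^esub> (z l (ent c l)))"
      using u r.unit_inv[OF u(2)] T.single_AG_inverse(2)[OF r.unit_inv(1)[OF u(2)], of "e l"]
      by (simp add: \<beta>.unit_inv \<beta>z index_mem ent_mem l)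
    ultimately show ?thesis
      using c by (simp add: g \<Delta>t T.single_AG_mult tens_mult)
  qed
  \<comment> \<open>Embedding \<open>T\<close> in degree 0 is itself a homomorphism; its equalizer
    with \<open>\<Delta>\<close> is a subalgebra and so contains \<open>B\<close> once it contains
    the generators.\<close>
  have "(\<lambda>b. single T (\<lambda>i. 0) b) \<in> alg_hom K T T.AG"
    by (rule alg_homI)
      (simp_all add: T.single_AG_mult T.single_AG_add T.single_AG_one T.single_AG_smult)
  then have "subalg K T {b \<in> carrier T. \<Delta> b = single T (\<lambda>i. 0) b}"
    by (rule equalizer_subalg[OF T.assoc_algebra_axioms AG.assoc_algebra_axioms \<Delta>])
  then have "B \<subseteq> {b \<in> carrier T. \<Delta> b = single T (\<lambda>i. 0) b}"
    unfolding B_def by (rule T.generated_subalgebra_minimal) (use zero gens_closed in blast)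
  with \<Delta> \<Delta>Z show ?thesis unfolding e_def by blast
qed

lemma skew_laurent_B:
  "skew_laurent_extension T B t Z (\<lambda>s. torus2_act K n P y N z (\<tau> s))"
proof -
  obtain \<Delta> where \<Delta>: "\<Delta> \<in> alg_hom K T (coeff_algebra T deg_group)"
    "\<And>b. b \<in> B \<Longrightarrow> \<Delta> b = single T (\<lambda>i. 0) b"
    "\<And>j. j \<in> {1..t} \<Longrightarrow> \<Delta> (Z j) = single T (\<lambda>i. if i = j then 1 else 0) (Z j)"
    using grading by blast
  interpret graded_laurent K T t Z B \<Delta>
  proof unfold_locales
    show "Z i \<in> Units T" if "i \<in> {1..t}" for i using that by (rule Z_unit)
    show "subalg K T B" by (rule B_subalg)
    show "conj_by T (Z i) b \<in> B" if "i \<in> {1..t}" "b \<in> B" for i b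
      using that by (rule conj_B(1))
    show "conj_by T (inv\<^bsub>T\<^esub> (Z i)) b \<in> B" if "i \<in> {1..t}" "b \<in> B" for i b
      using that by (rule conj_B(2))
    show "U = carrier T" if "subalg K T U" "B \<subseteq> U" "\<And>i. i \<in> {1..t} \<Longrightarrow> Z i \<in> U \<and> inv\<^bsub>T\<^esub> (Z i) \<in> U" for U
      using that by (rule B_Z_generated)
    show "\<Delta> \<in> alg_hom K T (coeff_algebra T deg_group)" by (rule \<Delta>(1))
    show "\<Delta> b = single T (\<lambda>i. 0) b" if "b \<in> B" for b using that by (rule \<Delta>(2))
    show "\<Delta> (Z j) = single T (\<lambda>i. if i = j then 1 else 0) (Z j)" if "j \<in> {1..t}" for j
      using that by (rule \<Delta>(3))
    show "Z i \<otimes>\<^bsub>T\<^esub> Z j = Z j \<otimes>\<^bsub>T\<^esub> Z i" if "i \<in> {1..t}" "j \<in> {1..t}" for i j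
      using that by (rule Z_commute)
  qed
  show ?thesis
    by (rule skew_laurent_extension_cong[OF skew_laurent torus2_act_\<tau>])
qed

end

theorem lemma2p6:
  fixes K :: "('k, 'm) ring_scheme" and q :: 'k and n t :: nat and r c :: "nat list"
    and P :: "('k, 'a, 'u) module_scheme" and \<phi> :: "'k qmat set \<Rightarrow> 'a"
    and N :: "('k, 'b, 'v) module_scheme" and \<psi> :: "'k qmat set \<Rightarrow> 'b"
  defines "y \<equiv> \<lambda>i j. \<phi> (Rp0_Y K q n r i j)"
    and "z \<equiv> \<lambda>i j. \<psi> (Rm0_Z K q n c i j)"
  assumes "field K" and "n \<ge> 1" and "q \<in> Units K"
    and "(r, c) \<in> RC n" and "length r = t" and "length c = t"
    and "is_Rp K q n r P \<phi>"
    and "is_Rm K q n c N \<psi>"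
  shows "\<exists>\<tau>. (\<forall>i\<in>{1..t}. \<tau> i \<in> {torus_one K n} \<times> torus K n) \<and>
    skew_laurent_extension (tensor_algebra K P N) (Brc K n r c P y N z) t
      (\<lambda>i. tensor K P N \<one>\<^bsub>P\<^esub> (z i (ent c i)))
      (\<lambda>i. torus2_act K n P y N z (\<tau> i))"
proof -
  interpret field K by fact
  interpret Q: quantum_pair K q n r c t P \<phi> N \<psi>
    using assms by unfold_locales
  have y: "y = Q.y" and z: "z = Q.z"
    by (simp_all add: y_def z_def Q.y_def[abs_def] Q.z_def[abs_def])
  have Z: "(\<lambda>i. tensor K P N \<one>\<^bsub>P\<^esub> (Q.z i (ent c i))) = Q.Z"
    by (simp add: fun_eq_iff Q.Z_def)
  show ?thesis
    unfolding y z Z using Q.skew_laurent_B Q.\<tau>_mem by blast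
qed

end
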